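(* For every $\ell\ge 2$ and $r\ge 3$ there exist $c,K>0$ such that for all sufficiently large $n$ and every $t\ge K(\log n)^{r-2}$, there exists a collection $\mathcal{C}$ of $r$-graphs on $[n]$ such that (a) $|\mathcal{C}|\le\exp\left(c(\log n)^{2r-3}\max\left\{\left(\frac{t}{(\log n)^{r-2}}\right)^{-\frac{2\ell-2}{2(r-1)\ell^2-(r+2)\ell+2}}n^{1+1/\ell},\ \log n\cdot n^{1+\frac{1}{2\ell-1}}\right\}\right)$; (b) $e(G)\le tn^{1+1/\ell}$ for every $G\in\mathcal{C}$; (c) every $\mathcal{B}^r_{2\ell}$-free $r$-graph on $[n]$ is a subgraph of some $G\in\mathcal{C}$.
   Context: An $r$-graph is an $r$-uniform hypergraph; $e(G)$ is the number of edges. For $k\ge2$, $\mathcal{B}^r_k$ is the family of $r$-graphs with $k$ distinct edges $e_1,\dots,e_k$ for which there are $k$ distinct vertices $v_1,\dots,v_k$ with $v_{i-1},v_i\in e_i$ ($1\le i\le k$, $v_0=v_k$). $\mathcal{B}^r_{2\ell}$-free means containing no member of $\mathcal{B}^r_{2\ell}$ as a subgraph. *)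

theory Defs
  imports Complex_Main "HOL-Library.Ramsey"
begin

text \<open>
  An r-graph is identified with its set of edges, so e(G) is \<^term>\<open>card G\<close> and the subgraph relation
  is inclusion of edge sets. The vertex set is only relevant through the bound \<open>V\<close> below
  (isolated vertices play no role).
\<close>

definition r_graph_on :: "nat \<Rightarrow> 'a set \<Rightarrow> 'a set set \<Rightarrow> bool" where
  "r_graph_on r V G \<longleftrightarrow> G \<subseteq> nsets V r"

text \<open>
  All labelled copies, inside the type \<open>'a\<close>, of members of the family. The value \<open>v 0\<close> only encodes
  the cyclic convention. The core vertices \<open>v 1, \<dots>, v k\<close> are distinct, but \<open>e i\<close> may contain
  core vertices other than \<open>v (i - 1)\<close> and \<open>v i\<close>.
\<close>

definition berge_cycles :: "nat \<Rightarrow> nat \<Rightarrow> 'a set set set" where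
  "berge_cycles r k = {F. r_graph_on r UNIV F \<and>
     (\<exists>e v. inj_on e {1..k} \<and> F = e ` {1..k} \<and>
            inj_on v {1..k} \<and> v 0 = v k \<and>
            (\<forall>i\<in>{1..k}. v (i - 1) \<in> e i \<and> v i \<in> e i))}"

definition berge_free :: "nat \<Rightarrow> nat \<Rightarrow> 'a set set \<Rightarrow> bool" where
  "berge_free r k G \<longleftrightarrow> \<not> (\<exists>F\<in>berge_cycles r k. F \<subseteq> G)"

end

theory Submission
  imports Defs
begin

text \<open>
  A container theorem for weighted uniform hypergraphs is applied to the hypergraph whose vertices are the
  edges of an \<open>r\<close>-graph \<open>G\<close> and whose edges are the Berge \<open>2l\<close>-cycles of \<open>G\<close>. It shrinks \<open>G\<close> by a constant
  factor, so that \<open>O(ln n)\<close> rounds, starting from the complete \<open>r\<close>-graph, give the family.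

  The container theorem needs a weight on the Berge cycles whose degrees are spread out. A maximal weight
  subject to the desired degree bounds is heavy enough unless some subgraph with at least half of the edges
  has no cycle avoiding the saturated sets, the sets of edges whose degree has reached its bound. Such a
  cycle is found by comparing weighted counts of closed walks, and there are two cases, according to a
  threshold \<open>D\<close> for the codegrees of pairs. If many edges can be assigned pairs so that no pair is used more
  than \<open>D\<close> times, the pairs form a graph of bounded multiplicity. There one takes a random closed
  \<open>2l\<close>-walk, and log-convexity of the return probabilities bounds the mass of the walks through prescribed
  edges. Otherwise many edges span a subgraph in which all pairs have codegree above \<open>D\<close>. Most of its edges
  contain a triple whose codegree is much smaller than those of its pairs. For a vertex \<open>u\<close>, one takes a
  random walk in the link of \<open>u\<close> formed by these triples; closed up through \<open>u\<close>, it is a cycle of pairs, and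
  each pair is completed independently to a uniformly random edge.
\<close>

section \<open>Containers for weighted uniform hypergraphs\<close>

text \<open>The exponents come from balancing three upper bounds for \<open>S\<close>, the inverse
  of the \<tau> of the container theorem. A round costs about |G| / S fingerprint elements, so
  \<open>S\<close> should be large. Let G have t n^(1 + 1/l) edges and let \<delta>, of order t
  n^(1/l), be a minimum degree. In pair graphs of multiplicity D the mass of closed walks grows by
  at most 1 / \<theta> for every omitted step beyond the first, where \<theta> is the smaller of
  (\<delta> / (n D))^(1/(l-1)) and n^(-1/(2l-1)); this asks for S below \<theta> \<delta>. In wheels
  triples have a fraction 1 / d of the codegree of their pairs, up to constants, and S^(2l-1) must
  stay below (d D)^(2l-1) / d: one factor d is lost because a saturated set of 2 l edges can
  prescribe the whole cycle and leave no random step. Finally d^(r-2) is at most of order D, since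
  an edge with only heavy extensions is confined to about d vertices besides its poorest pair. With
  D = t^\<alpha>, d = t^\<beta>, \<alpha> = (r-2) \<beta>, equating the first and the third bound
  determines \<open>rate\<close>; the second part of \<theta> produces n^(1 + 1/(2l-1)).\<close>

definition wdeg :: "'a set \<Rightarrow> ('a set \<Rightarrow> real) \<Rightarrow> 'a set \<Rightarrow> real" where
  "wdeg V \<mu> \<sigma> = (\<Sum>A\<in>Pow V. if \<sigma> \<subseteq> A then \<mu> A else 0)"

definition uniform_weight :: "nat \<Rightarrow> 'a set \<Rightarrow> ('a set \<Rightarrow> real) \<Rightarrow> bool" where
  "uniform_weight h V \<mu> \<longleftrightarrow> (\<forall>A. 0 \<le> \<mu> A) \<and> (\<forall>A. \<mu> A \<noteq> 0 \<longrightarrow> A \<subseteq> V \<and> card A = h)"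

lemma sum_wdeg:
  assumes "finite V" "finite Q"
  shows "(\<Sum>\<sigma>\<in>Q. wdeg V \<mu> \<sigma>) = (\<Sum>A\<in>Pow V. real (card {\<sigma>\<in>Q. \<sigma> \<subseteq> A}) * \<mu> A)"
proof -
  have "(\<Sum>\<sigma>\<in>Q. wdeg V \<mu> \<sigma>) = (\<Sum>A\<in>Pow V. \<Sum>\<sigma>\<in>Q. if \<sigma> \<subseteq> A then \<mu> A else 0)"
    unfolding wdeg_def by (rule sum.swap)
  also have "\<dots> = (\<Sum>A\<in>Pow V. real (card {\<sigma>\<in>Q. \<sigma> \<subseteq> A}) * \<mu> A)"
    using assms by (intro sum.cong refl) (simp add: sum.If_cases Int_def)
  finally show ?thesis .
qed

lemma sum_wdeg_singletons:
  assumes "finite V" "uniform_weight h V \<mu>"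
  shows "(\<Sum>v\<in>V. wdeg V \<mu> {v}) = real h * wdeg V \<mu> {}"
proof -
  have "(\<Sum>v\<in>V. wdeg V \<mu> {v}) = (\<Sum>A\<in>Pow V. \<Sum>v\<in>V. if {v} \<subseteq> A then \<mu> A else 0)"
    unfolding wdeg_def by (rule sum.swap)
  also have "\<dots> = (\<Sum>A\<in>Pow V. real h * \<mu> A)"
  proof (intro sum.cong refl)
    fix A assume "A \<in> Pow V"
    then have "V \<inter> {v. v \<in> A} = A" by auto
    then have "(\<Sum>v\<in>V. if {v} \<subseteq> A then \<mu> A else 0) = real (card A) * \<mu> A"
      using assms by (simp add: sum.If_cases)
    then show "(\<Sum>v\<in>V. if {v} \<subseteq> A then \<mu> A else 0) = real h * \<mu> A"
      using assms unfolding uniform_weight_def by (cases "\<mu> A = 0") auto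
  qed
  finally show ?thesis by (simp add: wdeg_def sum_distrib_left)
qed

lemma wdeg_nonneg: "uniform_weight h V \<mu> \<Longrightarrow> 0 \<le> wdeg V \<mu> \<sigma>"
  unfolding wdeg_def uniform_weight_def by (intro sum_nonneg) auto

text \<open>Union bound: by spreadness the edges that meet \<open>Q\<close> and those that contain a
  set of \<open>S\<close> carry at most M / 4 each, so \<open>\<alpha>\<close> keeps half of the
  mass. Averaging its degrees over \<open>V\<close> gives M / (2 N), and a vertex of
  \<open>Q\<close> cannot attain this because its \<open>\<alpha>\<close>-degree is 0.\<close>

lemma exists_heavy_vertex:
  assumes fin: "finite V" and uni: "uniform_weight (Suc h) V \<mu>"
    and M: "M = wdeg V \<mu> {}" "M > 0" and N: "N = real (card V)" "N > 0"
    and spread: "\<And>\<sigma>. \<sigma> \<subseteq> V \<Longrightarrow> \<sigma> \<noteq> {} \<Longrightarrow> wdeg V \<mu> \<sigma> \<le> C * M / N * \<tau> ^ (card \<sigma> - 1)"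
    and Q: "Q \<subseteq> V" "real (card Q) * (C * M / N) \<le> M / 4"
    and S: "S \<subseteq> Pow V - {{}}" "(\<Sum>\<sigma>\<in>S. C * M / N * \<tau> ^ (card \<sigma> - 1)) \<le> M / 4"
    and al: "\<alpha> = (\<lambda>A. if A \<inter> Q = {} \<and> (\<forall>\<sigma>\<in>S. \<not> \<sigma> \<subseteq> A) then \<mu> A else 0)"
  shows "\<exists>v\<in>V - Q. wdeg V \<alpha> {v} \<ge> M / (2 * N)"
proof (rule ccontr)
  assume neg: "\<not> ?thesis"
  have pos: "0 \<le> \<mu> A" for A using uni by (auto simp: uniform_weight_def)
  have fS: "finite S" using S fin by (meson finite_Diff finite_Pow_iff finite_subset)
  have fQ: "finite Q" using Q fin finite_subset by auto
  have uni': "uniform_weight (Suc h) V \<alpha>" using uni unfolding uniform_weight_def al by auto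
  define T where "T = S \<union> (\<lambda>v. {v}) ` Q"
  have fT: "finite T" using fS fQ T_def by auto
  have "M = (\<Sum>A\<in>Pow V. \<mu> A)" by (simp add: M wdeg_def)
  also have "\<dots> \<le> (\<Sum>A\<in>Pow V. \<alpha> A + real (card {\<sigma>\<in>T. \<sigma> \<subseteq> A}) * \<mu> A)"
  proof (intro sum_mono)
    fix A
    show "\<mu> A \<le> \<alpha> A + real (card {\<sigma>\<in>T. \<sigma> \<subseteq> A}) * \<mu> A"
    proof (cases "A \<inter> Q = {} \<and> (\<forall>\<sigma>\<in>S. \<not> \<sigma> \<subseteq> A)")
      case True then show ?thesis using pos by (simp add: al)
    next
      case False
      then have "{\<sigma>\<in>T. \<sigma> \<subseteq> A} \<noteq> {}" unfolding T_def by auto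
      then have "1 \<le> real (card {\<sigma>\<in>T. \<sigma> \<subseteq> A})"
        using fT by (simp add: Suc_le_eq card_gt_0_iff)
      then have "1 * \<mu> A \<le> real (card {\<sigma>\<in>T. \<sigma> \<subseteq> A}) * \<mu> A"
        using pos mult_right_mono by blast
      moreover have "0 \<le> \<alpha> A" using pos by (simp add: al)
      ultimately show ?thesis by simp
    qed
  qed
  also have "\<dots> = wdeg V \<alpha> {} + (\<Sum>\<sigma>\<in>T. wdeg V \<mu> \<sigma>)"
    by (subst sum_wdeg[OF fin fT]) (simp add: sum.distrib wdeg_def)
  also have "(\<Sum>\<sigma>\<in>T. wdeg V \<mu> \<sigma>) \<le> (\<Sum>\<sigma>\<in>S. wdeg V \<mu> \<sigma>) + (\<Sum>\<sigma>\<in>(\<lambda>v. {v}) ` Q. wdeg V \<mu> \<sigma>)"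
    unfolding T_def using fS fQ
    by (subst sum.union_inter[symmetric]) (auto intro!: sum_nonneg wdeg_nonneg[OF uni])
  also have "(\<Sum>\<sigma>\<in>S. wdeg V \<mu> \<sigma>) \<le> M / 4"
    using S by (intro order_trans[OF sum_mono S(2)] spread) auto
  also have "(\<Sum>\<sigma>\<in>(\<lambda>v. {v}) ` Q. wdeg V \<mu> \<sigma>) = (\<Sum>v\<in>Q. wdeg V \<mu> {v})"
    by (subst sum.reindex) (auto simp: inj_on_def)
  also have "\<dots> \<le> (\<Sum>v\<in>Q. C * M / N)"
    using Q spread[of "{v}" for v] by (intro sum_mono) auto
  also have "\<dots> \<le> M / 4" using Q(2) by simp
  finally have "M / 2 \<le> wdeg V \<alpha> {}" by simp
  also have "\<dots> \<le> real (Suc h) * wdeg V \<alpha> {}"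
    using wdeg_nonneg[OF uni', of "{}"] by (simp add: algebra_simps)
  also have "\<dots> = (\<Sum>v\<in>V. wdeg V \<alpha> {v})"
    using sum_wdeg_singletons[OF fin uni'] by simp
  also have "\<dots> < (\<Sum>v\<in>V. M / (2 * N))"
  proof (rule sum_strict_mono)
    show "V \<noteq> {}" using N by auto
    fix v assume "v \<in> V"
    show "wdeg V \<alpha> {v} < M / (2 * N)"
    proof (cases "v \<in> Q")
      case True
      then have "wdeg V \<alpha> {v} = 0" unfolding wdeg_def al by (intro sum.neutral) auto
      then show ?thesis using M N by simp
    next
      case False then show ?thesis using neg \<open>v \<in> V\<close> by (meson DiffI not_le)
    qed
  qed (rule fin)
  also have "\<dots> = M / 2" using N by simp
  finally show False by simp
qed

definition link :: "'a set \<Rightarrow> ('a set \<Rightarrow> real) \<Rightarrow> 'a \<Rightarrow> 'a set \<Rightarrow> real" where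
  "link V \<mu> v B = (if B \<subseteq> V - {v} then \<mu> (insert v B) else 0)"

lemma wdeg_link:
  assumes "finite V" "v \<in> V" 
  shows "wdeg V (link V \<mu> v) \<sigma> = (if v \<in> \<sigma> then 0 else wdeg V \<mu> (insert v \<sigma>))"
proof (cases "v \<in> \<sigma>")
  case True
  have "wdeg V (link V \<mu> v) \<sigma> = 0" unfolding wdeg_def link_def using True by (intro sum.neutral) auto
  then show ?thesis using True by simp
next
  case False
  have "wdeg V (link V \<mu> v) \<sigma> = (\<Sum>B | B \<subseteq> V - {v} \<and> \<sigma> \<subseteq> B. \<mu> (insert v B))"
    unfolding wdeg_def using assms(1)
    by (intro sum.mono_neutral_cong_right) (auto simp: link_def split: if_splits)
  also have "\<dots> = (\<Sum>A | A \<subseteq> V \<and> insert v \<sigma> \<subseteq> A. \<mu> A)"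
    using assms(2) False
    by (intro sum.reindex_bij_witness[of _ "\<lambda>A. A - {v}" "insert v"]) blast+
  also have "\<dots> = wdeg V \<mu> (insert v \<sigma>)"
    unfolding wdeg_def using assms(1) by (intro sum.mono_neutral_cong_left) (auto split: if_splits)
  finally show ?thesis using False by simp
qed

lemma wdeg_add: "wdeg V (\<lambda>A. \<mu> A + \<nu> A) \<sigma> = wdeg V \<mu> \<sigma> + wdeg V \<nu> \<sigma>"
  proof -
  have "wdeg V (\<lambda>A. \<mu> A + \<nu> A) \<sigma> = (\<Sum>A\<in>Pow V. (if \<sigma> \<subseteq> A then \<mu> A else 0) + (if \<sigma> \<subseteq> A then \<nu> A else 0))"
    unfolding wdeg_def by (intro sum.cong) auto
  then show ?thesis by (simp add: wdeg_def sum.distrib)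
qed

definition edge_free :: "('a set \<Rightarrow> real) \<Rightarrow> 'a set \<Rightarrow> bool" where
  "edge_free \<mu> I \<longleftrightarrow> (\<forall>A. \<mu> A \<noteq> 0 \<longrightarrow> \<not> A \<subseteq> I)"

text \<open>The common shape of all container statements: \<open>s\<close> bounds the size of a
  container and \<open>g\<close> their number. Both are real because they arise from products of
  real powers.\<close>

definition covered :: "'a set \<Rightarrow> ('a set \<Rightarrow> bool) \<Rightarrow> real \<Rightarrow> real \<Rightarrow> bool" where
  "covered V P s g \<longleftrightarrow> (\<exists>\<C>. finite \<C> \<and> real (card \<C>) \<le> g \<and> (\<forall>U\<in>\<C>. U \<subseteq> V \<and> real (card U) \<le> s) \<and>
     (\<forall>I\<subseteq>V. P I \<longrightarrow> (\<exists>U\<in>\<C>. I \<subseteq> U)))"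

lemma coveredI:
  "finite \<C> \<Longrightarrow> real (card \<C>) \<le> g \<Longrightarrow> (\<And>U. U \<in> \<C> \<Longrightarrow> U \<subseteq> V \<and> real (card U) \<le> s) \<Longrightarrow>
    (\<And>I. I \<subseteq> V \<Longrightarrow> P I \<Longrightarrow> \<exists>U\<in>\<C>. I \<subseteq> U) \<Longrightarrow> covered V P s g"
  unfolding covered_def by (rule exI[of _ \<C>]) simp

lemma coveredE:
  assumes "covered V P s g"
  obtains \<C> where "finite \<C>" "real (card \<C>) \<le> g" "\<And>U. U \<in> \<C> \<Longrightarrow> U \<subseteq> V" "\<And>U. U \<in> \<C> \<Longrightarrow> real (card U) \<le> s"
    "\<And>I. I \<subseteq> V \<Longrightarrow> P I \<Longrightarrow> \<exists>U\<in>\<C>. I \<subseteq> U"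
  using assms unfolding covered_def by (elim exE conjE) simp

lemma covered_mono:
  assumes "covered V P s g" "\<And>I. I \<subseteq> V \<Longrightarrow> P' I \<Longrightarrow> P I" "s \<le> s'" "g \<le> g'"
  shows "covered V P' s' g'"
  using assms(1)
proof (rule coveredE)
  fix \<C> assume *: "finite \<C>" "real (card \<C>) \<le> g" "\<And>U. U \<in> \<C> \<Longrightarrow> U \<subseteq> V" "\<And>U. U \<in> \<C> \<Longrightarrow> real (card U) \<le> s"
    "\<And>I. I \<subseteq> V \<Longrightarrow> P I \<Longrightarrow> \<exists>U\<in>\<C>. I \<subseteq> U"
  show ?thesis
    by (rule coveredI[of \<C>]) (use * assms(2-4) in \<open>fastforce+\<close>)
qed

lemma covered_disj:
  assumes "covered V P s g" "covered V P' s g'"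
  shows "covered V (\<lambda>I. P I \<or> P' I) s (g + g')"
  using assms(1)
proof (rule coveredE)
  fix \<C> assume 1: "finite \<C>" "real (card \<C>) \<le> g" "\<And>U. U \<in> \<C> \<Longrightarrow> U \<subseteq> V" "\<And>U. U \<in> \<C> \<Longrightarrow> real (card U) \<le> s"
    "\<And>I. I \<subseteq> V \<Longrightarrow> P I \<Longrightarrow> \<exists>U\<in>\<C>. I \<subseteq> U"
  from assms(2) show ?thesis
  proof (rule coveredE)
    fix \<C>' assume 2: "finite \<C>'" "real (card \<C>') \<le> g'" "\<And>U. U \<in> \<C>' \<Longrightarrow> U \<subseteq> V" "\<And>U. U \<in> \<C>' \<Longrightarrow> real (card U) \<le> s"
      "\<And>I. I \<subseteq> V \<Longrightarrow> P' I \<Longrightarrow> \<exists>U\<in>\<C>'. I \<subseteq> U"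
    show ?thesis
    proof (rule coveredI[of "\<C> \<union> \<C>'"])
      show "real (card (\<C> \<union> \<C>')) \<le> g + g'"
        using 1(2) 2(2) card_Un_le[of \<C> \<C>'] by linarith
      show "\<exists>U\<in>\<C> \<union> \<C>'. I \<subseteq> U" if "I \<subseteq> V" "P I \<or> P' I" for I
        using that 1(5)[of I] 2(5)[of I] by blast
      show "U \<subseteq> V \<and> real (card U) \<le> s" if "U \<in> \<C> \<union> \<C>'" for U
        using that 1(3,4)[of U] 2(3,4)[of U] by blast
    qed (use 1 2 in simp)
  qed
qed

text \<open>
  Branching on a vertex \<open>v\<close> of large degree among the edges that avoid \<open>R \<union> S\<close> and the saturated sets of \<open>\<nu>\<close>:
  either \<open>v\<close> lies in the independent set, joins \<open>S\<close> and its link is added to \<open>\<nu>\<close>, or it joins \<open>R\<close>. The budgets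
  \<open>k\<close> and \<open>a\<close> bound how often either can still happen.
\<close>

lemma container_process:
  fixes V :: "'a set" and \<mu> :: "'a set \<Rightarrow> real" and M N C \<tau> \<epsilon> :: real
  assumes fin: "finite V" and uni: "uniform_weight (Suc h) V \<mu>"
    and M: "M = wdeg V \<mu> {}" "M > 0" and N: "N = real (card V)" "N > 0"
    and spread: "\<And>\<sigma>. \<sigma> \<subseteq> V \<Longrightarrow> \<sigma> \<noteq> {} \<Longrightarrow> wdeg V \<mu> \<sigma> \<le> C * M / N * \<tau> ^ (card \<sigma> - 1)"
    and C: "C \<ge> 1" and \<tau>: "0 < \<tau>" "\<tau> \<le> 1"
    and b: "real b * (2 ^ h * C\<^sup>2) \<le> \<tau> * N / 8"
    and \<epsilon>: "\<epsilon> * C \<le> 1 / 8" "0 < \<epsilon>" 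
    and final: "\<And>\<nu>. uniform_weight h V \<nu> \<Longrightarrow> wdeg V \<nu> {} \<ge> b * M / (2 * N) \<Longrightarrow>
        (\<And>\<sigma>. \<sigma> \<subseteq> V \<Longrightarrow> \<sigma> \<noteq> {} \<Longrightarrow> wdeg V \<nu> \<sigma> \<le> (1 + C) * M / N * \<tau> ^ card \<sigma>) \<Longrightarrow>
        covered V (edge_free \<nu>) ((1 - \<epsilon>) * N) g"
    and g: "g \<ge> 1"
  shows "R \<subseteq> V \<Longrightarrow> S \<subseteq> V \<Longrightarrow> card S + k = b \<Longrightarrow> real (card R) + real a \<ge> \<epsilon> * N \<Longrightarrow> 
    uniform_weight h V \<nu> \<Longrightarrow> (\<And>B. \<nu> B \<noteq> 0 \<Longrightarrow> \<exists>v\<in>S. \<mu> (insert v B) \<noteq> 0) \<Longrightarrow>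
    wdeg V \<nu> {} \<ge> card S * M / (2 * N) \<Longrightarrow> wdeg V \<nu> {} \<le> card S * (C * M / N) \<Longrightarrow>
    (\<And>\<sigma>. \<sigma> \<subseteq> V \<Longrightarrow> \<sigma> \<noteq> {} \<Longrightarrow> wdeg V \<nu> \<sigma> \<le> (1 + C) * M / N * \<tau> ^ card \<sigma>) \<Longrightarrow>
    covered V (\<lambda>I. edge_free \<mu> I \<and> S \<subseteq> I \<and> R \<inter> I = {}) ((1 - \<epsilon>) * N) ((real a + 1) ^ k * g)"
proof (induction "a + k" arbitrary: a k R S \<nu> rule: less_induct)
  case less
  note IH = less.hyps and R = \<open>R \<subseteq> V\<close> and S = \<open>S \<subseteq> V\<close> and Sk = \<open>card S + k = b\<close>
    and Ra = \<open>\<epsilon> * N \<le> real (card R) + real a\<close> and uni\<nu> = \<open>uniform_weight h V \<nu>\<close>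
    and supp = less.prems(6) and low = less.prems(7) and up = less.prems(8) and cap = less.prems(9)
  have fR: "finite R" and fS: "finite S" using R S fin finite_subset by auto
  have g_ge: "g \<le> (real a + 1) ^ k * g" "1 \<le> (real a + 1) ^ k * g"
  proof -
    have "1 * g \<le> (real a + 1) ^ k * g" using g by (intro mult_right_mono) (auto intro: one_le_power)
    then show "g \<le> (real a + 1) ^ k * g" by simp
    then show "1 \<le> (real a + 1) ^ k * g" using g by linarith
  qed
  \<comment> \<open>Once \<open>R\<close> has \<epsilon> N vertices, its complement is small enough
    to be the container. Once k = 0, the weight \<open>\<nu>\<close> has collected b links and is
    heavy enough for the containers of uniformity h.\<close>
  consider (big) "\<epsilon> * N \<le> real (card R)" | (finished) "k = 0" | (step) "real (card R) < \<epsilon> * N" "k > 0"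
    by linarith
  then show ?case
  proof cases
    case big
    show ?thesis
    proof (rule coveredI[of "{V - R}"])
      show "U \<subseteq> V \<and> real (card U) \<le> (1 - \<epsilon>) * N" if "U \<in> {V - R}" for U
        using that big R fin N card_mono[OF fin R] by (auto simp: card_Diff_subset[OF fR R] algebra_simps of_nat_diff)
    qed (use g_ge in auto)
  next
    case finished
    then have "card S = b" using Sk by simp
    then have "covered V (edge_free \<nu>) ((1 - \<epsilon>) * N) g"
      using low cap by (intro final[OF uni\<nu>]) auto
    then show ?thesis
    proof (rule covered_mono)
      fix I assume "edge_free \<mu> I \<and> S \<subseteq> I \<and> R \<inter> I = {}"
      then show "edge_free \<nu> I" using supp unfolding edge_free_def by (metis insert_subset subset_iff)
    qed (use g_ge in auto)
  next
    case step
    then have a: "a > 0" using Ra by (cases a) auto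
    have Sb: "card S < b" using Sk step by simp
    define Q where "Q = R \<union> S"
    \<comment> \<open>Saturation starts at M / N \<tau>^|\<sigma>|, while one link adds at most C M
      / N \<tau>^|\<sigma>|. A set below the threshold can therefore afford one more link, which
      explains the factor 1 + C in \<open>cap\<close>.\<close>
    define \<S> where "\<S> = {\<sigma>. \<sigma> \<subseteq> V \<and> \<sigma> \<noteq> {} \<and> M / N * \<tau> ^ card \<sigma> \<le> wdeg V \<nu> \<sigma>}"
    define \<alpha> where "\<alpha> = (\<lambda>A. if A \<inter> Q = {} \<and> (\<forall>\<sigma>\<in>\<S>. \<not> \<sigma> \<subseteq> A) then \<mu> A else 0)"
    have bC: "real b * C\<^sup>2 * 2 ^ h \<le> \<tau> * N / 8" using b by (simp add: mult_ac)
    have bC1: "real b * C \<le> N / 8"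
    proof -
      have "real b * C * 1 \<le> real b * C * (C * 2 ^ h)"
        using C by (intro mult_left_mono) (auto intro!: mult_ge1_I one_le_power simp: mult_ge1_I)
      also have "\<dots> \<le> \<tau> * N / 8" using bC by (simp add: power2_eq_square mult_ac)
      also have "\<dots> \<le> N / 8" using \<tau> N mult_right_mono[of \<tau> 1 N] by simp
      finally show ?thesis by simp
    qed
    have Qb: "real (card Q) * (C * M / N) \<le> M / 4"
    proof -
      have "real (card Q) \<le> \<epsilon> * N + b"
        using card_Un_le[of R S] step Sb by (simp add: Q_def)
      then have "real (card Q) * (C * M / N) \<le> (\<epsilon> * N + b) * (C * M / N)"
        using M N C by (intro mult_right_mono) auto
      also have "\<dots> = (\<epsilon> * C) * M + (b * C) * (M / N)" using N by (simp add: field_simps)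
      also have "\<dots> \<le> (1/8) * M + (N / 8) * (M / N)"
        using \<epsilon> M N bC1 by (intro add_mono mult_right_mono) auto
      also have "\<dots> = M / 4" using N by (simp add: field_simps)
      finally show ?thesis .
    qed
    have f\<S>: "finite \<S>" unfolding \<S>_def using fin by auto
    have \<nu>pos: "0 \<le> \<nu> A" for A using uni\<nu> by (auto simp: uniform_weight_def)
    \<comment> \<open>An edge of \<open>\<nu>\<close> has h elements, hence at most 2^h saturated
      subsets. As every saturated set has large \<open>\<nu>\<close>-degree, this double count
      limits how many there are, weighted by size, and thereby the \<open>\<mu>\<close>-mass of the
      edges that contain one.\<close>
    have "(\<Sum>\<sigma>\<in>\<S>. wdeg V \<nu> \<sigma>) = (\<Sum>A\<in>Pow V. real (card {\<sigma>\<in>\<S>. \<sigma> \<subseteq> A}) * \<nu> A)"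
      by (rule sum_wdeg[OF fin f\<S>])
    also have "\<dots> \<le> (\<Sum>A\<in>Pow V. 2 ^ h * \<nu> A)"
    proof (rule sum_mono)
      fix A assume "A \<in> Pow V"
      then have fA: "finite A" using fin finite_subset by auto
      show "real (card {\<sigma>\<in>\<S>. \<sigma> \<subseteq> A}) * \<nu> A \<le> 2 ^ h * \<nu> A"
      proof (cases "\<nu> A = 0")
        case False
        then have "card A = h" using uni\<nu> by (auto simp: uniform_weight_def)
        moreover have "card {\<sigma>\<in>\<S>. \<sigma> \<subseteq> A} \<le> card (Pow A)" using fA by (intro card_mono) auto
        ultimately have "card {\<sigma>\<in>\<S>. \<sigma> \<subseteq> A} \<le> 2 ^ h" by (simp add: card_Pow fA)
        then have "real (card {\<sigma>\<in>\<S>. \<sigma> \<subseteq> A}) \<le> 2 ^ h" by (metis of_nat_le_iff of_nat_numeral of_nat_power)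
        then show ?thesis using \<nu>pos by (intro mult_right_mono) auto
      qed simp
    qed
    also have "\<dots> = 2 ^ h * wdeg V \<nu> {}" by (simp add: wdeg_def sum_distrib_left)
    also have "\<dots> \<le> 2 ^ h * (real b * (C * M / N))"
      using up Sb C M N by (intro mult_left_mono order_trans[OF up] mult_right_mono) auto
    finally have sat: "(\<Sum>\<sigma>\<in>\<S>. wdeg V \<nu> \<sigma>) \<le> 2 ^ h * (real b * (C * M / N))" .
    have "(\<Sum>\<sigma>\<in>\<S>. C * M / N * \<tau> ^ (card \<sigma> - 1)) \<le> (\<Sum>\<sigma>\<in>\<S>. C / \<tau> * wdeg V \<nu> \<sigma>)"
    proof (rule sum_mono)
      fix \<sigma> assume \<sigma>: "\<sigma> \<in> \<S>"
      then have "card \<sigma> > 0" using fin finite_subset unfolding \<S>_def by (auto simp: card_gt_0_iff)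
      then obtain j where j: "card \<sigma> = Suc j" by (cases "card \<sigma>") auto
      have "C * M / N * \<tau> ^ (card \<sigma> - 1) = C / \<tau> * (M / N * \<tau> ^ card \<sigma>)"
        using \<tau> by (simp add: j)
      also have "\<dots> \<le> C / \<tau> * wdeg V \<nu> \<sigma>"
        using \<sigma> C \<tau> unfolding \<S>_def by (intro mult_left_mono) auto
      finally show "C * M / N * \<tau> ^ (card \<sigma> - 1) \<le> C / \<tau> * wdeg V \<nu> \<sigma>" .
    qed
    also have "\<dots> = C / \<tau> * (\<Sum>\<sigma>\<in>\<S>. wdeg V \<nu> \<sigma>)" by (simp add: sum_distrib_left)
    also have "\<dots> \<le> C / \<tau> * (2 ^ h * (real b * (C * M / N)))"
      using sat C \<tau> by (intro mult_left_mono) auto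
    also have "\<dots> = (real b * C\<^sup>2 * 2 ^ h) * (M / (\<tau> * N))" by (simp add: field_simps power2_eq_square)
    also have "\<dots> \<le> (\<tau> * N / 8) * (M / (\<tau> * N))" using bC M N \<tau> by (intro mult_right_mono) auto
    also have "\<dots> \<le> M / 4" using M N \<tau> by (simp add: field_simps)
    finally have sat2: "(\<Sum>\<sigma>\<in>\<S>. C * M / N * \<tau> ^ (card \<sigma> - 1)) \<le> M / 4" .
    obtain v where v: "v \<in> V" "v \<notin> R" "v \<notin> S" "M / (2 * N) \<le> wdeg V \<alpha> {v}"
      using exists_heavy_vertex[OF fin uni M N spread _ Qb _ sat2 \<alpha>_def] R S
      unfolding Q_def \<S>_def by blast
    have \<alpha>le: "wdeg V \<alpha> \<sigma> \<le> wdeg V \<mu> \<sigma>" for \<sigma>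
      unfolding wdeg_def \<alpha>_def using uni by (intro sum_mono) (auto simp: uniform_weight_def)
    have uni\<alpha>: "uniform_weight (Suc h) V \<alpha>" using uni unfolding uniform_weight_def \<alpha>_def by auto
    define \<nu>' where "\<nu>' = (\<lambda>B. \<nu> B + link V \<alpha> v B)"
    have uni\<nu>': "uniform_weight h V \<nu>'"
      unfolding uniform_weight_def
    proof (intro conjI allI impI)
      fix A
      show "0 \<le> \<nu>' A" using \<nu>pos uni\<alpha> by (auto simp: \<nu>'_def link_def uniform_weight_def intro!: add_nonneg_nonneg)
      assume "\<nu>' A \<noteq> 0"
      then consider "\<nu> A \<noteq> 0" | "link V \<alpha> v A \<noteq> 0" by (cases "\<nu> A = 0") (auto simp: \<nu>'_def)
      then have "A \<subseteq> V \<and> card A = h"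
      proof cases
        case 2
        then have *: "A \<subseteq> V - {v}" "\<alpha> (insert v A) \<noteq> 0" by (auto simp: link_def split: if_splits)
        then have "card (insert v A) = Suc h" using uni\<alpha> by (auto simp: uniform_weight_def)
        moreover have "finite A" "v \<notin> A" using * fin finite_subset by auto
        ultimately show ?thesis using * by auto
      qed (use uni\<nu> in \<open>auto simp: uniform_weight_def\<close>)
      then show "A \<subseteq> V" "card A = h" by auto
    qed
    have deg': "wdeg V \<nu>' \<sigma> = wdeg V \<nu> \<sigma> + (if v \<in> \<sigma> then 0 else wdeg V \<alpha> (insert v \<sigma>))" for \<sigma>
      unfolding \<nu>'_def wdeg_add using wdeg_link[OF fin v(1)] by simp
    have "covered V (\<lambda>I. edge_free \<mu> I \<and> insert v S \<subseteq> I \<and> R \<inter> I = {}) ((1 - \<epsilon>) * N) ((real a + 1) ^ (k - 1) * g)"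
    proof (rule IH)
      show "a + (k - 1) < a + k" "card (insert v S) + (k - 1) = b" using step Sk v fS by auto
      show "insert v S \<subseteq> V" using S v by auto
      show "\<exists>x\<in>insert v S. \<mu> (insert x B) \<noteq> 0" if "\<nu>' B \<noteq> 0" for B
      proof (cases "\<nu> B = 0")
        case True
        then have "\<alpha> (insert v B) \<noteq> 0" using that by (auto simp: \<nu>'_def link_def split: if_splits)
        then show ?thesis by (auto simp: \<alpha>_def split: if_splits)
      qed (use supp in auto)
      have c: "card (insert v S) = Suc (card S)" using v fS by simp
      show "real (card (insert v S)) * M / (2 * N) \<le> wdeg V \<nu>' {}"
        using low v(4) unfolding deg' c by (simp add: algebra_simps add_divide_distrib)
      have "wdeg V \<alpha> {v} \<le> C * M / N" using \<alpha>le[of "{v}"] spread[of "{v}"] v by simp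
      then show "wdeg V \<nu>' {} \<le> real (card (insert v S)) * (C * M / N)"
        using up unfolding deg' c by (simp add: algebra_simps add_divide_distrib)
      show "wdeg V \<nu>' \<sigma> \<le> (1 + C) * M / N * \<tau> ^ card \<sigma>" if \<sigma>: "\<sigma> \<subseteq> V" "\<sigma> \<noteq> {}" for \<sigma>
      proof (cases "v \<in> \<sigma> \<or> \<sigma> \<in> \<S>")
        case True
        \<comment> \<open>The link of \<open>v\<close> in \<open>\<alpha>\<close> has no edge over a
          saturated set, so a degree stops growing after it has passed the threshold.\<close>
        have "wdeg V \<alpha> (insert v \<sigma>) = 0" if "\<sigma> \<in> \<S>"
          unfolding wdeg_def \<alpha>_def using that by (intro sum.neutral) auto
        then show ?thesis using True cap[OF \<sigma>] by (auto simp: deg')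
      next
        case False
        then have 1: "wdeg V \<nu> \<sigma> \<le> M / N * \<tau> ^ card \<sigma>" using \<sigma> by (auto simp: \<S>_def)
        have "finite \<sigma>" using \<sigma> fin finite_subset by auto
        then have 2: "card (insert v \<sigma>) - 1 = card \<sigma>" using False by simp
        have "wdeg V \<alpha> (insert v \<sigma>) \<le> C * M / N * \<tau> ^ card \<sigma>"
          using \<alpha>le[of "insert v \<sigma>"] spread[of "insert v \<sigma>"] \<sigma> v(1) 2 by simp
        then show ?thesis using 1 False by (simp add: deg' algebra_simps add_divide_distrib)
      qed
    qed (use R Ra uni\<nu>' in auto)
    moreover have "covered V (\<lambda>I. edge_free \<mu> I \<and> S \<subseteq> I \<and> insert v R \<inter> I = {}) ((1 - \<epsilon>) * N) ((real (a - 1) + 1) ^ k * g)"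
    proof (rule IH[OF _ _ S Sk _ uni\<nu> supp low up cap])
      show "\<epsilon> * N \<le> real (card (insert v R)) + real (a - 1)" using v fR Ra a by simp
    qed (use R v(1) a in auto)
    ultimately have "covered V (\<lambda>I. (edge_free \<mu> I \<and> insert v S \<subseteq> I \<and> R \<inter> I = {}) \<or>
        (edge_free \<mu> I \<and> S \<subseteq> I \<and> insert v R \<inter> I = {})) ((1 - \<epsilon>) * N)
        ((real a + 1) ^ (k - 1) * g + (real (a - 1) + 1) ^ k * g)"
      by (rule covered_disj)
    then show ?thesis
    proof (rule covered_mono)
      obtain k' where k': "k = Suc k'" using step by (cases k) auto
      \<comment> \<open>The recursion behind the count (a + 1)^k: accepting \<open>v\<close> leaves
        (a + 1)^(k - 1), rejecting it leaves a^k.\<close>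
      have "(real a + 1) ^ (k - 1) + (real (a - 1) + 1) ^ k = (real a + 1) ^ k' + real a * real a ^ k'"
        using a by (simp add: k')
      also have "\<dots> \<le> (real a + 1) ^ k' + real a * (real a + 1) ^ k'"
        by (intro add_left_mono mult_left_mono power_mono) auto
      also have "\<dots> = (real a + 1) ^ k" by (simp add: k' algebra_simps)
      finally have "((real a + 1) ^ (k - 1) + (real (a - 1) + 1) ^ k) * g \<le> (real a + 1) ^ k * g"
        using g by (intro mult_right_mono) auto
      then show "(real a + 1) ^ (k - 1) * g + (real (a - 1) + 1) ^ k * g \<le> (real a + 1) ^ k * g"
        by (simp add: algebra_simps)
    qed auto
  qed
qed

text \<open>For singletons the bound is C M / N, a constant times the average degree; each further
  element of \<open>\<sigma>\<close> gains a factor \<open>\<tau>\<close>.\<close>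

definition spread :: "'a set \<Rightarrow> real \<Rightarrow> real \<Rightarrow> ('a set \<Rightarrow> real) \<Rightarrow> bool" where
  "spread V C \<tau> \<mu> \<longleftrightarrow>
     (\<forall>\<sigma>\<subseteq>V. \<sigma> \<noteq> {} \<longrightarrow> wdeg V \<mu> \<sigma> \<le> C * wdeg V \<mu> {} / real (card V) * \<tau> ^ (card \<sigma> - 1))"

text \<open>The count is that of fingerprints: about K \<tau> |V| elements with at most |V| + 1
  choices for each. The summand 1 covers values of \<open>\<tau>\<close> for which \<tau> |V| drops
  below 1.\<close>

definition has_containers :: "'a set \<Rightarrow> ('a set \<Rightarrow> real) \<Rightarrow> real \<Rightarrow> real \<Rightarrow> real \<Rightarrow> bool" where
  "has_containers V \<mu> \<epsilon> K \<tau> \<longleftrightarrow> covered V (edge_free \<mu>) ((1 - \<epsilon>) * real (card V))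
     ((real (card V) + 1) powr (K * (\<tau> * real (card V) + 1)))"

text \<open>Running the branching process until about \<beta> \<tau> N vertices are accepted
  produces a weight \<open>\<nu>\<close> of uniformity h with mass of order \<beta> \<tau> M and
  degrees at most (1 + C) M / N \<tau>^|\<sigma>|. It is again spread, with \<open>C'\<close> in
  place of \<open>C\<close>, so containers for \<open>\<nu>\<close> finish every branch that has not
  rejected \<epsilon> N vertices.\<close>

lemma container_Suc:
  fixes C :: real
  assumes IH: "\<And>C::real. C \<ge> 1 \<Longrightarrow> \<exists>\<epsilon>>0. \<exists>K\<ge>0. \<forall>(V :: 'a set) \<mu> \<tau>. finite V \<longrightarrow> V \<noteq> {} \<longrightarrow> 0 < \<tau> \<longrightarrow> \<tau> \<le> 1 \<longrightarrow>
      uniform_weight h V \<mu> \<longrightarrow> 0 < wdeg V \<mu> {} \<longrightarrow> spread V C \<tau> \<mu> \<longrightarrow> has_containers V \<mu> \<epsilon> K \<tau>"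
   and C: "C \<ge> 1"
  shows "\<exists>\<epsilon>>0. \<exists>K\<ge>0. \<forall>(V :: 'a set) \<mu> \<tau>. finite V \<longrightarrow> V \<noteq> {} \<longrightarrow> 0 < \<tau> \<longrightarrow> \<tau> \<le> 1 \<longrightarrow>
      uniform_weight (Suc h) V \<mu> \<longrightarrow> 0 < wdeg V \<mu> {} \<longrightarrow> spread V C \<tau> \<mu> \<longrightarrow> has_containers V \<mu> \<epsilon> K \<tau>"
proof -
  \<comment> \<open>The power 2^(h + 4) makes b 2^h C^2 at most \<tau>' N / 16, within the budget of
    the branching process.\<close>
  define \<beta> where "\<beta> = 1 / (2 ^ (h + 4) * C\<^sup>2)"
  have C2: "1 \<le> C\<^sup>2" using C by (simp add: one_le_power)
  have "(1::real) \<le> 2 ^ (h + 4) * C\<^sup>2" using C C2 by (intro mult_ge1_I one_le_power) auto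
  then have \<beta>: "0 < \<beta>" "\<beta> \<le> 1" unfolding \<beta>_def using C by (auto simp: field_simps)
  define C' where "C' = 4 * (1 + C) / \<beta>"
  have "\<beta> \<le> 4 * (1 + C)" using order_trans[OF \<beta>(2), of "4 * (1 + C)"] C by simp
  then have "C' \<ge> 1" unfolding C'_def using \<beta> by (simp add: field_simps)
  from IH[OF this] obtain \<epsilon>' K' where \<epsilon>': "\<epsilon>' > 0" and K': "K' \<ge> 0" and
    cont: "\<forall>(V :: 'a set) \<mu> \<tau>. finite V \<longrightarrow> V \<noteq> {} \<longrightarrow> 0 < \<tau> \<longrightarrow> \<tau> \<le> 1 \<longrightarrow>
      uniform_weight h V \<mu> \<longrightarrow> 0 < wdeg V \<mu> {} \<longrightarrow> spread V C' \<tau> \<mu> \<longrightarrow> has_containers V \<mu> \<epsilon>' K' \<tau>"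
    by (elim exE conjE) (rule that)
  \<comment> \<open>The three bounds serve the containers of lower uniformity, the mass lost to
    rejected vertices, and the case of bounded \<open>N\<close>.\<close>
  define \<epsilon> where "\<epsilon> = min \<epsilon>' (min (1 / (8 * C)) \<beta>)"
  have \<epsilon>: "\<epsilon> > 0" "\<epsilon> \<le> \<epsilon>'" "\<epsilon> \<le> \<beta>" "\<epsilon> * C \<le> 1 / 8" "\<epsilon> \<le> 1"
  proof -
    show "\<epsilon> > 0" unfolding \<epsilon>_def using \<epsilon>' \<beta> C by auto
    have "\<epsilon> \<le> 1 / (8 * C)" unfolding \<epsilon>_def by auto
    then show "\<epsilon> * C \<le> 1 / 8" using C by (simp add: field_simps)
  qed (use \<beta> in \<open>auto simp: \<epsilon>_def\<close>)
  define K where "K = (1 + K') * (1 + 1 / \<beta>)"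
  have K: "1 / \<beta> \<le> K" "0 \<le> K"
  proof -
    have "1 * (1 + 1 / \<beta>) \<le> K" unfolding K_def using K' \<beta> by (intro mult_right_mono) auto
    then show "1 / \<beta> \<le> K" by simp
    then show "0 \<le> K" using \<beta> by (meson divide_nonneg_pos order_trans zero_le_one)
  qed
  show ?thesis
  proof (rule exI[of _ \<epsilon>], intro conjI exI[of _ K] allI impI)
    fix V :: "'a set" and \<mu> \<tau>
    assume fin: "finite V" and ne: "V \<noteq> {}" and \<tau>: "0 < \<tau>" "\<tau> \<le> 1" and uni: "uniform_weight (Suc h) V \<mu>"
      and M: "0 < wdeg V \<mu> {}" and spr: "spread V C \<tau> \<mu>"
    define N where "N = real (card V)"
    define M where "M = wdeg V \<mu> {}"
    have N: "N \<ge> 1" unfolding N_def using fin ne by (simp add: Suc_le_eq card_gt_0_iff)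
    show "has_containers V \<mu> \<epsilon> K \<tau>"
    \<comment> \<open>If \<open>N\<close> is below the constant 1 / \<beta>, all proper subsets of
      \<open>V\<close> are affordable as containers, and \<open>V\<close> itself is not independent
      because the mass is positive.\<close>
    proof (cases "\<beta> * N < 1")
      case True
      have "covered V (edge_free \<mu>) ((1 - \<epsilon>) * N) ((N + 1) powr (K * (\<tau> * N + 1)))"
      proof (rule coveredI[of "Pow V - {V}"])
        have "real (card (Pow V - {V})) \<le> 2 ^ card V"
          using fin by (simp add: card_Diff_subset card_Pow of_nat_diff)
        also have "\<dots> = 2 powr N" by (simp add: N_def powr_realpow)
        also have "\<dots> \<le> (N + 1) powr N" using N by (intro powr_mono2) auto
        also have "\<dots> \<le> (N + 1) powr (K * (\<tau> * N + 1))"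
        proof (rule powr_mono)
          have "N \<le> 1 / \<beta>" using True \<beta> by (simp add: field_simps)
          also have "\<dots> \<le> K * 1" using K by simp
          also have "\<dots> \<le> K * (\<tau> * N + 1)" using K \<tau> N by (intro mult_left_mono) auto
          finally show "N \<le> K * (\<tau> * N + 1)" .
        qed (use N in auto)
        finally show "real (card (Pow V - {V})) \<le> (N + 1) powr (K * (\<tau> * N + 1))" .
      next
        fix U assume "U \<in> Pow V - {V}"
        then have "card U < card V" "U \<subseteq> V" using fin psubset_card_mono[of V U] by auto
        then have "real (card U) \<le> N - 1" unfolding N_def by linarith
        also have "\<dots> \<le> (1 - \<epsilon>) * N"
        proof -
          have "\<epsilon> * N \<le> \<beta> * N" using \<epsilon> N by (intro mult_right_mono) auto
          then show ?thesis using True by (simp add: algebra_simps)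
        qed
        finally show "U \<subseteq> V \<and> real (card U) \<le> (1 - \<epsilon>) * N" using \<open>U \<subseteq> V\<close> by simp
      next
        fix I assume I: "I \<subseteq> V" "edge_free \<mu> I"
        have "\<exists>A\<in>Pow V. \<mu> A \<noteq> 0"
        proof (rule ccontr)
          assume "\<not> ?thesis"
          then have "wdeg V \<mu> {} = 0" unfolding wdeg_def by (intro sum.neutral) auto
          then show False using M by simp
        qed
        then have "I \<noteq> V" using I unfolding edge_free_def by auto
        then show "\<exists>U\<in>Pow V - {V}. I \<subseteq> U" using I by blast
      qed (use fin in auto)
      then show ?thesis by (simp add: has_containers_def N_def)
    next
      case False
      then have \<beta>N: "\<beta> * N \<ge> 1" by simp
      \<comment> \<open>Raising \<open>\<tau>\<close> to at least 1 / (\<beta> N) keeps the weight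
        spread and guarantees b \<ge> 1. It adds only the constant 1 / \<beta> to \<tau> N.\<close>
      define \<tau>' where "\<tau>' = max \<tau> (1 / (\<beta> * N))"
      have \<tau>': "\<tau> \<le> \<tau>'" "0 < \<tau>'" "\<tau>' \<le> 1" "1 / (\<beta> * N) \<le> \<tau>'"
        unfolding \<tau>'_def using \<tau> \<beta>N by auto
      have \<tau>'N: "\<tau>' * N \<le> \<tau> * N + 1 / \<beta>"
      proof -
        have "\<tau>' * N \<le> (\<tau> + 1 / (\<beta> * N)) * N" using \<tau> \<beta> N unfolding \<tau>'_def by (intro mult_right_mono) auto
        also have "\<dots> = \<tau> * N + 1 / \<beta>" using N by (simp add: field_simps)
        finally show ?thesis .
      qed
      define b where "b = nat \<lfloor>\<beta> * \<tau>' * N\<rfloor>"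
      have x1: "1 \<le> \<beta> * \<tau>' * N" using \<tau>'(4) \<beta> N by (simp add: field_simps)
      have b: "real b \<le> \<beta> * \<tau>' * N" "\<beta> * \<tau>' * N / 2 \<le> real b" "1 \<le> b"
        proof -
        have "1 \<le> \<lfloor>\<beta> * \<tau>' * N\<rfloor>" using x1 by simp
        then have "real b = of_int \<lfloor>\<beta> * \<tau>' * N\<rfloor>" "1 \<le> b" unfolding b_def by linarith+
        then show "real b \<le> \<beta> * \<tau>' * N" "\<beta> * \<tau>' * N / 2 \<le> real b" "1 \<le> b" 
          using x1 by linarith+
      qed
      define g where "g = (N + 1) powr (K' * (\<tau>' * N + 1))"
      have g: "g \<ge> 1" unfolding g_def using N K' \<tau>' by (intro ge_one_powr_ge_zero) auto
      define a where "a = nat \<lceil>\<epsilon> * N\<rceil>"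
      have aN: "real a \<le> N" "\<epsilon> * N \<le> real a"
      proof -
        have "\<epsilon> * N \<le> N" using \<epsilon> N by (simp add: mult_le_cancel_right1)
        then have "\<lceil>\<epsilon> * N\<rceil> \<le> int (card V)" unfolding N_def by (simp add: ceiling_le_iff)
        then show "real a \<le> N" unfolding a_def N_def by linarith
        show "\<epsilon> * N \<le> real a" unfolding a_def by linarith
      qed
      have M0: "M > 0" using M by (simp add: M_def)
      have spr': "wdeg V \<mu> \<sigma> \<le> C * M / N * \<tau>' ^ (card \<sigma> - 1)" if "\<sigma> \<subseteq> V" "\<sigma> \<noteq> {}" for \<sigma>
      proof -
        have "wdeg V \<mu> \<sigma> \<le> C * M / N * \<tau> ^ (card \<sigma> - 1)"
          using spr that by (auto simp: spread_def M_def N_def)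
        also have "\<dots> \<le> C * M / N * \<tau>' ^ (card \<sigma> - 1)"
          using C M0 N \<tau> \<tau>' by (intro mult_left_mono power_mono) auto
        finally show ?thesis .
      qed
      have "covered V (\<lambda>I. edge_free \<mu> I \<and> {} \<subseteq> I \<and> {} \<inter> I = {}) ((1 - \<epsilon>) * N) ((real a + 1) ^ b * g)"
      proof (rule container_process[OF fin uni M_def M0 N_def _ spr' C \<tau>'(2,3) _ \<epsilon>(4,1), where \<nu> = "\<lambda>_. 0"])
        have "real b * (2 ^ h * C\<^sup>2) \<le> \<beta> * \<tau>' * N * (2 ^ h * C\<^sup>2)"
          using b C by (intro mult_right_mono) auto
        also have "\<dots> = \<tau>' * N / 16" unfolding \<beta>_def using C by (simp add: field_simps power_add)
        also have "\<dots> \<le> \<tau>' * N / 8" using \<tau>' N by simp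
        finally show "real b * (2 ^ h * C\<^sup>2) \<le> \<tau>' * N / 8" .
      next
        fix \<nu> assume \<nu>: "uniform_weight h V \<nu>" "real b * M / (2 * N) \<le> wdeg V \<nu> {}"
          and cap: "\<And>\<sigma>. \<sigma> \<subseteq> V \<Longrightarrow> \<sigma> \<noteq> {} \<Longrightarrow> wdeg V \<nu> \<sigma> \<le> (1 + C) * M / N * \<tau>' ^ card \<sigma>"
        have M': "\<beta> * \<tau>' * M / 4 \<le> wdeg V \<nu> {}"
        proof -
          have "\<beta> * \<tau>' * M / 4 = (\<beta> * \<tau>' * N / 2) * M / (2 * N)" using N by (simp add: field_simps)
          also have "\<dots> \<le> real b * M / (2 * N)" using b M0 N by (intro divide_right_mono mult_right_mono) auto
          also note \<nu>(2)
          finally show ?thesis .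
        qed
        moreover have "0 < \<beta> * \<tau>' * M / 4" using \<beta> \<tau>' M0 by simp
        ultimately have pos: "0 < wdeg V \<nu> {}" by linarith
        have "spread V C' \<tau>' \<nu>"
          unfolding spread_def
        proof (intro allI impI)
          fix \<sigma> assume \<sigma>: "\<sigma> \<subseteq> V" "\<sigma> \<noteq> {}"
          then have "card \<sigma> > 0" using fin finite_subset by (auto simp: card_gt_0_iff)
          then obtain j where j: "card \<sigma> = Suc j" by (cases "card \<sigma>") auto
          have "wdeg V \<nu> \<sigma> \<le> (1 + C) * M / N * \<tau>' ^ card \<sigma>" by (rule cap[OF \<sigma>])
          also have "\<dots> = C' * (\<beta> * \<tau>' * M / 4) / N * \<tau>' ^ (card \<sigma> - 1)"
            unfolding C'_def j using \<beta> N by (simp add: field_simps)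
          also have "\<dots> \<le> C' * wdeg V \<nu> {} / N * \<tau>' ^ (card \<sigma> - 1)"
            using M' \<open>C' \<ge> 1\<close> \<tau>' N by (intro mult_right_mono divide_right_mono mult_left_mono) auto
          finally show "wdeg V \<nu> \<sigma> \<le> C' * wdeg V \<nu> {} / real (card V) * \<tau>' ^ (card \<sigma> - 1)"
            by (simp add: N_def)
        qed
        from cont[rule_format, OF fin ne \<tau>'(2,3) \<nu>(1) pos this]
        have "covered V (edge_free \<nu>) ((1 - \<epsilon>') * N) g" by (simp add: has_containers_def N_def g_def)
        then show "covered V (edge_free \<nu>) ((1 - \<epsilon>) * N) g"
          by (rule covered_mono) (use \<epsilon> N in auto)
      qed (use N g aN M0 C \<tau>' in \<open>auto simp: uniform_weight_def wdeg_def intro!: mult_nonneg_nonneg\<close>)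
      then have "covered V (edge_free \<mu>) ((1 - \<epsilon>) * N) ((N + 1) powr (K * (\<tau> * N + 1)))"
      proof (rule covered_mono)
        have "(real a + 1) ^ b * g \<le> (N + 1) ^ b * g"
          using aN g by (intro mult_right_mono power_mono) auto
        also have "\<dots> = (N + 1) powr (real b + K' * (\<tau>' * N + 1))"
          unfolding g_def using N by (simp add: powr_add powr_realpow)
        also have "\<dots> \<le> (N + 1) powr (K * (\<tau> * N + 1))"
        proof (rule powr_mono)
          have "real b \<le> 1 * (\<tau>' * N)" using b(1) \<beta> \<tau>' N
            by (intro order_trans[OF b(1)]) (auto simp: mult.assoc intro!: mult_right_mono)
          then have "real b + K' * (\<tau>' * N + 1) \<le> (1 + K') * (\<tau>' * N + 1)" by (simp add: algebra_simps)
          also have "\<dots> \<le> (1 + K') * (\<tau> * N + 1 / \<beta> + 1)" using K' \<tau>'N by (intro mult_left_mono) auto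
          also have "\<dots> \<le> (1 + K') * ((1 + 1 / \<beta>) * (\<tau> * N + 1))"
          proof (rule mult_left_mono)
            have "0 \<le> (1 / \<beta>) * (\<tau> * N)" using \<beta> \<tau> N by simp
            then show "\<tau> * N + 1 / \<beta> + 1 \<le> (1 + 1 / \<beta>) * (\<tau> * N + 1)" by (simp add: algebra_simps)
          qed (use K' in auto)
          also have "\<dots> = K * (\<tau> * N + 1)" by (simp add: K_def)
          finally show "real b + K' * (\<tau>' * N + 1) \<le> K * (\<tau> * N + 1)" .
        qed (use N in auto)
        finally show "(real a + 1) ^ b * g \<le> (N + 1) powr (K * (\<tau> * N + 1))" .
      qed auto
      then show ?thesis by (simp add: has_containers_def N_def)
    qed
  qed (use \<epsilon> K in auto)
qed

text \<open>Induction on the uniformity. For h = 0 all mass lies on the empty set, which every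
  \<open>I\<close> contains, so no set is independent and the empty family suffices.\<close>

theorem hypergraph_containers:
  fixes C :: real
  assumes "C \<ge> 1"
  shows "\<exists>\<epsilon>>0. \<exists>K\<ge>0. \<forall>(V :: 'a set) \<mu> \<tau>. finite V \<longrightarrow> V \<noteq> {} \<longrightarrow> 0 < \<tau> \<longrightarrow> \<tau> \<le> 1 \<longrightarrow>
      uniform_weight h V \<mu> \<longrightarrow> 0 < wdeg V \<mu> {} \<longrightarrow> spread V C \<tau> \<mu> \<longrightarrow> has_containers V \<mu> \<epsilon> K \<tau>"
  using assms
proof (induction h arbitrary: C)
  case 0
  show ?case
  proof (rule exI[of _ 1], intro conjI exI[of _ 0] allI impI)
    fix V :: "'a set" and \<mu> and \<tau> :: real
    assume "uniform_weight 0 V \<mu>" "0 < wdeg V \<mu> {}" "finite V"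
    have "\<mu> {} \<noteq> 0"
    proof
      assume "\<mu> {} = 0"
      then have "\<mu> A = 0" if "A \<in> Pow V" for A
        using \<open>uniform_weight 0 V \<mu>\<close> \<open>finite V\<close> that finite_subset[of A V]
        unfolding uniform_weight_def by (cases "A = {}") auto
      then have "wdeg V \<mu> {} = 0" unfolding wdeg_def by (intro sum.neutral) auto
      then show False using \<open>0 < wdeg V \<mu> {}\<close> by simp
    qed
    then have "\<not> edge_free \<mu> I" for I unfolding edge_free_def by auto
    then show "has_containers V \<mu> 1 0 \<tau>" unfolding has_containers_def
      by (intro coveredI[of "{}"]) auto
  qed auto
next
  case (Suc h)
  then show ?case by (intro container_Suc) auto
qed

section \<open>Spread weights by a greedy choice\<close>

text \<open>
  A maximal admissible weight works, where multiples of a fixed unit make a maximum exist. The sets in \<open>Sat\<close>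
  are those whose degree is nearly at its bound; \<open>W\<close> consists of the vertices of unsaturated degree.
\<close>

lemma spread_weight_exists:
  fixes V :: "'a set" and \<A> :: "'a set set" and S :: real
  assumes fin: "finite V" and ne: "V \<noteq> {}" and h: "h \<ge> 1" and S: "S \<ge> 1"
    and \<A>: "\<And>A. A \<in> \<A> \<Longrightarrow> A \<subseteq> V \<and> card A = h"
    and rich: "\<And>W Sat. W \<subseteq> V \<Longrightarrow> card V \<le> 2 * card W \<Longrightarrow> Sat \<subseteq> Pow V \<Longrightarrow>
      (\<And>\<sigma>. \<sigma> \<in> Sat \<Longrightarrow> 2 \<le> card \<sigma> \<and> card \<sigma> \<le> h) \<Longrightarrow>
      (\<And>e j. e \<in> W \<Longrightarrow> 2 \<le> j \<Longrightarrow> j \<le> h \<Longrightarrow>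
         real (card {\<sigma>\<in>Sat. e \<in> \<sigma> \<and> card \<sigma> = j}) \<le> 2 ^ (h + 1) * S ^ (j - 1)) \<Longrightarrow>
      \<exists>A\<in>\<A>. A \<subseteq> W \<and> (\<forall>\<sigma>\<in>Sat. \<not> \<sigma> \<subseteq> A)"
  shows "\<exists>\<mu>. uniform_weight h V \<mu> \<and> (\<forall>A. \<mu> A \<noteq> 0 \<longrightarrow> A \<in> \<A>) \<and> 0 < wdeg V \<mu> {} \<and>
    spread V (4 * real h) (1 / S) \<mu>"
proof -
  define N where "N = real (card V)"
  have N: "N > 0" unfolding N_def using fin ne by (simp add: card_gt_0_iff)
  \<comment> \<open>The degree bounds of a weight of total mass 1 that is spread with constant 4 h
    and parameter 1 / S.\<close>
  define cap where "cap = (\<lambda>j::nat. 4 * real h / N * (1 / S) ^ (j - 1))"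
  have cap_pos: "cap j > 0" for j unfolding cap_def using N h S by simp
  \<comment> \<open>Half of the smallest cap: a set that cannot take one more unit has then reached
    at least half of its cap.\<close>
  define \<eta> where "\<eta> = cap h / 2"
  have \<eta>: "\<eta> > 0" using cap_pos by (simp add: \<eta>_def)
  have \<eta>_le: "\<eta> \<le> cap j / 2" if "j \<le> h" for j
    unfolding \<eta>_def cap_def using that S N
    by (intro divide_right_mono mult_left_mono power_decreasing) auto
  define adm where "adm = (\<lambda>f :: 'a set \<Rightarrow> nat. (\<forall>A. f A \<noteq> 0 \<longrightarrow> A \<in> \<A>) \<and>
     (\<forall>\<sigma>\<subseteq>V. \<sigma> \<noteq> {} \<longrightarrow> wdeg V (\<lambda>A. \<eta> * real (f A)) \<sigma> \<le> cap (card \<sigma>)))"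
  define tot where "tot = (\<lambda>f :: 'a set \<Rightarrow> nat. \<Sum>A\<in>Pow V. f A)"
  have uni: "uniform_weight h V (\<lambda>A. \<eta> * real (f A))" if "adm f" for f
    using that \<A> \<eta> unfolding adm_def uniform_weight_def by auto
  have mass: "wdeg V (\<lambda>A. \<eta> * real (f A)) {} = \<eta> * real (tot f)" for f
    unfolding wdeg_def tot_def by (simp add: sum_distrib_left)
  have hand: "real h * (\<eta> * real (tot f)) = (\<Sum>v\<in>V. wdeg V (\<lambda>A. \<eta> * real (f A)) {v})" if "adm f" for f
    using sum_wdeg_singletons[OF fin uni[OF that]] by (simp add: mass)
  have bound: "tot f \<le> nat \<lfloor>4 / \<eta>\<rfloor>" if "adm f" for f
  proof -
    have "real h * (\<eta> * real (tot f)) \<le> (\<Sum>v\<in>V. cap 1)"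
      unfolding hand[OF that] using that unfolding adm_def by (intro sum_mono) auto
    also have "\<dots> = real h * 4" using N by (simp add: cap_def N_def)
    finally have "\<eta> * real (tot f) \<le> 4" using h by simp
    then have "real (tot f) \<le> 4 / \<eta>" using \<eta> by (simp add: field_simps)
    then show ?thesis by linarith
  qed
  have adm0: "adm (\<lambda>_. 0)"
  proof -
    have "wdeg V (\<lambda>A. \<eta> * real 0) \<sigma> = 0" for \<sigma> unfolding wdeg_def by (intro sum.neutral) auto
    then show ?thesis unfolding adm_def by (simp add: order.strict_implies_order[OF cap_pos])
  qed
  have "\<forall>f. adm f \<longrightarrow> tot f < Suc (nat \<lfloor>4 / \<eta>\<rfloor>)" using bound by (simp add: less_Suc_eq_le)
  from ex_has_greatest_nat[OF adm0 this] obtain f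
    where f: "adm f" and fmax: "\<And>f'. adm f' \<Longrightarrow> tot f' \<le> tot f" by (elim exE conjE) simp
  define \<mu> where "\<mu> = (\<lambda>A. \<eta> * real (f A))"
  have uni\<mu>: "uniform_weight h V \<mu>" using uni[OF f] by (simp add: \<mu>_def)
  have \<mu>0: "0 \<le> \<mu> A" for A using \<eta> by (simp add: \<mu>_def)
  have deg0: "0 \<le> wdeg V \<mu> \<sigma>" for \<sigma> by (rule wdeg_nonneg[OF uni\<mu>])
  have capf: "wdeg V \<mu> \<sigma> \<le> cap (card \<sigma>)" if "\<sigma> \<subseteq> V" "\<sigma> \<noteq> {}" for \<sigma>
    using f that unfolding adm_def \<mu>_def by auto
  have "1 \<le> wdeg V \<mu> {}"
  proof (rule ccontr)
    assume "\<not> ?thesis"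
    then have small: "\<eta> * real (tot f) < 1" by (simp add: \<mu>_def mass)
    define sat where "sat = (\<lambda>\<sigma>. cap (card \<sigma>) < wdeg V \<mu> \<sigma> + \<eta>)"
    define W where "W = {v\<in>V. \<not> sat {v}}"
    define Sat where "Sat = {\<sigma>. \<sigma> \<subseteq> V \<and> 2 \<le> card \<sigma> \<and> card \<sigma> \<le> h \<and> sat \<sigma>}"
    have WV: "W \<subseteq> V" and fW: "finite W" using fin by (auto simp: W_def)
    have fSat: "finite Sat" using fin by (auto simp: Sat_def)
    have sat_half: "cap (card \<sigma>) / 2 \<le> wdeg V \<mu> \<sigma>" if "sat \<sigma>" "card \<sigma> \<le> h" for \<sigma>
      using that \<eta>_le[of "card \<sigma>"] by (auto simp: sat_def)
    \<comment> \<open>A saturated vertex has degree at least cap 1 / 2 = 2 h / N, while all degrees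
      sum to at most h, so at most half of the vertices are saturated.\<close>
    have "real (card (V - W)) * (cap 1 / 2) = (\<Sum>v\<in>V - W. cap 1 / 2)" by simp
    also have "\<dots> \<le> (\<Sum>v\<in>V - W. wdeg V \<mu> {v})"
      using sat_half[of "{v}" for v] h by (intro sum_mono) (auto simp: W_def)
    also have "\<dots> \<le> (\<Sum>v\<in>V. wdeg V \<mu> {v})" using fin deg0 by (intro sum_mono2) auto
    also have "\<dots> = real h * (\<eta> * real (tot f))" using hand[OF f] by (simp add: \<mu>_def)
    also have "\<dots> \<le> real h * 1" using small by (intro mult_left_mono) auto
    finally have "2 * real (card (V - W)) \<le> N" using h N by (simp add: cap_def field_simps)
    moreover have "real (card (V - W)) = N - real (card W)"
      unfolding N_def using card_Diff_subset[OF fW WV] card_mono[OF fin WV] by (simp add: of_nat_diff)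
    ultimately have "real (card V) \<le> 2 * real (card W)" unfolding N_def by linarith
    then have WW: "card V \<le> 2 * card W" by linarith
    have "\<exists>A\<in>\<A>. A \<subseteq> W \<and> (\<forall>\<sigma>\<in>Sat. \<not> \<sigma> \<subseteq> A)"
    proof (rule rich[OF WV WW])
      fix e j assume e: "e \<in> W" and j: "2 \<le> j" "j \<le> h"
      define T where "T = {\<sigma>\<in>Sat. e \<in> \<sigma> \<and> card \<sigma> = j}"
      have fT: "finite T" using fSat by (simp add: T_def)
      \<comment> \<open>Double counting of saturated sets inside weighted edges: an edge through
        \<open>e\<close> contains at most 2^h of them, and the degree of \<open>e\<close> is at most
        cap 1.\<close>
      have "real (card T) * (cap j / 2) = (\<Sum>\<sigma>\<in>T. cap j / 2)" by simp
      also have "\<dots> \<le> (\<Sum>\<sigma>\<in>T. wdeg V \<mu> \<sigma>)"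
        using sat_half j by (intro sum_mono) (auto simp: T_def Sat_def)
      also have "\<dots> = (\<Sum>A\<in>Pow V. real (card {\<sigma>\<in>T. \<sigma> \<subseteq> A}) * \<mu> A)" by (rule sum_wdeg[OF fin fT])
      also have "\<dots> \<le> (\<Sum>A\<in>Pow V. 2 ^ h * (if {e} \<subseteq> A then \<mu> A else 0))"
      proof (rule sum_mono)
        fix A assume "A \<in> Pow V"
        then have fA: "finite A" using fin finite_subset by auto
        show "real (card {\<sigma>\<in>T. \<sigma> \<subseteq> A}) * \<mu> A \<le> 2 ^ h * (if {e} \<subseteq> A then \<mu> A else 0)"
        proof (cases "\<mu> A = 0 \<or> e \<notin> A")
          case True
          have "card {\<sigma>\<in>T. \<sigma> \<subseteq> A} = 0" if "e \<notin> A"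
            using that by (auto simp: T_def card_eq_0_iff)
          then show ?thesis using True by (cases "\<mu> A = 0") simp_all
        next
          case False
          then have "card A = h" using uni\<mu> by (auto simp: uniform_weight_def)
          moreover have "card {\<sigma>\<in>T. \<sigma> \<subseteq> A} \<le> card (Pow A)" using fA by (intro card_mono) auto
          ultimately have "card {\<sigma>\<in>T. \<sigma> \<subseteq> A} \<le> 2 ^ h" by (simp add: card_Pow fA)
          then have "real (card {\<sigma>\<in>T. \<sigma> \<subseteq> A}) \<le> 2 ^ h" by (metis of_nat_le_iff of_nat_numeral of_nat_power)
          then show ?thesis using \<mu>0 False by (auto intro!: mult_right_mono)
        qed
      qed
      also have "\<dots> = 2 ^ h * wdeg V \<mu> {e}" by (simp add: wdeg_def sum_distrib_left)
      also have "\<dots> \<le> 2 ^ h * cap 1"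
        using capf[of "{e}"] e WV by (intro mult_left_mono) auto
      finally have "real (card T) * cap j \<le> 2 ^ (h + 1) * cap 1" by simp
      also have "cap 1 = cap j * S ^ (j - 1)" using S by (simp add: cap_def power_one_over)
      finally have "cap j * real (card T) \<le> cap j * (2 ^ (h + 1) * S ^ (j - 1))" by (simp add: mult_ac)
      then show "real (card {\<sigma>\<in>Sat. e \<in> \<sigma> \<and> card \<sigma> = j}) \<le> 2 ^ (h + 1) * S ^ (j - 1)"
        using cap_pos[of j] by (simp add: T_def)
    qed (auto simp: Sat_def)
    then obtain A where A: "A \<in> \<A>" "A \<subseteq> W" and noSat: "\<And>\<sigma>. \<sigma> \<in> Sat \<Longrightarrow> \<not> \<sigma> \<subseteq> A" by blast
    have AV: "A \<subseteq> V" "card A = h" using \<A> A by auto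
    have fA: "finite A" using AV fin finite_subset by auto
    \<comment> \<open>One more unit on \<open>A\<close> breaks no cap, since \<open>A\<close>
      contains neither a saturated vertex nor a larger saturated set. This contradicts
      maximality.\<close>
    define f' where "f' = f(A := f A + 1)"
    have deg': "wdeg V (\<lambda>B. \<eta> * real (f' B)) \<sigma> = wdeg V \<mu> \<sigma> + (if \<sigma> \<subseteq> A then \<eta> else 0)" for \<sigma>
    proof -
      have "wdeg V (\<lambda>B. \<eta> * real (f' B)) \<sigma> =
        (\<Sum>B\<in>Pow V. (if \<sigma> \<subseteq> B then \<mu> B else 0) + (if B = A then (if \<sigma> \<subseteq> A then \<eta> else 0) else 0))"
        unfolding wdeg_def by (intro sum.cong refl) (auto simp: f'_def \<mu>_def algebra_simps)
      then show ?thesis using AV fin by (simp add: sum.distrib wdeg_def)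
    qed
    have "adm f'"
      unfolding adm_def
    proof (intro conjI allI impI)
      show "B \<in> \<A>" if "f' B \<noteq> 0" for B using that f A by (auto simp: f'_def adm_def split: if_splits)
      fix \<sigma> assume \<sigma>: "\<sigma> \<subseteq> V" "\<sigma> \<noteq> {}"
      show "wdeg V (\<lambda>B. \<eta> * real (f' B)) \<sigma> \<le> cap (card \<sigma>)"
      proof (cases "\<sigma> \<subseteq> A")
        case True
        then have ch: "card \<sigma> \<le> h" using AV fA card_mono by metis
        have "card \<sigma> > 0" using \<sigma> fin finite_subset by (auto simp: card_gt_0_iff)
        then consider "card \<sigma> = 1" | "2 \<le> card \<sigma>" by linarith
        then have "\<not> sat \<sigma>"
        proof cases
          case 1
          then obtain v where "\<sigma> = {v}" by (auto simp: card_1_singleton_iff)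
          then show ?thesis using True A by (auto simp: W_def)
        next
          case 2
          then show ?thesis using noSat[of \<sigma>] True ch \<sigma> by (auto simp: Sat_def)
        qed
        then show ?thesis using True by (simp add: deg' sat_def)
      qed (use capf[OF \<sigma>] in \<open>simp add: deg'\<close>)
    qed
    from fmax[OF this] have "tot f' \<le> tot f" .
    moreover have "tot f' = tot f + 1"
    proof -
      have "tot f' = (\<Sum>B\<in>Pow V. f B + (if B = A then 1 else 0))"
        unfolding tot_def f'_def by (intro sum.cong) auto
      then show ?thesis using AV fin by (simp add: sum.distrib tot_def)
    qed
    ultimately show False by simp
  qed
  moreover have "spread V (4 * real h) (1 / S) \<mu>"
    unfolding spread_def
  proof (intro allI impI)
    fix \<sigma> assume \<sigma>: "\<sigma> \<subseteq> V" "\<sigma> \<noteq> {}"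
    have "wdeg V \<mu> \<sigma> \<le> cap (card \<sigma>)" by (rule capf[OF \<sigma>])
    also have "\<dots> = 4 * real h * 1 / N * (1 / S) ^ (card \<sigma> - 1)" by (simp add: cap_def)
    also have "\<dots> \<le> 4 * real h * wdeg V \<mu> {} / N * (1 / S) ^ (card \<sigma> - 1)"
      using \<open>1 \<le> wdeg V \<mu> {}\<close> N S h by (intro mult_right_mono divide_right_mono mult_left_mono) auto
    finally show "wdeg V \<mu> \<sigma> \<le> 4 * real h * wdeg V \<mu> {} / real (card V) * (1 / S) ^ (card \<sigma> - 1)"
      by (simp add: N_def)
  qed
  moreover have "\<forall>A. \<mu> A \<noteq> 0 \<longrightarrow> A \<in> \<A>" using f \<eta> by (auto simp: \<mu>_def adm_def)
  ultimately show ?thesis using uni\<mu> by (intro exI[of _ \<mu>]) auto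
qed

section \<open>Closed walks and Berge cycles\<close>

text \<open>One step of a walk: from \<open>src\<close> to \<open>dst\<close> through the hyperedge
  \<open>edge\<close>, which has to be recorded because many hyperedges may contain the same
  pair.\<close>

type_synonym ('e, 'v) dart = "'e \<times> 'v \<times> 'v"

abbreviation edge :: "('e, 'v) dart \<Rightarrow> 'e" where "edge d \<equiv> fst d"
abbreviation src :: "('e, 'v) dart \<Rightarrow> 'v" where "src d \<equiv> fst (snd d)"
abbreviation dst :: "('e, 'v) dart \<Rightarrow> 'v" where "dst d \<equiv> snd (snd d)"

fun chain :: "'v \<Rightarrow> ('e, 'v) dart list \<Rightarrow> 'v \<Rightarrow> bool" where
  "chain x [] y \<longleftrightarrow> x = y"
| "chain x (d # a) y \<longleftrightarrow> src d = x \<and> chain (dst d) a y"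

text \<open>Entry (x, y) of a product of transfer matrices, one for each weight function in the
  list; different steps may use different weights.\<close>

fun walk_sum :: "('e, 'v) dart set \<Rightarrow> 'v \<Rightarrow> (('e, 'v) dart \<Rightarrow> real) list \<Rightarrow> 'v \<Rightarrow> real" where
  "walk_sum D x [] y = (if x = y then 1 else 0)"
| "walk_sum D x (c # cs) y = (\<Sum>d\<in>{d\<in>D. src d = x}. c d * walk_sum D (dst d) cs y)"

text \<open>Restricting the weights of single steps turns the sum over all walks into the sum over
  the walks that follow a prescribed pattern.\<close>

definition cut :: "('d \<Rightarrow> real) \<Rightarrow> 'd set \<Rightarrow> 'd \<Rightarrow> real" where
  "cut c A = (\<lambda>d. if d \<in> A then c d else 0)"

fun walk_weight :: "'v \<Rightarrow> (('e, 'v) dart \<Rightarrow> real) list \<Rightarrow> ('e, 'v) dart list \<Rightarrow> 'v \<Rightarrow> real" where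
  "walk_weight x [] [] y = (if x = y then 1 else 0)"
| "walk_weight x (c # cs) (d # a) y = (if src d = x then c d * walk_weight (dst d) cs a y else 0)"
| "walk_weight x _ _ y = 0"

lemma walk_sum_eq:
  assumes "finite D"
  shows "walk_sum D x cs y = (\<Sum>a | set a \<subseteq> D \<and> length a = length cs. walk_weight x cs a y)"
proof (induction cs arbitrary: x)
  case Nil
  have "{a. set a \<subseteq> D \<and> length a = length []} = {[]}" by auto
  then show ?case by simp
next
  case (Cons c cs)
  let ?L = "{a. set a \<subseteq> D \<and> length a = length cs}"
  have "(\<Sum>a | set a \<subseteq> D \<and> length a = length (c # cs). walk_weight x (c # cs) a y)
      = (\<Sum>(a, d)\<in>?L \<times> D. walk_weight x (c # cs) (d # a) y)"
  proof -
    have "{a. set a \<subseteq> D \<and> length a = length (c # cs)} = (\<lambda>(a, d). d # a) ` (?L \<times> D)"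
      using lists_length_Suc_eq[of D "length cs"] by simp
    moreover have "inj_on (\<lambda>(a, d). d # a) (?L \<times> D)" by (auto simp: inj_on_def)
    ultimately show ?thesis by (simp add: sum.reindex case_prod_unfold)
  qed
  also have "\<dots> = (\<Sum>d\<in>D. \<Sum>a\<in>?L. walk_weight x (c # cs) (d # a) y)"
    by (subst sum.swap) (simp add: sum.cartesian_product)
  also have "\<dots> = (\<Sum>d\<in>D. if src d = x then c d * walk_sum D (dst d) cs y else 0)"
    unfolding Cons.IH by (intro sum.cong refl) (simp add: sum_distrib_left)
  also have "\<dots> = walk_sum D x (c # cs) y"
    using assms by (simp add: sum.inter_filter)
  finally show ?case by simp
qed

lemma walk_weight_nonneg:
  "(\<And>c d. c \<in> set cs \<Longrightarrow> 0 \<le> c d) \<Longrightarrow> 0 \<le> walk_weight x cs a y"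
  by (induction x cs a y rule: walk_weight.induct) auto

lemma walk_weight_chain: "walk_weight x cs a y \<noteq> 0 \<Longrightarrow> chain x a y"
  by (induction x cs a y rule: walk_weight.induct) (auto split: if_splits)

lemma walk_weight_cut:
  "list_all2 (\<in>) a As \<Longrightarrow> length cs = length As \<Longrightarrow>
    walk_weight x (map2 cut cs As) a y = walk_weight x cs a y"
proof (induction a As arbitrary: x cs rule: list_all2_induct)
  case Nil
  then show ?case by simp
next
  case (Cons d a A As)
  then obtain c cs' where "cs = c # cs'" by (cases cs) auto
  then show ?case using Cons by (auto simp: cut_def)
qed

lemma walk_sum_nonneg:
  "finite D \<Longrightarrow> (\<And>c d. c \<in> set cs \<Longrightarrow> 0 \<le> c d) \<Longrightarrow> 0 \<le> walk_sum D x cs y"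
  unfolding walk_sum_eq by (intro sum_nonneg walk_weight_nonneg)

lemma map2_cut_nonneg:
  assumes "\<And>c d. c \<in> set cs \<Longrightarrow> 0 \<le> c d" "c \<in> set (map2 cut cs As)"
  shows "0 \<le> c d"
  using assms by (auto simp: set_zip cut_def)

text \<open>First moment argument: a closed walk that obeys the pattern \<open>f i\<close> keeps its
  full weight after the cuts, so if every closed walk obeyed some pattern, the pattern masses would
  add up to at least the total. The weights \<open>\<kappa> x\<close> may depend on the starting
  vertex, as the link walks require.\<close>

lemma closed_walk_exists:
  fixes \<kappa> :: "'v \<Rightarrow> (('e, 'v) dart \<Rightarrow> real) list" and f :: "'i \<Rightarrow> ('e, 'v) dart set list"
  assumes D: "finite D" and X: "finite X" and I: "finite I"
    and nonneg: "\<And>x c d. c \<in> set (\<kappa> x) \<Longrightarrow> 0 \<le> c d"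
    and len: "\<And>x. length (\<kappa> x) = n" "\<And>i. i \<in> I \<Longrightarrow> length (f i) = n"
    and less: "(\<Sum>i\<in>I. \<Sum>x\<in>X. walk_sum D x (map2 cut (\<kappa> x) (f i)) x) < (\<Sum>x\<in>X. walk_sum D x (\<kappa> x) x)"
  shows "\<exists>x\<in>X. \<exists>a. set a \<subseteq> D \<and> length a = n \<and> chain x a x \<and> (\<forall>i\<in>I. \<not> list_all2 (\<in>) a (f i))"
proof (rule ccontr)
  assume neg: "\<not> ?thesis"
  let ?L = "{a. set a \<subseteq> D \<and> length a = n}"
  have "(\<Sum>x\<in>X. walk_sum D x (\<kappa> x) x) = (\<Sum>x\<in>X. \<Sum>a\<in>?L. walk_weight x (\<kappa> x) a x)"
    by (simp add: walk_sum_eq[OF D] len)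
  also have "\<dots> \<le> (\<Sum>x\<in>X. \<Sum>a\<in>?L. \<Sum>i\<in>I. walk_weight x (map2 cut (\<kappa> x) (f i)) a x)"
  proof (intro sum_mono)
    fix x a assume x: "x \<in> X" and a: "a \<in> ?L"
    have nn: "0 \<le> walk_weight x (map2 cut (\<kappa> x) (f i)) a x" for i
      using map2_cut_nonneg[of "\<kappa> x"] nonneg by (intro walk_weight_nonneg) blast
    show "walk_weight x (\<kappa> x) a x \<le> (\<Sum>i\<in>I. walk_weight x (map2 cut (\<kappa> x) (f i)) a x)"
    proof (cases "walk_weight x (\<kappa> x) a x = 0")
      case True then show ?thesis using nn by (simp add: sum_nonneg)
    next
      case False
      then have "chain x a x" by (rule walk_weight_chain)
      then obtain i where i: "i \<in> I" "list_all2 (\<in>) a (f i)" using neg x a by blast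
      have "walk_weight x (\<kappa> x) a x = walk_weight x (map2 cut (\<kappa> x) (f i)) a x"
        using walk_weight_cut[OF i(2)] len i by simp
      also have "\<dots> \<le> (\<Sum>i\<in>I. walk_weight x (map2 cut (\<kappa> x) (f i)) a x)"
        using i I nn by (intro member_le_sum) auto
      finally show ?thesis .
    qed
  qed
  also have "\<dots> = (\<Sum>x\<in>X. \<Sum>i\<in>I. \<Sum>a\<in>?L. walk_weight x (map2 cut (\<kappa> x) (f i)) a x)"
    by (intro sum.cong refl sum.swap)
  also have "\<dots> = (\<Sum>i\<in>I. \<Sum>x\<in>X. \<Sum>a\<in>?L. walk_weight x (map2 cut (\<kappa> x) (f i)) a x)"
    by (rule sum.swap)
  also have "\<dots> = (\<Sum>i\<in>I. \<Sum>x\<in>X. walk_sum D x (map2 cut (\<kappa> x) (f i)) x)"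
    by (intro sum.cong refl) (simp add: walk_sum_eq[OF D] len)
  finally show False using less by simp
qed

lemma walk_sum_append:
  assumes D: "finite D" and V: "finite V" "\<And>d. d \<in> D \<Longrightarrow> dst d \<in> V" and x: "x \<in> V"
  shows "walk_sum D x (cs @ cs') y = (\<Sum>z\<in>V. walk_sum D x cs z * walk_sum D z cs' y)"
  using x
proof (induction cs arbitrary: x)
  case Nil
  have "(\<Sum>z\<in>V. walk_sum D x [] z * walk_sum D z cs' y) = (\<Sum>z\<in>V. if x = z then walk_sum D z cs' y else 0)"
    by (intro sum.cong) auto
  then show ?case using Nil V by simp
next
  case (Cons c cs)
  have "walk_sum D x ((c # cs) @ cs') y =
     (\<Sum>d\<in>{d\<in>D. src d = x}. \<Sum>z\<in>V. c d * walk_sum D (dst d) cs z * walk_sum D z cs' y)"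
    using Cons.IH V by (simp add: sum_distrib_left mult.assoc)
  also have "\<dots> = (\<Sum>z\<in>V. walk_sum D x (c # cs) z * walk_sum D z cs' y)"
    by (subst sum.swap) (simp add: sum_distrib_right)
  finally show ?case .
qed

lemma chain_first: "chain x a y \<Longrightarrow> a \<noteq> [] \<Longrightarrow> src (a ! 0) = x"
  by (cases a) auto

lemma chain_last: "chain x a y \<Longrightarrow> a \<noteq> [] \<Longrightarrow> dst (last a) = y"
  by (induction a arbitrary: x) (auto split: if_splits)

lemma chain_step: "chain x a y \<Longrightarrow> Suc i < length a \<Longrightarrow> src (a ! Suc i) = dst (a ! i)"
proof (induction a arbitrary: x i)
  case (Cons d a)
  then show ?case using chain_first[of "dst d" a y] by (cases i) auto
qed simp

lemma closed_walk_berge: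
  fixes a :: "('v set, 'v) dart list"
  assumes ch: "chain x a x" and len: "length a = k" and k: "k \<ge> 1"
    and inc: "\<And>d. d \<in> set a \<Longrightarrow> src d \<in> edge d \<and> dst d \<in> edge d \<and> finite (edge d) \<and> card (edge d) = r"
    and dist: "distinct (map edge a)" "distinct (map src a)"
  shows "edge ` set a \<in> berge_cycles r k"
proof -
  define e where "e = (\<lambda>i. edge (a ! (i - 1)))"
  \<comment> \<open>Core vertex i is the source of dart i, read cyclically so that v 0 = v k; the
    hyperedge e i belongs to dart i - 1 of the list.\<close>
  define v where "v = (\<lambda>i. src (a ! (i mod k)))"
  have ne: "a \<noteq> []" using len k by auto
  have inj_e: "inj_on e {1..k}"
  proof (rule inj_onI)
    fix i j assume "i \<in> {1..k}" "j \<in> {1..k}" "e i = e j"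
    then have "i - 1 = j - 1"
      using nth_eq_iff_index_eq[OF dist(1), of "i - 1" "j - 1"] len by (auto simp: e_def)
    then show "i = j" using \<open>i \<in> {1..k}\<close> \<open>j \<in> {1..k}\<close> by auto
  qed
  have inj_v: "inj_on v {1..k}"
  proof (rule inj_onI)
    fix i j assume ij: "i \<in> {1..k}" "j \<in> {1..k}" "v i = v j"
    have "i mod k < k" "j mod k < k" using k by auto
    then have "i mod k = j mod k"
      using ij(3) nth_eq_iff_index_eq[OF dist(2), of "i mod k" "j mod k"] len by (simp add: v_def)
    then show "i = j" using ij(1,2) by (cases "i = k"; cases "j = k") auto
  qed
  have img: "edge ` set a = e ` {1..k}"
  proof -
    have "{0..<k} = (\<lambda>i. i - 1) ` {1..k}"
      by (auto intro!: rev_image_eqI[of "Suc _"])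
    then have "e ` {1..k} = (\<lambda>i. edge (a ! i)) ` {0..<k}"
      by (simp add: e_def image_image)
    also have "\<dots> = edge ` (\<lambda>i. a ! i) ` {0..<k}" by (simp add: image_image)
    also have "(\<lambda>i. a ! i) ` {0..<k} = set a" using len by (auto simp: set_conv_nth)
    finally show ?thesis ..
  qed
  have inc': "v (i - 1) \<in> e i \<and> v i \<in> e i" if i: "i \<in> {1..k}" for i
  proof -
    have *: "a ! (i - 1) \<in> set a" using i len by auto
    have "i - 1 < k" using i by auto
    then have 1: "v (i - 1) = src (a ! (i - 1))" by (simp add: v_def)
    have 2: "v i = dst (a ! (i - 1))"
    proof (cases "i = k")
      case True
      then show ?thesis using chain_first[OF ch] chain_last[OF ch] ne len by (simp add: v_def last_conv_nth)
    next
      case False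
      then have "i < k" using i by auto
      moreover obtain j where "i = Suc j" using i by (cases i) auto
      ultimately show ?thesis using chain_step[OF ch, of j] len by (simp add: v_def)
    qed
    show ?thesis unfolding 1 2 using inc[OF *] by (auto simp: e_def)
  qed
  have "r_graph_on r UNIV (edge ` set a)"
    unfolding r_graph_on_def nsets_def using inc by auto
  moreover have "v 0 = v k" by (simp add: v_def)
  ultimately show ?thesis unfolding berge_cycles_def using inj_e inj_v img inc' by blast
qed

section \<open>Patterns of prescribed darts and the mass they carry\<close>

definition pat :: "('e, 'v) dart option list \<Rightarrow> ('e, 'v) dart set list" where
  "pat = map (\<lambda>p. case p of None \<Rightarrow> UNIV | Some d \<Rightarrow> {d})"

fun picked :: "'d option list \<Rightarrow> 'd list" where
  "picked [] = []"
| "picked (None # p) = picked p"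
| "picked (Some d # p) = d # picked p"

lemma set_picked: "set (picked p) = {d. Some d \<in> set p}"
  by (induction p rule: picked.induct) auto

lemma picked_map_if: "picked (map (\<lambda>i. if i \<in> P then Some (f i) else None) xs) = map f (filter (\<lambda>i. i \<in> P) xs)"
  by (induction xs) auto

text \<open>
  A pattern fixes some darts of a walk and leaves the others free; \<open>patterns D n (j, \<sigma>)\<close> fixes \<open>j\<close> darts, whose
  edges are exactly those of \<open>\<sigma>\<close>. In particular \<open>patterns D n (2, {e})\<close> describes the walks using the edge
  \<open>e\<close> twice. \<open>vpat\<close> describes the walks whose darts \<open>i\<close> and \<open>j\<close> start at the same vertex \<open>z\<close>.
\<close>

definition patterns :: "('e, 'v) dart set \<Rightarrow> nat \<Rightarrow> nat \<times> 'e set \<Rightarrow> ('e, 'v) dart option list set" where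
  "patterns D n = (\<lambda>(j, \<sigma>). {p. length p = n \<and> set (picked p) \<subseteq> D \<and> length (picked p) = j \<and> edge ` set (picked p) = \<sigma>})"

definition vpat :: "nat \<Rightarrow> nat \<times> nat \<times> 'v \<Rightarrow> ('e, 'v) dart set list" where
  "vpat n = (\<lambda>(i, j, z). map (\<lambda>m. if m = i \<or> m = j then {d. src d = z} else UNIV) [0..<n])"

text \<open>Each of the n places is free or holds one of at most n q darts over
  \<open>\<sigma>\<close>. The resulting constant is the \<open>c0\<close> of both cases, with q = 2
  for pair graphs and q = r^2 for wheels.\<close>

lemma card_patterns:
  assumes D: "finite D" and q: "\<And>e. e \<in> \<sigma> \<Longrightarrow> card {d\<in>D. edge d = e} \<le> q" and \<sigma>: "finite \<sigma>" "card \<sigma> \<le> n"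
  shows "finite (patterns D n (j, \<sigma>))" "card (patterns D n (j, \<sigma>)) \<le> (n * q + 1) ^ n"
proof -
  let ?B = "insert None (Some ` {d\<in>D. edge d \<in> \<sigma>})"
  have fB: "finite ?B" using D by auto
  have "{d\<in>D. edge d \<in> \<sigma>} = (\<Union>e\<in>\<sigma>. {d\<in>D. edge d = e})" by auto
  then have "card {d\<in>D. edge d \<in> \<sigma>} \<le> (\<Sum>e\<in>\<sigma>. card {d\<in>D. edge d = e})"
    using card_UN_le[OF \<sigma>(1)] by simp
  also have "\<dots> \<le> card \<sigma> * q" using sum_bounded_above[of \<sigma> _ q] q by simp
  also have "\<dots> \<le> n * q" using \<sigma> by simp
  finally have cB: "card ?B \<le> n * q + 1"
    using card_insert_le_m1 card_image_le[of "{d\<in>D. edge d \<in> \<sigma>}" Some] D fB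
    by (simp add: card_insert_if image_iff)
  have sub: "patterns D n (j, \<sigma>) \<subseteq> {p. set p \<subseteq> ?B \<and> length p = n}"
  proof
    fix p assume p: "p \<in> patterns D n (j, \<sigma>)"
    have "q \<in> ?B" if "q \<in> set p" for q
    proof (cases q)
      case (Some d)
      then have "d \<in> set (picked p)" using that by (simp add: set_picked)
      then show ?thesis using p Some by (auto simp: patterns_def)
    qed simp
    then show "p \<in> {p. set p \<subseteq> ?B \<and> length p = n}" using p by (auto simp: patterns_def)
  qed
  have fin: "finite {p. set p \<subseteq> ?B \<and> length p = n}" using finite_lists_length_eq[OF fB] by simp
  show "finite (patterns D n (j, \<sigma>))" using finite_subset[OF sub fin] .
  have "card (patterns D n (j, \<sigma>)) \<le> card {p. set p \<subseteq> ?B \<and> length p = n}" by (rule card_mono[OF fin sub])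
  also have "\<dots> = card ?B ^ n" by (rule card_lists_length_eq[OF fB])
  also have "\<dots> \<le> (n * q + 1) ^ n" using cB by (rule power_mono) simp
  finally show "card (patterns D n (j, \<sigma>)) \<le> (n * q + 1) ^ n" .
qed

definition bad_mass :: "('e, 'v) dart set \<Rightarrow> 'v set \<Rightarrow> ('v \<Rightarrow> (('e, 'v) dart \<Rightarrow> real) list) \<Rightarrow> ('e, 'v) dart set list \<Rightarrow> real" where
  "bad_mass D X \<kappa> As = (\<Sum>x\<in>X. walk_sum D x (map2 cut (\<kappa> x) As) x)"

lemma walk_sum_single:
  assumes "finite D" "d \<in> D"
  shows "walk_sum D z (cut c {d} # cs) y = (if src d = z then c d * walk_sum D (dst d) cs y else 0)"
proof -
  have "walk_sum D z (cut c {d} # cs) y =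
    (\<Sum>d'\<in>{d'\<in>D. src d' = z}. if d' = d then c d * walk_sum D (dst d) cs y else 0)"
    by (simp add: cut_def) (intro sum.cong, auto)
  then show ?thesis using assms by simp
qed

lemma walk_sum_cut_vertex:
  "walk_sum D x (cut c {d. src d = z} # cs) y = (if x = z then walk_sum D x (c # cs) y else 0)"
  by (auto simp: cut_def intro!: sum.cong sum.neutral)

lemma cut_UNIV: "cut c UNIV = c"
  by (simp add: cut_def)

text \<open>A walk whose darts i and j both leave \<open>z\<close> splits at these two visits into
  three pieces that can be summed independently.\<close>

lemma walk_sum_vpat:
  assumes D: "finite D" and X: "finite X" "\<And>d. d \<in> D \<Longrightarrow> dst d \<in> X" and u: "u \<in> X" and z: "z \<in> X"
    and ij: "i < j" "j < length cs"
  shows "walk_sum D u (map2 cut cs (vpat (length cs) (i, j, z))) y =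
    walk_sum D u (take i cs) z * walk_sum D z (take (j - i) (drop i cs)) z * walk_sum D z (drop j cs) y"
proof -
  note app = walk_sum_append[OF D X(1) X(2)]
  let ?S = "{d. src d = z}" and ?m = "take (j - Suc i) (drop (Suc i) cs)"
  have "map2 cut cs (vpat (length cs) (i, j, z)) =
     take i cs @ cut (cs ! i) ?S # ?m @ cut (cs ! j) ?S # drop (Suc j) cs"
  proof (rule nth_equalityI)
    fix t assume "t < length (map2 cut cs (vpat (length cs) (i, j, z)))"
    then have t: "t < length cs" by (simp add: vpat_def)
    have "map2 cut cs (vpat (length cs) (i, j, z)) ! t = cut (cs ! t) (if t = i \<or> t = j then ?S else UNIV)"
      using t by (simp add: vpat_def)
    also have "\<dots> = (take i cs @ cut (cs ! i) ?S # ?m @ cut (cs ! j) ?S # drop (Suc j) cs) ! t"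
    proof -
      consider "t < i" | "t = i" | "i < t" "t < j" | "t = j" | "j < t" by linarith
      then show ?thesis
      proof cases
        case 3
        then obtain s where s: "t = Suc (i + s)" using less_iff_Suc_add by auto
        then have "s < j - Suc i" using 3 by linarith
        then show ?thesis using 3 ij t s by (simp add: nth_append cut_UNIV)
      next
        case 4
        then obtain s where s: "j = Suc (i + s)" using ij less_iff_Suc_add by auto
        then show ?thesis using 4 ij t by (simp add: nth_append)
      next
        case 5
        then obtain s where s: "t = Suc (j + s)" using less_iff_Suc_add by auto
        obtain s' where s': "j = Suc (i + s')" using ij less_iff_Suc_add by auto
        show ?thesis using s s' ij t by (simp add: nth_append cut_UNIV)
      qed (use ij t in \<open>auto simp: nth_append cut_UNIV\<close>)
    qed
    finally show "map2 cut cs (vpat (length cs) (i, j, z)) ! t =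
        (take i cs @ cut (cs ! i) ?S # ?m @ cut (cs ! j) ?S # drop (Suc j) cs) ! t" .
  qed (use ij in \<open>simp add: vpat_def\<close>)
  then have "walk_sum D u (map2 cut cs (vpat (length cs) (i, j, z))) y =
     walk_sum D u (take i cs @ cut (cs ! i) ?S # ?m @ cut (cs ! j) ?S # drop (Suc j) cs) y" by (simp only:)
  also have "\<dots> = (\<Sum>w\<in>X. if w = z then walk_sum D u (take i cs) z * walk_sum D z (cs ! i # ?m @ cut (cs ! j) ?S # drop (Suc j) cs) y else 0)"
    by (subst app[OF _ u], assumption, rule sum.cong[OF refl]) (simp add: walk_sum_cut_vertex del: walk_sum.simps)
  also have "\<dots> = walk_sum D u (take i cs) z * walk_sum D z ((cs ! i # ?m) @ cut (cs ! j) ?S # drop (Suc j) cs) y"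
    using X z by simp
  also have "walk_sum D z ((cs ! i # ?m) @ cut (cs ! j) ?S # drop (Suc j) cs) y =
     (\<Sum>w\<in>X. if w = z then walk_sum D z (cs ! i # ?m) z * walk_sum D z (cs ! j # drop (Suc j) cs) y else 0)"
    by (subst app[OF _ z], assumption, rule sum.cong[OF refl]) (simp add: walk_sum_cut_vertex del: walk_sum.simps)
  also have "\<dots> = walk_sum D z (cs ! i # ?m) z * walk_sum D z (cs ! j # drop (Suc j) cs) y"
    using X z by simp
  also have "cs ! i # ?m = take (j - i) (drop i cs)"
  proof -
    have "drop i cs = cs ! i # drop (Suc i) cs" using ij by (simp add: Cons_nth_drop_Suc)
    moreover have "j - i = Suc (j - Suc i)" using ij by simp
    ultimately show ?thesis by simp
  qed
  also have "cs ! j # drop (Suc j) cs = drop j cs" using ij by (simp add: Cons_nth_drop_Suc)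
  finally show ?thesis by simp
qed

text \<open>A closed walk yields a Berge cycle unless it repeats a vertex or an edge, and the cycle
  is unsuitable if it contains a saturated set. Each of these three kinds of failure carries at most
  a quarter of the total mass, so the union bound leaves a good walk.\<close>

lemma good_cycle_exists:
  fixes D :: "('v set, 'v) dart set"
  assumes D: "finite D" and X: "finite X" and k: "k \<ge> 1" and W: "finite W"
    and inc: "\<And>d. d \<in> D \<Longrightarrow> edge d \<in> W \<and> src d \<in> X \<and> src d \<in> edge d \<and> dst d \<in> edge d"
    and card_W: "\<And>e. e \<in> W \<Longrightarrow> finite e \<and> card e = r"
    and nonneg: "\<And>x c d. c \<in> set (\<kappa> x) \<Longrightarrow> 0 \<le> c d" and len: "\<And>x. length (\<kappa> x) = k"
    and Sat: "\<And>\<sigma>. \<sigma> \<in> Sat \<Longrightarrow> \<sigma> \<subseteq> W \<and> 2 \<le> card \<sigma> \<and> card \<sigma> \<le> k" 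
    and q: "\<And>e. e \<in> W \<Longrightarrow> card {d\<in>D. edge d = e} \<le> q"
    and pos: "0 < (\<Sum>x\<in>X. walk_sum D x (\<kappa> x) x)"
    and vert: "(\<Sum>t\<in>{(i, j, z). i < j \<and> j < k \<and> z \<in> X}. bad_mass D X \<kappa> (vpat k t)) \<le> (\<Sum>x\<in>X. walk_sum D x (\<kappa> x) x) / 4"
    and edges: "(\<Sum>e\<in>W. \<Sum>p\<in>patterns D k (2, {e}). bad_mass D X \<kappa> (pat p)) \<le> (\<Sum>x\<in>X. walk_sum D x (\<kappa> x) x) / 4"
    and sat: "(\<Sum>\<sigma>\<in>Sat. \<Sum>p\<in>patterns D k (card \<sigma>, \<sigma>). bad_mass D X \<kappa> (pat p)) \<le> (\<Sum>x\<in>X. walk_sum D x (\<kappa> x) x) / 4"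
  shows "\<exists>A\<in>berge_cycles r k. A \<subseteq> W \<and> card A = k \<and> (\<forall>\<sigma>\<in>Sat. \<not> \<sigma> \<subseteq> A)"
proof -
  define I1 where "I1 = {(i::nat, j, z). i < j \<and> j < k \<and> z \<in> X}"
  define J where "J = (\<lambda>e. (2::nat, {e})) ` W \<union> (\<lambda>\<sigma>. (card \<sigma>, \<sigma>)) ` Sat"
  define I2 where "I2 = Sigma J (patterns D k)"
  define f where "f = (\<lambda>t :: _ + (nat \<times> 'v set set) \<times> _. (case t of Inl t \<Rightarrow> vpat k t | Inr (u, p) \<Rightarrow> pat p) :: ('v set, 'v) dart set list)"
  have "I1 \<subseteq> {..<k} \<times> {..<k} \<times> X" by (auto simp: I1_def)
  then have fI1: "finite I1" using X finite_subset by blast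
  have "Sat \<subseteq> Pow W" using Sat by auto
  then have fSat: "finite Sat" using W finite_subset by (metis finite_Pow_iff)
  then have fJ: "finite J" using W by (simp add: J_def)
  have fpat: "finite (patterns D k u)" if "u \<in> J" for u
  proof -
    have "finite (patterns D k (j, \<sigma>))" if "(j, \<sigma>) \<in> J" for j \<sigma>
    proof (rule card_patterns(1)[OF D])
      show "finite \<sigma>" "card \<sigma> \<le> k" using that Sat k W finite_subset[of \<sigma> W] by (auto simp: J_def)
      show "card {d\<in>D. edge d = e} \<le> q" if "e \<in> \<sigma>" for e using that \<open>(j, \<sigma>) \<in> J\<close> Sat q by (auto simp: J_def)
    qed
    then show ?thesis using that by (cases u) auto
  qed
  then have fI2: "finite I2" unfolding I2_def using fJ by auto
  let ?T = "\<Sum>x\<in>X. walk_sum D x (\<kappa> x) x"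
  have "(\<Sum>u\<in>J. \<Sum>p\<in>patterns D k u. bad_mass D X \<kappa> (pat p)) =
     (\<Sum>u\<in>(\<lambda>e. (2::nat, {e})) ` W. \<Sum>p\<in>patterns D k u. bad_mass D X \<kappa> (pat p)) +
     (\<Sum>u\<in>(\<lambda>\<sigma>. (card \<sigma>, \<sigma>)) ` Sat. \<Sum>p\<in>patterns D k u. bad_mass D X \<kappa> (pat p))"
    \<comment> \<open>The two kinds of indices do not collide: \<open>{e}\<close> has one element, a
      saturated set at least two.\<close>
    unfolding J_def using W fSat Sat by (intro sum.union_disjoint) fastforce+
  also have "(\<Sum>u\<in>(\<lambda>e. (2::nat, {e})) ` W. \<Sum>p\<in>patterns D k u. bad_mass D X \<kappa> (pat p)) =
     (\<Sum>e\<in>W. \<Sum>p\<in>patterns D k (2, {e}). bad_mass D X \<kappa> (pat p))"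
    by (subst sum.reindex) (auto simp: inj_on_def)
  also have "(\<Sum>u\<in>(\<lambda>\<sigma>. (card \<sigma>, \<sigma>)) ` Sat. \<Sum>p\<in>patterns D k u. bad_mass D X \<kappa> (pat p)) =
     (\<Sum>\<sigma>\<in>Sat. \<Sum>p\<in>patterns D k (card \<sigma>, \<sigma>). bad_mass D X \<kappa> (pat p))"
    by (subst sum.reindex) (auto simp: inj_on_def)
  finally have J2: "(\<Sum>u\<in>J. \<Sum>p\<in>patterns D k u. bad_mass D X \<kappa> (pat p)) \<le> ?T / 2" using edges sat by simp
  have "(\<Sum>i\<in>I1 <+> I2. \<Sum>x\<in>X. walk_sum D x (map2 cut (\<kappa> x) (f i)) x) =
     (\<Sum>t\<in>I1. bad_mass D X \<kappa> (vpat k t)) + (\<Sum>t\<in>I2. bad_mass D X \<kappa> (pat (snd t)))"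
    using fI1 fI2 by (simp add: sum.Plus f_def bad_mass_def case_prod_unfold)
  also have "(\<Sum>t\<in>I2. bad_mass D X \<kappa> (pat (snd t))) = (\<Sum>u\<in>J. \<Sum>p\<in>patterns D k u. bad_mass D X \<kappa> (pat p))"
    unfolding I2_def using fJ fpat by (subst sum.Sigma) (auto simp: case_prod_unfold)
  finally have "(\<Sum>i\<in>I1 <+> I2. \<Sum>x\<in>X. walk_sum D x (map2 cut (\<kappa> x) (f i)) x) < ?T"
    using J2 vert pos unfolding I1_def by linarith
  then have "\<exists>x\<in>X. \<exists>a. set a \<subseteq> D \<and> length a = k \<and> chain x a x \<and> (\<forall>i\<in>I1 <+> I2. \<not> list_all2 (\<in>) a (f i))"
  proof (intro closed_walk_exists[OF D X])
    show "length (f i) = k" if "i \<in> I1 <+> I2" for i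
      using that by (auto simp: f_def vpat_def pat_def I2_def patterns_def case_prod_unfold)
  qed (use fI1 fI2 nonneg len in auto)
  then obtain x a where a: "set a \<subseteq> D" "length a = k" "chain x a x"
    and no: "\<forall>i\<in>I1 <+> I2. \<not> list_all2 (\<in>) a (f i)"
    by (elim bexE exE conjE) (rule that)
  have no1: "\<not> list_all2 (\<in>) a (vpat k t)" if "t \<in> I1" for t
    using no[rule_format, of "Inl t"] that by (simp add: f_def InlI)
  have no2: "\<not> list_all2 (\<in>) a (pat p)" if "u \<in> J" "p \<in> patterns D k u" for u p
    using no[rule_format, of "Inr (u, p)"] that by (simp add: f_def InrI I2_def)
  have d1: "distinct (map src a)"
  proof (rule ccontr)
    assume "\<not> ?thesis"
    then obtain i j where ij: "i < j" "j < k" "src (a ! i) = src (a ! j)"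
      using a(2) by (auto simp: distinct_conv_nth) (metis linorder_neqE_nat)
    moreover have "src (a ! i) \<in> X" using inc a ij by (meson less_trans nth_mem subsetD)
    ultimately have "(i, j, src (a ! i)) \<in> I1" by (simp add: I1_def)
    moreover have "list_all2 (\<in>) a (vpat k (i, j, src (a ! i)))"
      using ij a by (auto simp: list_all2_conv_all_nth vpat_def)
    ultimately show False using no1 by blast
  qed
  \<comment> \<open>Both kinds of edge failure reduce to this: the darts at the places
    \<open>P\<close> form a forbidden pattern. A repeated edge is the case of two places with the
    same edge.\<close>
  have general: False if "P \<subseteq> {..<k}" "(card P, (\<lambda>i. edge (a ! i)) ` P) \<in> J" for P
  proof -
    define p where "p = map (\<lambda>i. if i \<in> P then Some (a ! i) else None) [0..<k]"
    have pk: "picked p = map (\<lambda>i. a ! i) (filter (\<lambda>i. i \<in> P) [0..<k])"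
      unfolding p_def by (rule picked_map_if)
    have sP: "set (filter (\<lambda>i. i \<in> P) [0..<k]) = P" using that by auto
    have "length (filter (\<lambda>i. i \<in> P) [0..<k]) = card P"
      using distinct_card[of "filter (\<lambda>i. i \<in> P) [0..<k]"] sP by simp
    then have "p \<in> patterns D k (card P, (\<lambda>i. edge (a ! i)) ` P)"
    proof -
      have "length p = k" by (simp add: p_def)
      moreover have "set (picked p) = (\<lambda>i. a ! i) ` P" using sP by (simp add: pk)
      moreover have "(\<lambda>i. a ! i) ` P \<subseteq> D" using that(1) a nth_mem[of _ a] by blast
      moreover have "length (picked p) = card P"
        using \<open>length (filter (\<lambda>i. i \<in> P) [0..<k]) = card P\<close> by (simp add: pk)
      ultimately show ?thesis unfolding patterns_def by (simp add: image_image)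
    qed
    moreover have "list_all2 (\<in>) a (pat p)"
      using a by (auto simp: list_all2_conv_all_nth pat_def p_def)
    ultimately show False using no2 that by blast
  qed
  have d2: "distinct (map edge a)"
  proof (rule ccontr)
    assume "\<not> ?thesis"
    then obtain i j where ij: "i < k" "j < k" "i \<noteq> j" "edge (a ! i) = edge (a ! j)"
      using a(2) by (auto simp: distinct_conv_nth)
    have "edge (a ! i) \<in> W" using a ij inc by (meson nth_mem subsetD)
    moreover have "(\<lambda>i. edge (a ! i)) ` {i, j} = {edge (a ! i)}" using ij by auto
    ultimately have "(card {i, j}, (\<lambda>i. edge (a ! i)) ` {i, j}) \<in> J" using ij by (auto simp: J_def)
    then show False using general[of "{i, j}"] ij by auto
  qed
  have "edge ` set a \<in> berge_cycles r k"
    using a inc card_W by (intro closed_walk_berge[OF a(3,2) k _ d2 d1]) blast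
  moreover have "edge ` set a \<subseteq> W" using a inc by auto
  moreover have "card (edge ` set a) = k" using distinct_card[OF d2] a by simp
  moreover have "\<not> \<sigma> \<subseteq> edge ` set a" if "\<sigma> \<in> Sat" for \<sigma>
  proof
    assume sub: "\<sigma> \<subseteq> edge ` set a"
    define P where "P = {i. i < k \<and> edge (a ! i) \<in> \<sigma>}"
    have img: "(\<lambda>i. edge (a ! i)) ` P = \<sigma>"
    proof
      show "\<sigma> \<subseteq> (\<lambda>i. edge (a ! i)) ` P"
      proof
        fix e assume e: "e \<in> \<sigma>"
        then obtain d where "d \<in> set a" "edge d = e" using sub by auto
        then obtain i where "i < k" "edge (a ! i) = e" using a(2) by (auto simp: in_set_conv_nth)
        then show "e \<in> (\<lambda>i. edge (a ! i)) ` P" using e unfolding P_def by blast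
      qed
    qed (auto simp: P_def)
    have "inj_on (\<lambda>i. edge (a ! i)) P"
      using d2 a(2) by (auto simp: inj_on_def P_def distinct_conv_nth)
    then have "card \<sigma> = card P" using img card_image by metis
    moreover have "(card \<sigma>, \<sigma>) \<in> J" using that by (simp add: J_def)
    ultimately have "(card P, (\<lambda>i. edge (a ! i)) ` P) \<in> J" unfolding img by simp
    then show False using general[of P] by (auto simp: P_def)
  qed
  ultimately show ?thesis by blast
qed

section \<open>Return probabilities in graphs of bounded multiplicity\<close>

definition log_convex :: "(nat \<Rightarrow> real) \<Rightarrow> bool" where
  "log_convex f \<longleftrightarrow> (\<forall>k. 0 < f k) \<and> (\<forall>k. (f (Suc k))\<^sup>2 \<le> f k * f (Suc (Suc k)))"

lemma log_convex_pos: "log_convex f \<Longrightarrow> 0 < f k"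
  by (simp add: log_convex_def)

text \<open>Log-convexity means that the ratios f (k + 1) / f k increase, so i steps starting at b
  gain at least as much as i steps starting at a \<le> b.\<close>

lemma log_convex_exchange:
  assumes "log_convex f" "a \<le> b"
  shows "f (a + i) * f b \<le> f a * f (b + i)"
proof -
  have pos: "0 < f k" for k using assms by (simp add: log_convex_def)
  have ratio1: "f (Suc k) / f k \<le> f (Suc (Suc k)) / f (Suc k)" for k
    using assms(1) pos by (simp add: log_convex_def field_simps power2_eq_square)
  have ratio: "f (Suc k) / f k \<le> f (Suc (k + j)) / f (k + j)" for k j
    by (induction j) (use ratio1 order_trans in \<open>fastforce+\<close>)
  have "f (a + i) / f a \<le> f (b + i) / f b"
  proof (induction i)
    case 0
    show ?case using pos[of a] pos[of b] by simp
  next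
    case (Suc i)
    have "a + i + (b - a) = b + i" using assms(2) by simp
    have "f (a + Suc i) / f a = (f (a + i) / f a) * (f (Suc (a + i)) / f (a + i))"
      using pos[of "a + i"] by simp
    also have "\<dots> \<le> (f (b + i) / f b) * (f (Suc (b + i)) / f (b + i))"
      using Suc ratio[of "a + i" "b - a"] \<open>a + i + (b - a) = b + i\<close> pos by (intro mult_mono) (auto simp: less_imp_le)
    also have "\<dots> = f (b + Suc i) / f b" using pos[of "b + i"] by simp
    finally show ?case .
  qed
  then show ?thesis using pos[of a] pos[of b] by (simp add: field_simps)
qed

text \<open>Monotonicity of the k-th roots, written without roots so that index 0 is included.
  Single steps follow by induction from the (k + 1)-st power of the log-convexity
  inequality.\<close>

lemma log_convex_root_mono:
  assumes f: "log_convex f" "f 0 \<le> 1" and "g \<le> m"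
  shows "f g ^ m \<le> f m ^ g"
proof -
  have pos: "0 < f k" for k using f by (simp add: log_convex_def)
  have step: "f k ^ Suc k \<le> f (Suc k) ^ k" for k
  proof (induction k)
    case 0 then show ?case using f by simp
  next
    case (Suc k)
    have "f (Suc k) ^ k * f (Suc k) ^ Suc (Suc k) = ((f (Suc k))\<^sup>2) ^ Suc k"
      by (simp add: power_mult[symmetric] power_add[symmetric] mult_2 flip: power_Suc)
    also have "\<dots> \<le> (f k * f (Suc (Suc k))) ^ Suc k"
      using f(1) by (intro power_mono) (auto simp: log_convex_def)
    also have "\<dots> = f k ^ Suc k * f (Suc (Suc k)) ^ Suc k" by (simp only: power_mult_distrib)
    also have "\<dots> \<le> f (Suc k) ^ k * f (Suc (Suc k)) ^ Suc k"
      using Suc pos by (intro mult_right_mono) (auto simp: less_imp_le)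
    finally show ?case using pos[of "Suc k"] by (simp only: mult_le_cancel_left_pos zero_less_power)
  qed
  show ?thesis using \<open>g \<le> m\<close>
  proof (induction m rule: dec_induct)
    case (step m)
    show ?case
    proof (cases "m = 0")
      case True then show ?thesis using step f by simp
    next
      case False
      have "(f g ^ Suc m) ^ m = (f g ^ m) ^ Suc m" by (simp only: power_mult[symmetric] mult.commute)
      also have "\<dots> \<le> (f m ^ g) ^ Suc m" using step.IH pos by (intro power_mono) (auto simp: less_imp_le)
      also have "\<dots> = (f m ^ Suc m) ^ g" by (simp only: power_mult[symmetric] mult.commute)
      also have "\<dots> \<le> (f (Suc m) ^ m) ^ g" using \<open>\<And>k. f k ^ Suc k \<le> f (Suc k) ^ k\<close> pos
        by (intro power_mono) (auto simp: less_imp_le)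
      also have "\<dots> = (f (Suc m) ^ g) ^ m" by (simp only: power_mult[symmetric] mult.commute)
      finally show ?thesis using False pos power_le_imp_le_base[of "f g ^ Suc m" "m - 1" "f (Suc m) ^ g"]
        by (simp add: less_imp_le)
    qed
  qed simp
qed

text \<open>Interpolation between the end points 0 and m, read off from the monotone roots.\<close>

lemma log_convex_le_one:
  assumes "log_convex f" "f 0 \<le> 1" "f m \<le> 1" "k \<le> m"
  shows "f k \<le> 1"
proof (cases "m = 0")
  case False
  have pos: "0 < f k" for k using assms by (simp add: log_convex_def)
  have "f k ^ m \<le> f m ^ k" by (rule log_convex_root_mono[OF assms(1,2,4)])
  also have "\<dots> \<le> 1" using assms pos[of m] by (intro power_le_one) auto
  finally show ?thesis using False pos[of k] by (metis power_le_one_iff less_imp_le not_gr_zero)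
qed (use assms in auto)

text \<open>The left side is a product of k successive ratios, all bounded by the last one.\<close>

lemma log_convex_ratio:
  assumes f: "log_convex f"
  shows "f (Suc k) / f 1 \<le> (f (Suc k) / f k) ^ k"
proof (induction k)
  case 0 then show ?case using log_convex_pos[OF f, of 1] by simp
next
  case (Suc k)
  have pos: "0 < f k" for k by (rule log_convex_pos[OF f])
  have r: "f (Suc k) / f k \<le> f (Suc (Suc k)) / f (Suc k)"
    using f pos by (simp add: log_convex_def field_simps power2_eq_square)
  have "f (Suc (Suc k)) / f 1 = f (Suc (Suc k)) / f (Suc k) * (f (Suc k) / f 1)"
    using pos[of "Suc k"] by simp
  also have "\<dots> \<le> f (Suc (Suc k)) / f (Suc k) * (f (Suc k) / f k) ^ k"
    using Suc pos by (intro mult_left_mono) (auto simp: less_imp_le)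
  also have "\<dots> \<le> f (Suc (Suc k)) / f (Suc k) * (f (Suc (Suc k)) / f (Suc k)) ^ k"
    using r pos by (intro mult_left_mono power_mono) (auto simp: less_imp_le)
  finally show ?case by simp
qed

text \<open>Lagrange's identity: the double sum of the squares (f x g y - f y g x)^2 with weights w
  x w y is twice the difference of the two sides.\<close>

lemma weighted_Cauchy_Schwarz:
  fixes w f g :: "'a \<Rightarrow> real"
  assumes "finite X" "\<And>x. x \<in> X \<Longrightarrow> 0 \<le> w x"
  shows "(\<Sum>x\<in>X. w x * f x * g x)\<^sup>2 \<le> (\<Sum>x\<in>X. w x * (f x)\<^sup>2) * (\<Sum>x\<in>X. w x * (g x)\<^sup>2)"
proof -
  let ?A = "\<Sum>x\<in>X. w x * (f x)\<^sup>2" and ?B = "\<Sum>x\<in>X. w x * (g x)\<^sup>2" and ?C = "\<Sum>x\<in>X. w x * f x * g x"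
  have "0 \<le> (\<Sum>x\<in>X. \<Sum>y\<in>X. w x * w y * (f x * g y - f y * g x)\<^sup>2)"
    using assms by (intro sum_nonneg mult_nonneg_nonneg) auto
  also have "\<dots> = (\<Sum>x\<in>X. \<Sum>y\<in>X. (w x * (f x)\<^sup>2) * (w y * (g y)\<^sup>2) + (w x * (g x)\<^sup>2) * (w y * (f y)\<^sup>2)
      - 2 * ((w x * f x * g x) * (w y * f y * g y)))"
    by (intro sum.cong refl) (simp add: power2_eq_square algebra_simps)
  also have "\<dots> = ?A * ?B + ?B * ?A - 2 * (?C * ?C)"
    by (simp add: sum.distrib sum_subtractf sum_product flip: sum_distrib_left)
  finally show ?thesis by (simp add: power2_eq_square)
qed

text \<open>The hyperedges of \<open>F\<close> become edges of a loopless multigraph, each through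
  its single pair \<open>p e\<close>. Here \<open>\<delta>\<close> is a lower bound for the degrees
  and \<open>m\<close> an upper bound for the multiplicities.\<close>

locale pair_graph =
  fixes F :: "'e set" and p :: "'e \<Rightarrow> 'v set" and \<delta> m :: real
  assumes finF: "finite F" and neF: "F \<noteq> {}" and card_p: "\<And>e. e \<in> F \<Longrightarrow> card (p e) = 2"
    and \<delta>: "0 < \<delta>" and min_deg: "\<And>e x. e \<in> F \<Longrightarrow> x \<in> p e \<Longrightarrow> \<delta> \<le> real (card {e\<in>F. x \<in> p e})"
    and mult: "\<And>q. real (card {e\<in>F. p e = q}) \<le> m"
begin

definition X where "X = \<Union> (p ` F)"
definition dg where "dg x = real (card {e\<in>F. x \<in> p e})"
definition D where "D = {(e, x, y). e \<in> F \<and> p e = {x, y}}"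
text \<open>Weighting by the degree of the end of a dart instead of its start does not change closed walks, and \<open>H\<close> below
  becomes symmetric.\<close>
definition \<kappa> :: "('e, 'v) dart \<Rightarrow> real" where "\<kappa> d = 1 / dg (dst d)"
definition G where "G g x y = walk_sum D x (replicate g \<kappa>) y"
text \<open>The g-step transition density relative to the degree measure; \<open>H_add\<close> is
  its Chapman-Kolmogorov equation.\<close>

definition H where "H g x y = G g x y / dg x"
definition q where "q x y = (if x = y then 0 else real (card {e\<in>F. p e = {x, y}}))"

section \<open>The symmetric transition kernel\<close>

lemma fin_p: "e \<in> F \<Longrightarrow> finite (p e)"
  using card_p by (intro card_ge_0_finite) auto

lemma finX: "finite X"
  unfolding X_def using finF fin_p by auto

lemma neX: "X \<noteq> {}"
proof -
  obtain e where "e \<in> F" using neF by auto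
  then have "p e \<noteq> {}" using card_p[of e] by auto
  then show ?thesis using \<open>e \<in> F\<close> by (auto simp: X_def)
qed

lemma dg_ge: "x \<in> X \<Longrightarrow> \<delta> \<le> dg x"
  using min_deg by (auto simp: X_def dg_def)

lemma dg_pos: "x \<in> X \<Longrightarrow> 0 < dg x"
  using dg_ge \<delta> by fastforce

lemma dart_X: "d \<in> D \<Longrightarrow> src d \<in> X \<and> dst d \<in> X"
  unfolding D_def X_def by force

lemma finD: "finite D"
proof -
  have "D \<subseteq> F \<times> X \<times> X" using dart_X by (auto simp: D_def X_def)
  then show ?thesis using finF finX finite_subset by blast
qed

lemma sum_darts: "(\<Sum>d\<in>{d\<in>D. src d = x}. f (dst d)) = (\<Sum>y\<in>X. q x y * f y)"
proof -
  have "(\<Sum>d\<in>{d\<in>D. src d = x}. f (dst d)) = (\<Sum>y\<in>X. \<Sum>d\<in>{d\<in>{d\<in>D. src d = x}. dst d = y}. f (dst d))"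
    using finD finX dart_X by (intro sum.group[symmetric]) auto
  also have "\<dots> = (\<Sum>y\<in>X. q x y * f y)"
  proof (intro sum.cong refl)
    fix y
    have "{d\<in>{d\<in>D. src d = x}. dst d = y} = (\<lambda>e. (e, x, y)) ` {e\<in>F. p e = {x, y}}"
      by (auto simp: D_def)
    then have "card {d\<in>{d\<in>D. src d = x}. dst d = y} = card {e\<in>F. p e = {x, y}}"
      by (simp add: card_image inj_on_def)
    moreover have "card {e\<in>F. p e = {x, y}} = 0" if "x = y" using card_p that by (fastforce simp: card_eq_0_iff)
    ultimately have "real (card {d\<in>{d\<in>D. src d = x}. dst d = y}) = q x y"
      unfolding q_def by (cases "x = y") auto
    moreover have "(\<Sum>d\<in>{d\<in>{d\<in>D. src d = x}. dst d = y}. f (dst d)) =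
        real (card {d\<in>{d\<in>D. src d = x}. dst d = y}) * f y" by simp
    ultimately show "(\<Sum>d\<in>{d\<in>{d\<in>D. src d = x}. dst d = y}. f (dst d)) = q x y * f y" by simp
  qed
  finally show ?thesis .
qed

lemma q_sym: "q x y = q y x"
  by (simp add: q_def insert_commute)

lemma q_le: "q x y \<le> m" 
  using mult[of "{x, y}"] mult[of "{}"] unfolding q_def
  by (auto intro: order_trans[OF _ mult])

lemma m_nonneg: "0 \<le> m"
  by (rule order_trans[OF of_nat_0_le_iff mult[of "{}"]])

lemma q_nonneg: "0 \<le> q x y" by (simp add: q_def)

lemma sum_q: "x \<in> X \<Longrightarrow> (\<Sum>y\<in>X. q x y) = dg x"
proof -
  assume "x \<in> X"
  have "(\<Sum>y\<in>X. q x y) = real (card {d\<in>D. src d = x})"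
    using sum_darts[where x = x and f = "\<lambda>_. 1"] by simp
  also have "card {d\<in>D. src d = x} = card {e\<in>F. x \<in> p e}"
  proof (rule bij_betw_same_card[of edge], rule bij_betw_imageI)
    show "inj_on edge {d\<in>D. src d = x}"
      by (auto simp: inj_on_def D_def doubleton_eq_iff)
    show "edge ` {d\<in>D. src d = x} = {e\<in>F. x \<in> p e}"
    proof
      show "{e\<in>F. x \<in> p e} \<subseteq> edge ` {d\<in>D. src d = x}"
      proof
        fix e assume e: "e \<in> {e\<in>F. x \<in> p e}"
        then have "card (p e - {x}) = 1" using card_p[of e] by simp
        then obtain y where "p e - {x} = {y}" by (auto simp: card_1_singleton_iff)
        then have "p e = {x, y}" using e by auto
        then have "(e, x, y) \<in> {d\<in>D. src d = x}" using e by (auto simp: D_def)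
        then show "e \<in> edge ` {d\<in>D. src d = x}" by force
      qed
    qed (auto simp: D_def)
  qed
  finally show ?thesis by (simp add: dg_def)
qed

lemma G_0: "G 0 x y = (if x = y then 1 else 0)" by (simp add: G_def)

lemma G_Suc: "G (Suc g) x y = (\<Sum>z\<in>X. q x z / dg z * G g z y)"
  unfolding G_def using sum_darts[where x = x and f = "\<lambda>z. 1 / dg z * G g z y"] by (simp add: \<kappa>_def G_def)

lemma G_add: "x \<in> X \<Longrightarrow> G (a + b) x y = (\<Sum>z\<in>X. G a x z * G b z y)"
  unfolding G_def replicate_add using walk_sum_append[OF finD finX] dart_X by blast

lemma H_0: "H 0 x y = (if x = y then 1 / dg x else 0)" by (simp add: H_def G_0)

lemma H_1: "x \<in> X \<Longrightarrow> y \<in> X \<Longrightarrow> H (Suc 0) x y = q x y / (dg x * dg y)"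
proof -
  assume "x \<in> X" "y \<in> X"
  have "G (Suc 0) x y = (\<Sum>z\<in>X. if z = y then q x y / dg y else 0)"
    unfolding G_Suc by (intro sum.cong) (auto simp: G_0)
  then show ?thesis using finX \<open>y \<in> X\<close> by (simp add: H_def)
qed

lemma G_H: "x \<in> X \<Longrightarrow> G g x y = dg x * H g x y"
  using dg_pos[of x] by (simp add: H_def)

lemma H_add: "x \<in> X \<Longrightarrow> H (a + b) x y = (\<Sum>z\<in>X. dg z * H a x z * H b z y)"
proof -
  assume x: "x \<in> X"
  have "H (a + b) x y = (\<Sum>z\<in>X. G a x z * G b z y) / dg x" by (simp add: H_def G_add x)
  also have "\<dots> = (\<Sum>z\<in>X. dg z * H a x z * H b z y)"
    unfolding sum_divide_distrib by (intro sum.cong refl) (use dg_pos[OF x] in \<open>simp add: G_H x\<close>)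
  finally show ?thesis .
qed

lemma H_sym: "x \<in> X \<Longrightarrow> y \<in> X \<Longrightarrow> H g x y = H g y x"
proof (induction g arbitrary: x y)
  case 0 then show ?case by (auto simp: H_0)
next
  case (Suc g)
  have "H (Suc g) x y = H (Suc 0 + g) x y" by simp
  also have "\<dots> = (\<Sum>z\<in>X. dg z * H (Suc 0) x z * H g z y)" using Suc.prems by (simp only: H_add)
  also have "\<dots> = (\<Sum>z\<in>X. dg z * H g y z * H (Suc 0) z x)"
    using Suc by (intro sum.cong refl) (simp add: H_1 q_sym mult_ac)
  also have "\<dots> = H (g + Suc 0) y x" using Suc.prems by (simp only: H_add)
  finally show ?case by simp
qed

lemma G_nonneg: "0 \<le> G g x y"
  unfolding G_def by (rule walk_sum_nonneg[OF finD]) (auto simp: \<kappa>_def dg_def)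

lemma H_nonneg: "0 \<le> H g x y"
  using G_nonneg[of g x y] by (simp add: H_def dg_def)

lemma sum_H: "x \<in> X \<Longrightarrow> (\<Sum>y\<in>X. dg y * H g x y) = 1"
proof (induction g arbitrary: x)
  case 0
  have "(\<Sum>y\<in>X. dg y * H 0 x y) = (\<Sum>y\<in>X. if y = x then 1 else 0)"
    using dg_pos by (intro sum.cong) (fastforce simp: H_0)+
  then show ?case using 0 finX by simp
next
  case (Suc g)
  have "(\<Sum>y\<in>X. dg y * H (Suc g) x y) = (\<Sum>y\<in>X. \<Sum>z\<in>X. dg z * H (Suc 0) x z * (dg y * H g z y))"
    using H_add[OF Suc.prems, of "Suc 0" g] by (intro sum.cong refl) (simp add: sum_distrib_left mult_ac)
  also have "\<dots> = (\<Sum>z\<in>X. dg z * H (Suc 0) x z * (\<Sum>y\<in>X. dg y * H g z y))"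
    by (subst sum.swap) (simp add: sum_distrib_left)
  also have "\<dots> = (\<Sum>z\<in>X. q x z / dg x)"
    using Suc dg_pos by (intro sum.cong refl) (fastforce simp: H_1)
  also have "\<dots> = 1" using sum_q[OF Suc.prems] dg_pos[OF Suc.prems] by (simp add: sum_divide_distrib[symmetric])
  finally show ?case .
qed

text \<open>By symmetry H (a + b) x y is the \<open>dg\<close>-weighted inner product of the rows H
  a x and H b y, while H (2 a) x x is the squared norm of a row.\<close>

lemma H_Cauchy_Schwarz:
  assumes "x \<in> X" "y \<in> X"
  shows "(H (a + b) x y)\<^sup>2 \<le> H (2 * a) x x * H (2 * b) y y"
proof -
  have sq: "H (2 * c) z z = (\<Sum>w\<in>X. dg w * (H c z w)\<^sup>2)" if "z \<in> X" for c z
    using H_add[OF that, of c c z] H_sym[OF that] by (simp add: mult_2 power2_eq_square mult.assoc)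
  have "(H (a + b) x y)\<^sup>2 = (\<Sum>z\<in>X. dg z * H a x z * H b y z)\<^sup>2"
    using H_add[OF assms(1)] H_sym[OF assms(2), of _ b] by simp
  also have "\<dots> \<le> (\<Sum>z\<in>X. dg z * (H a x z)\<^sup>2) * (\<Sum>z\<in>X. dg z * (H b y z)\<^sup>2)"
    by (rule weighted_Cauchy_Schwarz[OF finX]) (simp add: dg_def)
  finally show ?thesis using sq assms by simp
qed

text \<open>A squared norm, which vanishes only if the row H k x does; but this row has
  degree-weighted sum 1.\<close>

lemma H_even_pos: "x \<in> X \<Longrightarrow> 0 < H (2 * k) x x"
proof -
  assume x: "x \<in> X"
  have "H (2 * k) x x = (\<Sum>w\<in>X. dg w * (H k x w)\<^sup>2)"
    using H_add[OF x, of k k x] H_sym[OF x] by (simp add: mult_2 power2_eq_square mult.assoc)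
  moreover have "(\<Sum>w\<in>X. dg w * (H k x w)\<^sup>2) \<noteq> 0"
  proof
    assume "(\<Sum>w\<in>X. dg w * (H k x w)\<^sup>2) = 0"
    then have "\<forall>w\<in>X. dg w * (H k x w)\<^sup>2 = 0" using finX by (subst (asm) sum_nonneg_eq_0_iff) (auto simp: dg_def)
    then have "(\<Sum>w\<in>X. dg w * H k x w) = 0" by (intro sum.neutral) auto
    then show False using sum_H[OF x] by simp
  qed
  moreover have "0 \<le> (\<Sum>w\<in>X. dg w * (H k x w)\<^sup>2)" by (intro sum_nonneg) (simp add: dg_def)
  ultimately show ?thesis by linarith
qed

text \<open>For odd \<open>g\<close> the geometric mean of the neighbours keeps the sequence log-convex; the odd return
  probabilities themselves are not.\<close>

definition A where "A g x = (if even g then H g x x else sqrt (H (g - 1) x x * H (g + 1) x x))"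

lemma A_even: "A (2 * k) x = H (2 * k) x x" by (simp add: A_def)
lemma A_odd: "A (Suc (2 * k)) x = sqrt (H (2 * k) x x * H (2 * Suc k) x x)" by (simp add: A_def)

text \<open>For even g equality holds by the choice of the odd terms. For odd g the claim follows
  from Cauchy-Schwarz for three consecutive even return densities.\<close>

lemma A_log_convex:
  assumes x: "x \<in> X"
  shows "log_convex (\<lambda>g. A g x)"
  unfolding log_convex_def
proof (intro conjI allI)
  have pos: "0 < H (2 * k) x x" for k by (rule H_even_pos[OF x])
  fix g
  show "0 < A g x"
  proof (cases "even g")
    case True then show ?thesis using pos by (auto elim!: evenE simp: A_even)
  next
    case False
    then obtain k where "g = Suc (2 * k)" by (auto elim!: oddE)
    then show ?thesis using pos[of k] pos[of "Suc k"] by (simp add: A_odd)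
  qed
  show "(A (Suc g) x)\<^sup>2 \<le> A g x * A (Suc (Suc g)) x"
  proof (cases "even g")
    case True
    then obtain k where k: "g = 2 * k" by (auto elim!: evenE)
    then have "Suc (Suc g) = 2 * Suc k" by simp
    then show ?thesis unfolding k \<open>Suc (Suc g) = 2 * Suc k\<close>[unfolded k] A_odd A_even
      using pos[of k] pos[of "Suc k"] by simp
  next
    case False
    then obtain k where k: "g = Suc (2 * k)" by (auto elim!: oddE)
    let ?a = "H (2 * k) x x" and ?b = "H (2 * Suc k) x x" and ?c = "H (2 * Suc (Suc k)) x x"
    have e: "Suc g = 2 * Suc k" "Suc (Suc g) = Suc (2 * Suc k)" using k by auto
    have "?b\<^sup>2 \<le> ?a * ?c"
      using H_Cauchy_Schwarz[OF x x, of k "Suc (Suc k)"] by (simp add: mult_2)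
    then have "?b \<le> sqrt (?a * ?c)" using pos[of "Suc k"] by (simp add: real_le_rsqrt)
    then have "?b * ?b \<le> ?b * sqrt (?a * ?c)" using pos[of "Suc k"] by (intro mult_left_mono) auto
    also have "\<dots> = sqrt (?a * ?b) * sqrt (?b * ?c)"
      using pos[of "Suc k"] by (simp add: real_sqrt_mult[symmetric] mult_ac) (simp add: real_sqrt_mult)
    finally show ?thesis unfolding e unfolding k A_odd A_even by (simp add: power2_eq_square)
  qed
qed

lemma A_pos: "x \<in> X \<Longrightarrow> 0 < A g x"
  using A_log_convex log_convex_pos by blast

text \<open>For odd g = 2 k + 1 the steps are split into k and k + 1 in both orders; multiplying the
  two Cauchy-Schwarz bounds produces the geometric means that define \<open>A\<close>.\<close>

lemma H_le_A:
  assumes "x \<in> X" "y \<in> X"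
  shows "(H g x y)\<^sup>2 \<le> A g x * A g y"
proof (cases "even g")
  case True
  then obtain k where k: "g = k + k" by (auto elim!: evenE simp: mult_2)
  show ?thesis using H_Cauchy_Schwarz[OF assms, of k k] by (simp add: k A_even flip: mult_2)
next
  case False
  then obtain k where k: "g = Suc (2 * k)" by (auto elim!: oddE)
  have pos: "0 < H (2 * k) z z" if "z \<in> X" for k z by (rule H_even_pos[OF that])
  have 1: "(H g x y)\<^sup>2 \<le> H (2 * k) x x * H (2 * Suc k) y y"
    using H_Cauchy_Schwarz[OF assms, of k "Suc k"] by (simp add: k mult_2)
  have 2: "(H g x y)\<^sup>2 \<le> H (2 * Suc k) x x * H (2 * k) y y"
    using H_Cauchy_Schwarz[OF assms, of "Suc k" k] by (simp add: k mult_2)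
  have "((H g x y)\<^sup>2)\<^sup>2 \<le> (H (2 * k) x x * H (2 * Suc k) y y) * (H (2 * Suc k) x x * H (2 * k) y y)"
    unfolding power2_eq_square[of "(H g x y)\<^sup>2"] using 1 2 pos assms
    by (intro mult_mono) (auto intro!: mult_nonneg_nonneg H_nonneg)
  also have "\<dots> = (A g x * A g y)\<^sup>2"
    using pos[OF assms(1), of k] pos[OF assms(1), of "Suc k"] pos[OF assms(2), of k] pos[OF assms(2), of "Suc k"]
    by (simp add: k A_odd power_mult_distrib)
  finally show ?thesis
    using A_pos[OF assms(1), of g] A_pos[OF assms(2), of g] power2_le_imp_le by (meson less_imp_le mult_nonneg_nonneg)
qed

lemma H_diag_le_A: "x \<in> X \<Longrightarrow> H g x x \<le> A g x"
  using H_le_A[of x x g] A_pos[of x g] power2_le_imp_le[of "H g x x" "A g x"] by (simp add: power2_eq_square)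

text \<open>Scaling by \<open>\<delta>\<close> makes the sequence start at a value of at most 1,
  because A 0 x = 1 / dg x.\<close>

lemma A_root:
  assumes "x \<in> X" "g \<le> k"
  shows "(\<delta> * A g x) ^ k \<le> (\<delta> * A k x) ^ g"
proof (rule log_convex_root_mono[OF _ _ assms(2)])
  show "log_convex (\<lambda>g. \<delta> * A g x)"
    using A_log_convex[OF assms(1)] \<delta> by (auto simp: log_convex_def power2_eq_square mult_ac)
  have "\<delta> * A 0 x = \<delta> / dg x" using A_even[of 0 x] by (simp add: H_0)
  then show "\<delta> * A 0 x \<le> 1" using dg_ge[OF assms(1)] \<delta> dg_pos[OF assms(1)] by simp
qed

text \<open>The point is a bound that is multiplicative in g: the free gaps between prescribed darts
  may then be distributed arbitrarily, and only their total length matters.\<close>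

lemma kernel_bound:
  assumes U: "U \<subseteq> X" and n: "0 < n" and B: "\<And>u. u \<in> U \<Longrightarrow> A n u \<le> B"
    and uv: "u \<in> U" "v \<in> U" and g: "g \<le> n"
  shows "H g u v \<le> 1 / \<delta> * ((\<delta> * B) powr (1 / n)) ^ g"
proof -
  let ?M = "(\<delta> * B) powr (1 / n)"
  have B0: "0 < B" using B[OF uv(1)] A_pos[of u n] U uv by force
  have M: "?M ^ n = \<delta> * B" using B0 \<delta> n by (simp add: powr_realpow[symmetric] powr_powr)
  have *: "\<delta> * A g w \<le> ?M ^ g" if w: "w \<in> U" for w
  proof -
    have wX: "w \<in> X" using w U by auto
    have "(\<delta> * A g w) ^ n \<le> (\<delta> * A n w) ^ g" by (rule A_root[OF wX g])
    also have "\<dots> \<le> (\<delta> * B) ^ g"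
      using B[OF w] \<delta> A_pos[OF wX, of n] by (intro power_mono mult_left_mono) auto
    also have "\<dots> = (?M ^ n) ^ g" by (simp only: M)
    also have "\<dots> = (?M ^ g) ^ n" by (simp only: power_mult[symmetric] mult.commute)
    finally have "(\<delta> * A g w) ^ Suc (n - 1) \<le> (?M ^ g) ^ Suc (n - 1)" using n by simp
    then show ?thesis by (rule power_le_imp_le_base) simp
  qed
  have X: "u \<in> X" "v \<in> X" using uv U by auto
  have "(\<delta> * H g u v)\<^sup>2 \<le> (\<delta> * A g u) * (\<delta> * A g v)"
    using mult_left_mono[OF H_le_A[OF X, of g], of "\<delta>\<^sup>2"] by (simp add: power2_eq_square mult_ac)
  also have "\<dots> \<le> ?M ^ g * ?M ^ g"
    using *[OF uv(1)] *[OF uv(2)] \<delta> A_pos[OF X(1), of g] A_pos[OF X(2), of g] by (intro mult_mono) auto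
  finally have "(\<delta> * H g u v)\<^sup>2 \<le> (?M ^ g)\<^sup>2" by (simp only: power2_eq_square)
  then have "\<delta> * H g u v \<le> ?M ^ g" by (rule power2_le_imp_le) simp
  then have "\<delta> * H g u v / \<delta> \<le> ?M ^ g / \<delta>" using \<delta> by (intro divide_right_mono) auto
  then show ?thesis using \<delta> by simp
qed

section \<open>Mass of walks through prescribed darts\<close>

definition pcut where "pcut w = map2 cut (replicate (length w) \<kappa>) (pat w)"

lemma pcut_simps:
  "pcut [] = []" "pcut (None # w) = \<kappa> # pcut w" "pcut (Some d # w) = cut \<kappa> {d} # pcut w"
  by (auto simp: pcut_def pat_def cut_def)

lemma append_X: "x \<in> X \<Longrightarrow> walk_sum D x (cs @ cs') y = (\<Sum>z\<in>X. walk_sum D x cs z * walk_sum D z cs' y)"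
  using walk_sum_append[OF finD finX] dart_X by blast

lemma trace_cyclic: "(\<Sum>x\<in>X. walk_sum D x (cs @ cs') x) = (\<Sum>x\<in>X. walk_sum D x (cs' @ cs) x)"
proof -
  have "(\<Sum>x\<in>X. walk_sum D x (cs @ cs') x) = (\<Sum>x\<in>X. \<Sum>z\<in>X. walk_sum D x cs z * walk_sum D z cs' x)"
    by (simp add: append_X)
  also have "\<dots> = (\<Sum>z\<in>X. \<Sum>x\<in>X. walk_sum D z cs' x * walk_sum D x cs z)"
    by (subst sum.swap) (simp add: mult.commute)
  also have "\<dots> = (\<Sum>x\<in>X. walk_sum D x (cs' @ cs) x)" by (simp add: append_X)
  finally show ?thesis .
qed

text \<open>Dividing by dg x turns a free gap into a value of \<open>H\<close>, bounded by c M^gap,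
  and the weight 1 / dg (dst d) of a prescribed dart is exactly the division needed for the gap
  after it. So j darts and j + 1 gaps, some possibly empty, give c^(j + 1) times M to the number of
  free steps. The leading \<open>g\<close> collects free steps during the induction.\<close>

lemma open_pattern_bound:
  assumes U: "U \<subseteq> X" and c: "0 \<le> c" "0 \<le> M"
    and HB: "\<And>u v g. u \<in> U \<Longrightarrow> v \<in> U \<Longrightarrow> g \<le> n \<Longrightarrow> H g u v \<le> c * M ^ g"
    and y: "y \<in> U"
  shows "x \<in> U \<Longrightarrow> set (picked w) \<subseteq> {d\<in>D. src d \<in> U \<and> dst d \<in> U} \<Longrightarrow>
    g + (length w - length (picked w)) + g' \<le> n \<Longrightarrow> length (picked w) \<le> length w \<Longrightarrow>
    walk_sum D x (replicate g \<kappa> @ pcut w @ replicate g' \<kappa>) y / dg x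
      \<le> c ^ Suc (length (picked w)) * M ^ (g + (length w - length (picked w)) + g')"
proof (induction w arbitrary: x g rule: picked.induct)
  case 1
  then show ?case using HB[OF 1(1) y, of "g + g'"]
    by (simp add: pcut_simps H_def G_def flip: replicate_add)
next
  case (2 w)
  have "length (picked w) \<le> length w" by (induction w rule: picked.induct) auto
  then have e: "Suc g + (length w - length (picked w)) = g + (length (None # w) - length (picked (None # w)))" by simp
  show ?case using 2(1)[of x "Suc g"] 2(2-) \<open>length (picked w) \<le> length w\<close> unfolding e
    by (simp add: pcut_simps replicate_app_Cons_same)
next
  case (3 d w)
  have d: "d \<in> D" "src d \<in> U" "dst d \<in> U" using 3 by auto
  have xX: "x \<in> X" using 3 U by auto
  have "walk_sum D x (replicate g \<kappa> @ pcut (Some d # w) @ replicate g' \<kappa>) y =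
     (\<Sum>z\<in>X. if src d = z then G g x z * (\<kappa> d * walk_sum D (dst d) (pcut w @ replicate g' \<kappa>) y) else 0)"
    unfolding append_X[OF xX] G_def by (intro sum.cong refl) (simp add: pcut_simps walk_sum_single[OF finD d(1)] del: walk_sum.simps)
  also have "\<dots> = G g x (src d) * (\<kappa> d * walk_sum D (dst d) (pcut w @ replicate g' \<kappa>) y)"
    using finX d U by auto
  finally have "walk_sum D x (replicate g \<kappa> @ pcut (Some d # w) @ replicate g' \<kappa>) y / dg x
      = H g x (src d) * (walk_sum D (dst d) (pcut w @ replicate g' \<kappa>) y / dg (dst d))"
    by (simp add: H_def \<kappa>_def)
  also have "\<dots> \<le> (c * M ^ g) * (c ^ Suc (length (picked w)) * M ^ (0 + (length w - length (picked w)) + g'))"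
  proof (rule mult_mono)
    show "H g x (src d) \<le> c * M ^ g" using HB[of x "src d" g] 3 d by auto
    show "walk_sum D (dst d) (pcut w @ replicate g' \<kappa>) y / dg (dst d)
      \<le> c ^ Suc (length (picked w)) * M ^ (0 + (length w - length (picked w)) + g')"
      using 3(1)[of "dst d" 0] 3(2-) d by simp
    have "0 \<le> walk_sum D (dst d) (pcut w @ replicate g' \<kappa>) y"
      by (rule walk_sum_nonneg[OF finD]) (auto simp: pcut_def pat_def cut_def set_zip \<kappa>_def dg_def)
    then show "0 \<le> walk_sum D (dst d) (pcut w @ replicate g' \<kappa>) y / dg (dst d)" by (simp add: dg_def)
  qed (use c in auto)
  also have "\<dots> = c ^ Suc (length (picked (Some d # w))) * M ^ (g + (length (Some d # w) - length (picked (Some d # w))) + g')"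
    by (simp add: power_add)
  finally show ?case .
qed

lemma length_picked: "length (picked w) \<le> length w"
  by (induction w rule: picked.induct) auto

text \<open>Free steps in front are rotated to the back, which leaves the trace unchanged, until a
  prescribed dart comes first. This dart closes up the open pattern formed by the rest, so only j
  factors c occur.\<close>

lemma closed_pattern_bound:
  assumes U: "U \<subseteq> X" and c: "0 \<le> c" "0 \<le> M"
    and HB: "\<And>u v g. u \<in> U \<Longrightarrow> v \<in> U \<Longrightarrow> g \<le> n \<Longrightarrow> H g u v \<le> c * M ^ g"
  shows "picked w \<noteq> [] \<Longrightarrow> set (picked w) \<subseteq> {d\<in>D. src d \<in> U \<and> dst d \<in> U} \<Longrightarrow>
    length w - length (picked w) + g' \<le> n \<Longrightarrow>
    (\<Sum>x\<in>X. walk_sum D x (pcut w @ replicate g' \<kappa>) x)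
      \<le> c ^ length (picked w) * M ^ (length w - length (picked w) + g')"
proof (induction w arbitrary: g' rule: picked.induct)
  case (2 w)
  have "(\<Sum>x\<in>X. walk_sum D x (pcut (None # w) @ replicate g' \<kappa>) x) =
      (\<Sum>x\<in>X. walk_sum D x ([\<kappa>] @ (pcut w @ replicate g' \<kappa>)) x)" by (simp add: pcut_simps)
  also have "\<dots> = (\<Sum>x\<in>X. walk_sum D x ((pcut w @ replicate g' \<kappa>) @ [\<kappa>]) x)" by (rule trace_cyclic)
  also have "\<dots> = (\<Sum>x\<in>X. walk_sum D x (pcut w @ replicate (Suc g') \<kappa>) x)"
    by (simp add: replicate_append_same)
  finally show ?case using 2(1)[of "Suc g'"] 2(2-) length_picked[of w] by (simp add: Suc_diff_le)
next
  case (3 d w)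
  have d: "d \<in> D" "src d \<in> U" "dst d \<in> U" using 3 by auto
  have "(\<Sum>x\<in>X. walk_sum D x (pcut (Some d # w) @ replicate g' \<kappa>) x)
     = (\<Sum>x\<in>X. if src d = x then \<kappa> d * walk_sum D (dst d) (pcut w @ replicate g' \<kappa>) (src d) else 0)"
    by (intro sum.cong refl) (simp add: pcut_simps walk_sum_single[OF finD d(1)] del: walk_sum.simps)
  also have "\<dots> = walk_sum D (dst d) (replicate 0 \<kappa> @ pcut w @ replicate g' \<kappa>) (src d) / dg (dst d)"
    using d U finX by (auto simp: \<kappa>_def)
  also have "\<dots> \<le> c ^ Suc (length (picked w)) * M ^ (0 + (length w - length (picked w)) + g')"
    using 3 d length_picked[of w] by (intro open_pattern_bound[OF U c HB d(2) d(3)]) auto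
  finally show ?case by simp
qed auto

lemma full_pattern_bound:
  "set ds \<subseteq> D \<Longrightarrow> walk_sum D x (pcut (map Some ds)) y \<le> (1 / \<delta>) ^ length ds"
proof (induction ds arbitrary: x)
  case (Cons d ds)
  have "\<kappa> d \<le> 1 / \<delta>"
    using Cons.prems dart_X[of d] dg_ge[of "dst d"] \<delta> by (auto simp: \<kappa>_def intro!: divide_left_mono mult_pos_pos dg_pos)
  then have "\<kappa> d * walk_sum D (dst d) (pcut (map Some ds)) y \<le> (1 / \<delta>) * (1 / \<delta>) ^ length ds"
    using Cons \<delta> by (intro mult_mono walk_sum_nonneg[OF finD]) (auto simp: pcut_def pat_def cut_def set_zip \<kappa>_def dg_def)
  then show ?case using Cons.prems \<delta> by (simp add: pcut_simps walk_sum_single[OF finD] del: walk_sum.simps)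
qed (simp add: pcut_simps)

lemma picked_full: "length (picked w) = length w \<Longrightarrow> w = map Some (picked w)"
proof (induction w rule: picked.induct)
  case (2 w) then show ?case using length_picked[of w] by simp
qed auto

text \<open>Let B be the largest A (n - j) u over the end points of \<open>\<sigma>\<close>. With
  M^(n - j) = \<delta> B the bound \<delta>^(-j) M^(n - j) becomes \<delta>^(-(j - 1)) B. Replacing
  the maximum by the sum over all end points makes the bound additive over the edges of
  \<open>\<sigma>\<close>.\<close>

lemma pattern_mass:
  assumes p: "pp \<in> patterns D n (j, \<sigma>)" and j: "1 \<le> j" and \<sigma>: "\<sigma> \<subseteq> F"
  shows "bad_mass D X (\<lambda>_. replicate n \<kappa>) (pat pp) \<le> (1 / \<delta>) ^ (j - 1) * (\<Sum>e\<in>\<sigma>. \<Sum>u\<in>p e. A (n - j) u)"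
proof -
  have len: "length pp = n" "length (picked pp) = j" "set (picked pp) \<subseteq> D" "edge ` set (picked pp) = \<sigma>"
    using p by (auto simp: patterns_def)
  have jn: "j \<le> n" using length_picked[of pp] len by simp
  define U where "U = \<Union> (p ` \<sigma>)"
  have U: "U \<subseteq> X" using \<sigma> by (auto simp: U_def X_def)
  have f\<sigma>: "finite \<sigma>" using \<sigma> finF finite_subset by auto
  have fU: "finite U" unfolding U_def using f\<sigma> \<sigma> fin_p by auto
  have dU: "src d \<in> U \<and> dst d \<in> U" if "d \<in> set (picked pp)" for d
  proof -
    have "d \<in> D" "edge d \<in> \<sigma>" using that len by auto
    moreover from this have "src d \<in> p (edge d)" "dst d \<in> p (edge d)" by (auto simp: D_def)
    ultimately show ?thesis by (auto simp: U_def)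
  qed
  have ne: "picked pp \<noteq> []" using len j by auto
  then have "hd (picked pp) \<in> set (picked pp)" by simp
  then have "src (hd (picked pp)) \<in> U" using dU by blast
  then have Une: "U \<noteq> {}" by blast
  have bm: "bad_mass D X (\<lambda>_. replicate n \<kappa>) (pat pp) = (\<Sum>x\<in>X. walk_sum D x (pcut pp) x)"
    by (simp add: bad_mass_def pcut_def len)
  have sum_ge: "A k u \<le> (\<Sum>e\<in>\<sigma>. \<Sum>u\<in>p e. A k u)" if u: "u \<in> U" for u k
  proof -
    obtain e where e: "e \<in> \<sigma>" "u \<in> p e" using u by (auto simp: U_def)
    have nn: "0 \<le> A k u" if "e \<in> \<sigma>" "u \<in> p e" for e u
      using A_pos[of u k] that \<sigma> by (auto simp: X_def intro: less_imp_le)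
    have "A k u \<le> (\<Sum>u\<in>p e. A k u)" using e nn \<sigma> fin_p by (intro member_le_sum) auto
    also have "\<dots> \<le> (\<Sum>e\<in>\<sigma>. \<Sum>u\<in>p e. A k u)" using e f\<sigma> nn by (intro member_le_sum) (auto intro!: sum_nonneg)
    finally show ?thesis .
  qed
  show ?thesis
  proof (cases "j = n")
    case True
    \<comment> \<open>Without a free step there is no root to take; the weights are bounded
      directly, the first by A 0 (dst d) = 1 / dg (dst d) and all others by 1 / \<delta>.\<close>
    then have "pp = map Some (picked pp)" using len picked_full by metis
    then obtain d ds where ds: "pp = map Some (d # ds)" "set (d # ds) \<subseteq> D" "length ds = n - 1"
      using len ne by (cases "picked pp") auto
    have d: "d \<in> D" using ds by auto
    have dX: "src d \<in> X" "dst d \<in> X" using dart_X[OF d] by auto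
    have "d \<in> set (picked pp)" by (simp add: ds(1) set_picked)
    then have dU': "dst d \<in> U" using dU by auto
    have "(\<Sum>x\<in>X. walk_sum D x (pcut pp) x) =
        (\<Sum>x\<in>X. if src d = x then \<kappa> d * walk_sum D (dst d) (pcut (map Some ds)) (src d) else 0)"
      by (intro sum.cong refl) (simp add: ds pcut_simps walk_sum_single[OF finD d] del: walk_sum.simps)
    also have "\<dots> = \<kappa> d * walk_sum D (dst d) (pcut (map Some ds)) (src d)" using dX finX by simp
    also have "\<dots> \<le> A 0 (dst d) * (1 / \<delta>) ^ length ds"
    proof (rule mult_mono)
      show "\<kappa> d \<le> A 0 (dst d)" using A_even[of 0 "dst d"] by (simp add: \<kappa>_def H_0)
      show "walk_sum D (dst d) (pcut (map Some ds)) (src d) \<le> (1 / \<delta>) ^ length ds"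
        using ds by (intro full_pattern_bound) auto
    qed (auto intro!: walk_sum_nonneg[OF finD] less_imp_le[OF A_pos] dX simp: pcut_def pat_def cut_def set_zip \<kappa>_def dg_def)
    also have "\<dots> \<le> (\<Sum>e\<in>\<sigma>. \<Sum>u\<in>p e. A 0 u) * (1 / \<delta>) ^ length ds"
      using sum_ge[OF dU'] \<delta> by (intro mult_right_mono) auto
    finally show ?thesis unfolding bm using True ds(3) by (simp add: mult.commute)
  next
    case False
    then have n: "0 < n - j" using jn by simp
    define B where "B = Max (A (n - j) ` U)"
    have B: "A (n - j) u \<le> B" if "u \<in> U" for u using that fU by (simp add: B_def)
    have "B \<in> A (n - j) ` U" unfolding B_def using fU Une by (intro Max_in) auto
    then obtain u0 where u0: "u0 \<in> U" "B = A (n - j) u0" by blast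
    have B0: "0 < B" using u0 A_pos U by auto
    let ?M = "(\<delta> * B) powr (1 / real (n - j))"
    have "(\<Sum>x\<in>X. walk_sum D x (pcut pp @ replicate 0 \<kappa>) x) \<le> (1 / \<delta>) ^ length (picked pp) * ?M ^ (length pp - length (picked pp) + 0)"
    proof (rule closed_pattern_bound[OF U])
      show "H g u v \<le> 1 / \<delta> * ?M ^ g" if "u \<in> U" "v \<in> U" "g \<le> n - j" for u v g
        by (rule kernel_bound[OF U n B that])
    qed (use \<delta> ne dU len in auto)
    also have "\<dots> = (1 / \<delta>) ^ j * (\<delta> * B)"
      using n B0 \<delta> by (simp add: len powr_realpow[symmetric] powr_powr)
    also have "\<dots> = (1 / \<delta>) ^ (j - 1) * B" using j \<delta> by (cases j) auto
    also have "\<dots> \<le> (1 / \<delta>) ^ (j - 1) * (\<Sum>e\<in>\<sigma>. \<Sum>u\<in>p e. A (n - j) u)"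
      using sum_ge[OF u0(1), of "n - j"] u0(2) \<delta> by (intro mult_left_mono) auto
    finally show ?thesis by (simp add: bm)
  qed
qed

section \<open>Degree-weighted traces and their decay\<close>

definition Y where "Y n = (\<Sum>u\<in>X. dg u * A n u)"

lemma Y_pos: "0 < Y n"
  unfolding Y_def using finX neX A_pos dg_pos by (intro sum_pos) auto

text \<open>Cauchy-Schwarz, used to carry pointwise log-convexity over to degree-weighted
  sums.\<close>

lemma sum_sq_le:
  assumes "\<And>x. x \<in> X \<Longrightarrow> (f x)\<^sup>2 \<le> g x * h x" "\<And>x. x \<in> X \<Longrightarrow> 0 \<le> f x" 
    "\<And>x. x \<in> X \<Longrightarrow> 0 \<le> g x" "\<And>x. x \<in> X \<Longrightarrow> 0 \<le> h x"
  shows "(\<Sum>x\<in>X. dg x * f x)\<^sup>2 \<le> (\<Sum>x\<in>X. dg x * g x) * (\<Sum>x\<in>X. dg x * h x)"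
proof -
  have "(\<Sum>x\<in>X. dg x * f x) \<le> (\<Sum>x\<in>X. dg x * sqrt (g x) * sqrt (h x))"
    using assms by (intro sum_mono) (auto simp: mult.assoc real_sqrt_mult[symmetric] dg_def intro!: mult_left_mono real_le_rsqrt)
  then have "(\<Sum>x\<in>X. dg x * f x)\<^sup>2 \<le> (\<Sum>x\<in>X. dg x * sqrt (g x) * sqrt (h x))\<^sup>2"
    using assms by (intro power_mono) (auto intro!: sum_nonneg mult_nonneg_nonneg simp: dg_def)
  also have "\<dots> \<le> (\<Sum>x\<in>X. dg x * (sqrt (g x))\<^sup>2) * (\<Sum>x\<in>X. dg x * (sqrt (h x))\<^sup>2)"
    by (rule weighted_Cauchy_Schwarz[OF finX]) (simp add: dg_def)
  finally show ?thesis using assms by simp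
qed

lemma Y_step: "(Y (Suc g))\<^sup>2 \<le> Y g * Y (Suc (Suc g))"
  unfolding Y_def using A_log_convex A_pos by (intro sum_sq_le) (auto simp: log_convex_def less_imp_le)

lemma Y_even_step: "(Y (2 * Suc k))\<^sup>2 \<le> Y (2 * k) * Y (2 * Suc (Suc k))"
  unfolding Y_def
proof (intro sum_sq_le)
  fix x assume x: "x \<in> X"
  show "(A (2 * Suc k) x)\<^sup>2 \<le> A (2 * k) x * A (2 * Suc (Suc k)) x"
    using H_Cauchy_Schwarz[OF x x, of k "Suc (Suc k)"] unfolding A_even by (simp add: mult_2)
qed (use A_pos less_imp_le in blast)+

lemma Y_0: "Y 0 = real (card X)"
proof -
  have "Y 0 = (\<Sum>u\<in>X. 1)"
    unfolding Y_def using A_even[of 0] dg_pos by (intro sum.cong refl) (fastforce simp: H_0)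
  then show ?thesis by simp
qed

text \<open>dg x * A 2 x is the probability of being back after two steps: from any neighbour at
  most m of its at least \<delta> edges lead to x.\<close>

lemma return_two: "x \<in> X \<Longrightarrow> dg x * A 2 x \<le> m / \<delta>"
proof -
  assume x: "x \<in> X"
  have "A 2 x = H (Suc 0 + Suc 0) x x" using A_even[of 1 x] by (simp add: numeral_2_eq_2)
  also have "\<dots> = (\<Sum>z\<in>X. dg z * H (Suc 0) x z * H (Suc 0) z x)" by (rule H_add[OF x])
  also have "\<dots> = (\<Sum>z\<in>X. q x z / dg z * (q x z / (dg x * dg x)))"
    using dg_pos[OF x] dg_pos x by (intro sum.cong refl) (fastforce simp: H_1 q_sym[of _ x])
  also have "\<dots> \<le> (\<Sum>z\<in>X. m / \<delta> * (q x z / (dg x * dg x)))"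
    using q_le q_nonneg dg_ge \<delta> m_nonneg by (intro sum_mono mult_right_mono frac_le) (auto simp: dg_def intro: order_trans)
  also have "\<dots> = m / \<delta> * (dg x / (dg x * dg x))"
    by (simp add: sum_q[OF x, symmetric] sum_distrib_left sum_divide_distrib)
  finally have "dg x * A 2 x \<le> dg x * (m / \<delta> * (dg x / (dg x * dg x)))"
    using dg_pos[OF x] by (intro mult_left_mono) auto
  then show ?thesis using dg_pos[OF x] by simp
qed

lemma Y_2: "Y 2 \<le> real (card X) * (m / \<delta>)"
  unfolding Y_def using sum_bounded_above[of X "\<lambda>u. dg u * A 2 u" "m / \<delta>"] return_two by simp

text \<open>The trace of an even power is at least the contribution of the eigenvalue 1. Spectra are
  avoided by applying Cauchy-Schwarz to the double sum of dg x * dg y * H k x y, which equals the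
  sum of all degrees.\<close>

lemma Y_top: "1 \<le> Y (2 * k)"
proof -
  let ?T = "\<Sum>x\<in>X. dg x"
  have T: "0 < ?T" using finX neX dg_pos by (intro sum_pos) auto
  have "?T = (\<Sum>x\<in>X. dg x * (\<Sum>y\<in>X. dg y * H k x y))" by (intro sum.cong refl) (simp add: sum_H)
  also have "\<dots> = (\<Sum>(x, y)\<in>X \<times> X. (dg x * dg y) * H k x y * 1)"
    by (simp add: sum.cartesian_product[symmetric] sum_distrib_left mult_ac)
  finally have "?T\<^sup>2 = (\<Sum>t\<in>X \<times> X. (dg (fst t) * dg (snd t)) * H k (fst t) (snd t) * 1)\<^sup>2"
    by (simp add: case_prod_unfold)
  also have "\<dots> \<le> (\<Sum>t\<in>X \<times> X. (dg (fst t) * dg (snd t)) * (H k (fst t) (snd t))\<^sup>2) *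
       (\<Sum>t\<in>X \<times> X. (dg (fst t) * dg (snd t)) * 1\<^sup>2)"
    using finX by (intro weighted_Cauchy_Schwarz) (auto simp: dg_def)
  also have "(\<Sum>t\<in>X \<times> X. (dg (fst t) * dg (snd t)) * 1\<^sup>2) = ?T\<^sup>2"
    by (simp add: power2_eq_square sum_product sum.cartesian_product case_prod_unfold)
  also have "(\<Sum>t\<in>X \<times> X. (dg (fst t) * dg (snd t)) * (H k (fst t) (snd t))\<^sup>2)
      = (\<Sum>x\<in>X. \<Sum>y\<in>X. dg x * (dg y * H k x y * H k y x))"
    unfolding sum.cartesian_product
    by (intro sum.cong refl) (auto simp: power2_eq_square H_sym[of _ _ k] mult_ac)
  also have "\<dots> = Y (2 * k)"
    unfolding Y_def
  proof (intro sum.cong refl)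
    fix x assume "x \<in> X"
    then show "(\<Sum>y\<in>X. dg x * (dg y * H k x y * H k y x)) = dg x * A (2 * k) x"
      using H_add[of x k k x] A_even[of k x] by (simp add: mult_2 sum_distrib_left)
  qed
  finally show ?thesis using T by simp
qed

text \<open>The bound \<theta>^(2 l - 1) |X| \<le> 1 and Y (2 l) \<ge> 1 settle g = 0, and
  \<open>top\<close> settles g = 2 l - 2. Log-convexity interpolates the even g in between, and for
  odd g the trace is at most the geometric mean of its neighbours.\<close>

lemma Y_decay:
  assumes \<theta>: "0 < \<theta>" "\<theta> ^ (2 * l - 1) * real (card X) \<le> 1" "\<theta> ^ (l - 1) * (real (card X) * (m / \<delta>)) \<le> 1"
    and l: "2 \<le> l" and g: "g \<le> 2 * l - 2"
  shows "\<theta> ^ (2 * l - 1 - g) * Y g \<le> Y (2 * l)"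
proof -
  define e where "e k = Y (2 * k)" for k
  have e: "log_convex e"
    using Y_pos Y_even_step by (simp add: log_convex_def e_def)
  have epos: "0 < e k" for k by (rule log_convex_pos[OF e])
  obtain k where k: "l = Suc k" "1 \<le> k" using l by (cases l) auto
  have el: "1 \<le> e l" using Y_top by (simp add: e_def)
  \<comment> \<open>If the last ratio were below \<open>\<theta>\<close>, so would be all earlier
    ones, and Y (2 l) < \<theta>^(l - 1) Y 2 \<le> 1 would contradict \<open>Y_top\<close>.\<close>
  have top: "\<theta> * e k \<le> e l"
  proof (rule ccontr)
    assume "\<not> ?thesis"
    then have lt: "e l / e k < \<theta>" using epos[of k] by (simp add: field_simps)
    have "e l / e 1 \<le> (e l / e k) ^ k" using log_convex_ratio[OF e, of k] k by simp
    also have "\<dots> < \<theta> ^ k" using lt k epos[of l] epos[of k] by (intro power_strict_mono) auto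
    finally have "e l < \<theta> ^ k * e 1" using epos[of 1] by (simp add: field_simps)
    also have "\<dots> \<le> \<theta> ^ k * (real (card X) * (m / \<delta>))"
      using Y_2 \<theta> by (intro mult_left_mono) (auto simp: e_def)
    also have "\<dots> \<le> 1" using \<theta>(3) k by simp
    finally show False using el by simp
  qed
  \<comment> \<open>Normalised so that the claim for g = 2 j reads y j \<le> 1.\<close>
  define y where "y j = \<theta> ^ (2 * l - 1) / e l * (e j / (\<theta>\<^sup>2) ^ j)" for j
  have "log_convex y"
    unfolding log_convex_def
  proof (intro conjI allI)
    fix j
    show "0 < y j" using \<theta> epos by (simp add: y_def)
    have "(y (Suc j))\<^sup>2 = (\<theta> ^ (2 * l - 1) / e l)\<^sup>2 * ((e (Suc j))\<^sup>2 / (\<theta>\<^sup>2) ^ (2 * Suc j))"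
      unfolding y_def power_mult_distrib power_divide power_even_eq[of "\<theta>\<^sup>2" "Suc j"] by simp
    also have "\<dots> \<le> (\<theta> ^ (2 * l - 1) / e l)\<^sup>2 * ((e j * e (Suc (Suc j))) / (\<theta>\<^sup>2) ^ (2 * Suc j))"
      using e \<theta> by (intro mult_left_mono divide_right_mono) (auto simp: log_convex_def)
    also have "(\<theta>\<^sup>2) ^ (2 * Suc j) = (\<theta>\<^sup>2) ^ j * (\<theta>\<^sup>2) ^ Suc (Suc j)" 
    proof -
      have "2 * Suc j = j + Suc (Suc j)" by simp
      then show ?thesis by (simp only: power_add)
    qed
    also have "c\<^sup>2 * ((a * b) / (u * v)) = (c * (a / u)) * (c * (b / v))" for a b c u v :: real
      by (simp add: power2_eq_square)
    also have "\<theta> ^ (2 * l - 1) / e l * (e j / (\<theta>\<^sup>2) ^ j) * (\<theta> ^ (2 * l - 1) / e l * (e (Suc (Suc j)) / (\<theta>\<^sup>2) ^ Suc (Suc j)))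
        = y j * y (Suc (Suc j))" by (simp only: y_def)
    finally show "(y (Suc j))\<^sup>2 \<le> y j * y (Suc (Suc j))" .
  qed
  moreover have "y 0 \<le> 1"
  proof -
    have "\<theta> ^ (2 * l - 1) * e 0 \<le> e l" using \<theta>(2) el Y_0 by (simp add: e_def)
    then show ?thesis using epos[of l] by (simp add: y_def)
  qed
  moreover have "y k \<le> 1"
  proof -
    have "\<theta> ^ (2 * l - 1) = \<theta> * (\<theta>\<^sup>2) ^ k" by (simp add: k power_mult)
    then show ?thesis using top \<theta> epos[of l] by (simp add: y_def)
  qed
  ultimately have y1: "y j \<le> 1" if "j \<le> k" for j using log_convex_le_one that by blast
  have even: "\<theta> ^ (2 * l - 1 - 2 * j) * e j \<le> e l" if j: "j \<le> k" for j
  proof -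
    have "\<theta> ^ (2 * l - 1) = \<theta> ^ (2 * l - 1 - 2 * j) * (\<theta>\<^sup>2) ^ j"
      using j k by (simp add: power_mult[symmetric] power_add[symmetric])
    then have "y j = \<theta> ^ (2 * l - 1 - 2 * j) * e j / e l" using \<theta> by (simp add: y_def)
    then have "\<theta> ^ (2 * l - 1 - 2 * j) * e j / e l \<le> 1" using y1[OF j] by simp
    then show ?thesis using epos[of l] by simp
  qed
  show ?thesis
  proof (cases "Parity.even g")
    case True
    then obtain j where "g = 2 * j" by (auto elim!: evenE)
    then show ?thesis using even[of j] g k by (simp add: e_def)
  next
    case False
    then obtain j where j: "g = Suc (2 * j)" by (auto elim!: oddE)
    have jk: "j \<le> k" "Suc j \<le> k" using g j k by auto
    have "(\<theta> ^ (2 * l - 1 - g) * Y g)\<^sup>2 = \<theta> ^ (2 * (2 * l - 1 - g)) * (Y g)\<^sup>2"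
      by (simp add: power_mult_distrib power_mult[symmetric] mult.commute)
    also have "\<dots> \<le> \<theta> ^ (2 * (2 * l - 1 - g)) * (e j * e (Suc j))"
      using Y_step[of "2 * j"] \<theta> by (intro mult_left_mono) (auto simp: j e_def)
    also have "2 * (2 * l - 1 - g) = (2 * l - 1 - 2 * j) + (2 * l - 1 - 2 * Suc j)" using jk j k by simp
    also have "\<theta> ^ \<dots> * (e j * e (Suc j)) = (\<theta> ^ (2 * l - 1 - 2 * j) * e j) * (\<theta> ^ (2 * l - 1 - 2 * Suc j) * e (Suc j))"
      by (simp add: power_add)
    also have "\<dots> \<le> e l * e l"
      using even[OF jk(1)] even[OF jk(2)] \<theta> epos by (intro mult_mono) (auto simp: less_imp_le)
    finally have "(\<theta> ^ (2 * l - 1 - g) * Y g)\<^sup>2 \<le> (e l)\<^sup>2" by (simp only: power2_eq_square)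
    then have "\<theta> ^ (2 * l - 1 - g) * Y g \<le> e l" by (rule power2_le_imp_le) (simp add: less_imp_le[OF epos])
    then show ?thesis by (simp only: e_def)
  qed
qed

lemma G_loop: "z \<in> X \<Longrightarrow> G (Suc 0) z z = 0"
  using G_H[of z "Suc 0" z] H_1[of z z] by (simp add: q_def)

text \<open>At a repeated vertex the closed walk splits into two closed walks. Length 1 is
  impossible for want of loops, so the exchange inequality can shift the lengths to 2 and n - 2, and
  a return in two steps has probability at most m / \<delta>.\<close>

lemma vpat_mass:
  assumes ij: "i < j" "j < n" and z: "z \<in> X" and n: "4 \<le> n"
  shows "bad_mass D X (\<lambda>_. replicate n \<kappa>) (vpat n (i, j, z)) \<le> m / \<delta> * (dg z * A (n - 2) z)"
proof -
  obtain g where g: "j = Suc (i + g)" using ij(1) less_iff_Suc_add by auto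
  obtain h where h: "n = Suc (j + h)" using ij(2) less_iff_Suc_add by auto
  have "bad_mass D X (\<lambda>_. replicate n \<kappa>) (vpat n (i, j, z)) =
     (\<Sum>x\<in>X. G (Suc g) z z * (G (Suc h) z x * G i x z))"
    unfolding bad_mass_def
  proof (rule sum.cong[OF refl])
    fix x assume "x \<in> X"
    then show "walk_sum D x (map2 cut (replicate n \<kappa>) (vpat n (i, j, z))) x = G (Suc g) z z * (G (Suc h) z x * G i x z)"
      using walk_sum_vpat[OF finD finX _ _ z ij(1), of x "replicate n \<kappa>" x] dart_X ij(2)
      by (simp add: G_def g h del: walk_sum.simps replicate_Suc)
  qed
  also have "\<dots> = G (Suc g) z z * G (Suc (h + i)) z z"
    using G_add[OF z, of "Suc h" i z] by (simp add: sum_distrib_left)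
  also have "\<dots> \<le> m / \<delta> * (dg z * A (n - 2) z)"
  proof (cases "g = 0 \<or> h + i = 0")
    case True
    have "0 \<le> m / \<delta> * (dg z * A (n - 2) z)"
      using A_pos[OF z, of "n - 2"] dg_pos[OF z] \<delta> q_le[of z z] by (auto simp: q_def intro!: mult_nonneg_nonneg divide_nonneg_pos)
    moreover have "G (Suc g) z z * G (Suc (h + i)) z z = 0" using True G_loop[OF z] by auto
    ultimately show ?thesis by linarith
  next
    case False
    then obtain a b where ab: "g = Suc a" "h + i = Suc b" by (cases g; cases "h + i") auto
    have "G (Suc g) z z * G (Suc (h + i)) z z = (dg z)\<^sup>2 * (H (2 + a) z z * H (2 + b) z z)"
      by (simp add: G_H[OF z] ab power2_eq_square)
    also have "\<dots> \<le> (dg z)\<^sup>2 * (A (2 + a) z * A (2 + b) z)"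
      using H_diag_le_A[OF z] A_pos[OF z] H_nonneg by (intro mult_left_mono mult_mono) (auto simp: less_imp_le)
    also have "\<dots> \<le> (dg z)\<^sup>2 * (A 2 z * A (2 + b + a) z)"
      using log_convex_exchange[OF A_log_convex[OF z], of 2 "2 + b" a] by (intro mult_left_mono) auto
    also have "2 + b + a = n - 2" using ab by (simp add: h g)
    also have "(dg z)\<^sup>2 * (A 2 z * A (n - 2) z) = (dg z * A 2 z) * (dg z * A (n - 2) z)"
      by (simp add: power2_eq_square)
    also have "\<dots> \<le> m / \<delta> * (dg z * A (n - 2) z)"
      using return_two[OF z] A_pos[OF z, of "n - 2"] dg_pos[OF z] by (intro mult_right_mono) (auto simp: less_imp_le)
    finally show ?thesis .
  qed
  finally show ?thesis .
qed

lemma darts_per_edge: "e \<in> F \<Longrightarrow> card {d\<in>D. edge d = e} \<le> 2"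
proof -
  assume e: "e \<in> F"
  then obtain x y where xy: "p e = {x, y}" "x \<noteq> y" using card_p[OF e] by (auto simp: card_2_iff)
  have "{d\<in>D. edge d = e} \<subseteq> {(e, x, y), (e, y, x)}"
    using xy by (auto simp: D_def doubleton_eq_iff)
  then have "card {d\<in>D. edge d = e} \<le> card {(e, x, y), (e, y, x)}" by (intro card_mono) auto
  also have "\<dots> \<le> 2" using card_insert_le_m1[of 2 "{(e, y, x)}" "(e, x, y)"] by simp
  finally show ?thesis .
qed

lemma handshake: "(\<Sum>e\<in>F. \<Sum>u\<in>p e. f u) = (\<Sum>u\<in>X. dg u * f u)"
proof -
  have "(\<Sum>e\<in>F. \<Sum>u\<in>p e. f u) = (\<Sum>e\<in>F. \<Sum>u\<in>X. if u \<in> p e then f u else 0)"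
  proof (rule sum.cong[OF refl])
    fix e assume "e \<in> F"
    then have "X \<inter> {u. u \<in> p e} = p e" by (auto simp: X_def)
    then show "sum f (p e) = (\<Sum>u\<in>X. if u \<in> p e then f u else 0)" using finX by (simp add: sum.If_cases)
  qed
  also have "\<dots> = (\<Sum>u\<in>X. \<Sum>e\<in>F. if u \<in> p e then f u else 0)" by (rule sum.swap)
  also have "\<dots> = (\<Sum>u\<in>X. dg u * f u)"
    by (intro sum.cong refl) (use finF in \<open>simp add: sum.If_cases dg_def Int_def\<close>)
  finally show ?thesis .
qed

lemma total_Y: "(\<Sum>x\<in>X. walk_sum D x (replicate (2 * k) \<kappa>) x) = Y (2 * k)"
  unfolding Y_def by (intro sum.cong refl) (simp add: A_even G_H flip: G_def)

lemma patterns_mass: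
  assumes \<sigma>: "\<sigma> \<subseteq> F" "card \<sigma> \<le> n" and j: "1 \<le> j"
  shows "(\<Sum>w\<in>patterns D n (j, \<sigma>). bad_mass D X (\<lambda>_. replicate n \<kappa>) (pat w))
     \<le> real ((n * 2 + 1) ^ n) * ((1 / \<delta>) ^ (j - 1) * (\<Sum>e\<in>\<sigma>. \<Sum>u\<in>p e. A (n - j) u))"
proof -
  let ?B = "(1 / \<delta>) ^ (j - 1) * (\<Sum>e\<in>\<sigma>. \<Sum>u\<in>p e. A (n - j) u)"
  have f\<sigma>: "finite \<sigma>" using \<sigma> finF finite_subset by auto
  have "0 \<le> A (n - j) u" if "e \<in> \<sigma>" "u \<in> p e" for e u
    using A_pos[of u "n - j"] that \<sigma> by (auto simp: X_def intro: less_imp_le)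
  then have B0: "0 \<le> ?B" using \<delta> by (intro mult_nonneg_nonneg sum_nonneg) auto
  have "(\<Sum>w\<in>patterns D n (j, \<sigma>). bad_mass D X (\<lambda>_. replicate n \<kappa>) (pat w)) \<le> (\<Sum>w\<in>patterns D n (j, \<sigma>). ?B)"
    using pattern_mass[OF _ j \<sigma>(1)] by (intro sum_mono) auto
  also have "\<dots> = real (card (patterns D n (j, \<sigma>))) * ?B" by simp
  also have "\<dots> \<le> real ((n * 2 + 1) ^ n) * ?B"
    using card_patterns(2)[OF finD _ f\<sigma> \<sigma>(2), of 2 j] darts_per_edge \<sigma>(1) B0
    by (intro mult_right_mono of_nat_mono) auto
  finally show ?thesis .
qed

end

lemma sum_over_members:
  assumes "finite F" "finite Q" "\<And>\<sigma>. \<sigma> \<in> Q \<Longrightarrow> \<sigma> \<subseteq> F"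
  shows "(\<Sum>\<sigma>\<in>Q. \<Sum>e\<in>\<sigma>. g e) = (\<Sum>e\<in>F. real (card {\<sigma>\<in>Q. e \<in> \<sigma>}) * (g e :: real))"
proof -
  have "(\<Sum>\<sigma>\<in>Q. \<Sum>e\<in>\<sigma>. g e) = (\<Sum>\<sigma>\<in>Q. \<Sum>e\<in>F. if e \<in> \<sigma> then g e else 0)"
  proof (rule sum.cong[OF refl])
    fix \<sigma> assume "\<sigma> \<in> Q"
    then have "F \<inter> {e. e \<in> \<sigma>} = \<sigma>" using assms(3) by auto
    then show "sum g \<sigma> = (\<Sum>e\<in>F. if e \<in> \<sigma> then g e else 0)" using assms(1) by (simp add: sum.If_cases)
  qed
  also have "\<dots> = (\<Sum>e\<in>F. \<Sum>\<sigma>\<in>Q. if e \<in> \<sigma> then g e else 0)" by (rule sum.swap)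
  also have "\<dots> = (\<Sum>e\<in>F. real (card {\<sigma>\<in>Q. e \<in> \<sigma>}) * g e)"
    by (intro sum.cong refl) (use assms in \<open>simp add: sum.If_cases Int_def\<close>)
  finally show ?thesis .
qed

text \<open>All bad masses are compared with the total T = Y (2 l) by \<open>Y_decay\<close>.
  Repeated vertices and edges have mass of order m / (\<theta> \<delta>) T and 1 / (\<theta>
  \<delta>) T. A saturated set of size j carries a factor \<delta>^(-(j - 1)), the decay another
  \<theta>^(-(j - 1)), and about S^(j - 1) such sets pass through an edge, so that (S / (\<theta>
  \<delta>))^(j - 1) remains.\<close>

lemma assigned_good_cycle:
  fixes F :: "'v set set" and S \<theta> \<delta> m N :: real
  assumes pg: "pair_graph F p \<delta> m" and r: "\<And>e. e \<in> F \<Longrightarrow> p e \<subseteq> e \<and> finite e \<and> card e = r"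
    and l: "2 \<le> l" and c0: "c0 = real ((2 * l * 2 + 1) ^ (2 * l))" and m: "1 \<le> m"
    and N: "real (card (\<Union> (p ` F))) \<le> N"
    and \<theta>: "0 < \<theta>" "\<theta> ^ (2 * l - 1) * N \<le> 1" "\<theta> ^ (l - 1) * (N * (m / \<delta>)) \<le> 1"
    and big: "4 * (real (2 * l))\<^sup>2 * c0 * m \<le> \<theta> * \<delta>"
    and S: "0 \<le> S" "4 * real (2 * l) * c0 * 2 ^ (2 * l + 1) * S \<le> \<theta> * \<delta>"
    and Sat: "\<And>\<sigma>. \<sigma> \<in> Sat \<Longrightarrow> 2 \<le> card \<sigma> \<and> card \<sigma> \<le> 2 * l" "finite Sat"
    and few: "\<And>e j. e \<in> F \<Longrightarrow> 2 \<le> j \<Longrightarrow> j \<le> 2 * l \<Longrightarrow>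
         real (card {\<sigma>\<in>Sat. e \<in> \<sigma> \<and> card \<sigma> = j}) \<le> 2 ^ (2 * l + 1) * S ^ (j - 1)"
  shows "\<exists>A\<in>berge_cycles r (2 * l). A \<subseteq> F \<and> card A = 2 * l \<and> (\<forall>\<sigma>\<in>Sat. \<not> \<sigma> \<subseteq> A)"
proof -
  interpret pair_graph F p \<delta> m by (rule pg)
  define n where "n = 2 * l"
  define Sat' where "Sat' = {\<sigma>\<in>Sat. \<sigma> \<subseteq> F}"
  define T where "T = (\<Sum>x\<in>X. walk_sum D x (replicate n \<kappa>) x)"
  have T: "T = Y n" by (simp add: T_def n_def total_Y)
  have T0: "0 < T" by (simp add: T Y_pos)
  have n4: "4 \<le> n" using l by (simp add: n_def)
  have c01: "1 \<le> c0" by (simp add: c0)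
  have XN: "real (card X) \<le> N" using N by (simp add: X_def)
  have th2: "\<theta> ^ (2 * l - 1) * real (card X) \<le> 1"
    using \<theta> XN by (intro order_trans[OF mult_left_mono \<theta>(2)]) auto
  have th3: "\<theta> ^ (l - 1) * (real (card X) * (m / \<delta>)) \<le> 1"
    using \<theta> XN \<delta> m by (intro order_trans[OF mult_left_mono \<theta>(3)] mult_right_mono) auto
  have decay: "\<theta> ^ (n - 1 - g) * Y g \<le> T" if "g \<le> n - 2" for g
    using Y_decay[OF \<theta>(1) th2 th3 l, of g] that by (simp add: T n_def)
  have Yn2: "\<theta> * Y (n - 2) \<le> T" using decay[of "n - 2"] n4 by simp
  have \<theta>\<delta>: "0 < \<theta> * \<delta>" using \<theta> \<delta> by simp
  have small: "z / (\<theta> * \<delta>) * T \<le> T / 4" if "4 * z \<le> \<theta> * \<delta>" for z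
  proof -
    have "z / (\<theta> * \<delta>) \<le> 1 / 4" using that \<theta>\<delta> by (simp add: field_simps)
    then have "z / (\<theta> * \<delta>) * T \<le> 1 / 4 * T" using T0 by (intro mult_right_mono) auto
    then show ?thesis by simp
  qed
  have "\<exists>A\<in>berge_cycles r n. A \<subseteq> F \<and> card A = n \<and> (\<forall>\<sigma>\<in>Sat'. \<not> \<sigma> \<subseteq> A)"
  proof (rule good_cycle_exists[OF finD finX _ finF, where \<kappa> = "\<lambda>_. replicate n \<kappa>" and q = 2])
    show "edge d \<in> F \<and> src d \<in> X \<and> src d \<in> edge d \<and> dst d \<in> edge d" if "d \<in> D" for d
      using that dart_X[OF that] r by (fastforce simp: D_def)
    show "0 \<le> c d" if "c \<in> set (replicate n \<kappa>)" for c d using that by (auto simp: \<kappa>_def dg_def)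
    show "\<sigma> \<subseteq> F \<and> 2 \<le> card \<sigma> \<and> card \<sigma> \<le> n" if "\<sigma> \<in> Sat'" for \<sigma> using that Sat by (auto simp: Sat'_def n_def)
    show "card {d\<in>D. edge d = e} \<le> 2" if "e \<in> F" for e by (rule darts_per_edge[OF that])
    show "0 < (\<Sum>x\<in>X. walk_sum D x (replicate n \<kappa>) x)" using T0 by (simp add: T_def)
    let ?I = "{(i::nat, j, z). i < j \<and> j < n \<and> z \<in> X}"
    show "(\<Sum>t\<in>?I. bad_mass D X (\<lambda>_. replicate n \<kappa>) (vpat n t)) \<le> (\<Sum>x\<in>X. walk_sum D x (replicate n \<kappa>) x) / 4"
    proof -
      have "(\<Sum>t\<in>?I. bad_mass D X (\<lambda>_. replicate n \<kappa>) (vpat n t)) \<le>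
          (\<Sum>t\<in>?I. m / \<delta> * (dg (snd (snd t)) * A (n - 2) (snd (snd t))))"
        using vpat_mass n4 by (intro sum_mono) auto
      also have "\<dots> \<le> (\<Sum>t\<in>{..<n} \<times> ({..<n} \<times> X). m / \<delta> * (dg (snd (snd t)) * A (n - 2) (snd (snd t))))"
        using finX m \<delta> A_pos[of _ "n - 2"]
        by (intro sum_mono2) (auto intro!: mult_nonneg_nonneg divide_nonneg_nonneg simp: dg_def less_imp_le)
      also have "\<dots> = (\<Sum>i<n. \<Sum>j<n. \<Sum>z\<in>X. m / \<delta> * (dg z * A (n - 2) z))"
        by (simp only: sum.cartesian_product' snd_conv)
      also have "\<dots> = (real n)\<^sup>2 * (m / \<delta> * Y (n - 2))"
        by (simp add: Y_def sum_distrib_left power2_eq_square mult_ac)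
      also have "\<dots> = ((real n)\<^sup>2 * m) / (\<theta> * \<delta>) * (\<theta> * Y (n - 2))" using \<theta> by simp
      also have "\<dots> \<le> ((real n)\<^sup>2 * m) / (\<theta> * \<delta>) * T"
        using Yn2 m \<theta>\<delta> by (intro mult_left_mono) auto
      also have "\<dots> \<le> T / 4"
      proof (rule small)
        have "4 * ((real n)\<^sup>2 * m) * 1 \<le> 4 * ((real n)\<^sup>2 * m) * c0" using c01 m by (intro mult_left_mono) auto
        then show "4 * ((real n)\<^sup>2 * m) \<le> \<theta> * \<delta>" using big by (simp add: n_def mult_ac)
      qed
      finally show ?thesis by (simp add: T_def)
    qed
    show "(\<Sum>e\<in>F. \<Sum>w\<in>patterns D n (2, {e}). bad_mass D X (\<lambda>_. replicate n \<kappa>) (pat w)) \<le> (\<Sum>x\<in>X. walk_sum D x (replicate n \<kappa>) x) / 4"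
    proof -
      have "(\<Sum>e\<in>F. \<Sum>w\<in>patterns D n (2, {e}). bad_mass D X (\<lambda>_. replicate n \<kappa>) (pat w)) \<le>
          (\<Sum>e\<in>F. c0 * ((1 / \<delta>) * (\<Sum>u\<in>p e. A (n - 2) u)))"
      proof (rule sum_mono)
        fix e assume "e \<in> F"
        then show "(\<Sum>w\<in>patterns D n (2, {e}). bad_mass D X (\<lambda>_. replicate n \<kappa>) (pat w)) \<le> c0 * ((1 / \<delta>) * (\<Sum>u\<in>p e. A (n - 2) u))"
          using patterns_mass[of "{e}" n 2] n4 by (simp add: c0 n_def)
      qed
      also have "\<dots> = c0 / \<delta> * Y (n - 2)"
        unfolding Y_def handshake[symmetric] by (simp add: sum_distrib_left)
      also have "\<dots> = c0 / (\<theta> * \<delta>) * (\<theta> * Y (n - 2))" using \<theta> by simp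
      also have "\<dots> \<le> c0 / (\<theta> * \<delta>) * T" using Yn2 c01 \<theta>\<delta> by (intro mult_left_mono) auto
      also have "\<dots> \<le> T / 4"
      proof (rule small)
        have "1 * 1 \<le> (real (2 * l))\<^sup>2 * m" using m l by (intro mult_mono one_le_power) auto
        then have "4 * c0 * 1 \<le> 4 * c0 * ((real (2 * l))\<^sup>2 * m)" using c01 by (intro mult_left_mono) auto
        then show "4 * c0 \<le> \<theta> * \<delta>" using big by (simp add: mult_ac)
      qed
      finally show ?thesis by (simp add: T_def)
    qed
    show "(\<Sum>\<sigma>\<in>Sat'. \<Sum>w\<in>patterns D n (card \<sigma>, \<sigma>). bad_mass D X (\<lambda>_. replicate n \<kappa>) (pat w)) \<le> (\<Sum>x\<in>X. walk_sum D x (replicate n \<kappa>) x) / 4"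
    proof -
      let ?f = "\<lambda>\<sigma>. \<Sum>w\<in>patterns D n (card \<sigma>, \<sigma>). bad_mass D X (\<lambda>_. replicate n \<kappa>) (pat w)"
      have fS: "finite Sat'" using Sat(2) by (simp add: Sat'_def)
      have "(\<Sum>\<sigma>\<in>Sat'. ?f \<sigma>) = (\<Sum>j\<in>{2..n}. \<Sum>\<sigma>\<in>{\<sigma>\<in>Sat'. card \<sigma> = j}. ?f \<sigma>)"
        using fS Sat(1) by (intro sum.group[symmetric]) (auto simp: Sat'_def n_def)
      also have "\<dots> \<le> (\<Sum>j\<in>{2..n}. c0 * 2 ^ (n + 1) * S / (\<theta> * \<delta>) * T)"
      proof (rule sum_mono)
        fix j assume j: "j \<in> {2..n}"
        let ?Q = "{\<sigma>\<in>Sat'. card \<sigma> = j}"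
        have "(\<Sum>\<sigma>\<in>?Q. ?f \<sigma>) \<le> (\<Sum>\<sigma>\<in>?Q. c0 * ((1 / \<delta>) ^ (j - 1) * (\<Sum>e\<in>\<sigma>. \<Sum>u\<in>p e. A (n - j) u)))"
        proof (rule sum_mono)
          fix \<sigma> assume "\<sigma> \<in> ?Q"
          then show "?f \<sigma> \<le> c0 * ((1 / \<delta>) ^ (j - 1) * (\<Sum>e\<in>\<sigma>. \<Sum>u\<in>p e. A (n - j) u))"
            using patterns_mass[of \<sigma> n j] j by (auto simp: c0 n_def Sat'_def)
        qed
        also have "\<dots> = c0 * (1 / \<delta>) ^ (j - 1) * (\<Sum>\<sigma>\<in>?Q. \<Sum>e\<in>\<sigma>. \<Sum>u\<in>p e. A (n - j) u)"
          by (simp add: sum_distrib_left mult.assoc)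
        also have "(\<Sum>\<sigma>\<in>?Q. \<Sum>e\<in>\<sigma>. \<Sum>u\<in>p e. A (n - j) u) =
            (\<Sum>e\<in>F. real (card {\<sigma>\<in>?Q. e \<in> \<sigma>}) * (\<Sum>u\<in>p e. A (n - j) u))"
          using Sat(2) by (intro sum_over_members finF) (auto simp: Sat'_def)
        also have "\<dots> \<le> (\<Sum>e\<in>F. 2 ^ (n + 1) * S ^ (j - 1) * (\<Sum>u\<in>p e. A (n - j) u))"
        proof (intro sum_mono mult_right_mono)
          fix e assume e: "e \<in> F"
          have "card {\<sigma>\<in>?Q. e \<in> \<sigma>} \<le> card {\<sigma>\<in>Sat. e \<in> \<sigma> \<and> card \<sigma> = j}"
            using Sat(2) by (intro card_mono) (auto simp: Sat'_def)
          then show "real (card {\<sigma>\<in>?Q. e \<in> \<sigma>}) \<le> 2 ^ (n + 1) * S ^ (j - 1)"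
            using few[OF e, of j] j by (simp add: n_def)
          have "0 \<le> A (n - j) u" if "u \<in> p e" for u
            using e that A_pos[of u "n - j"] by (auto simp: X_def intro: less_imp_le)
          then show "0 \<le> (\<Sum>u\<in>p e. A (n - j) u)" by (rule sum_nonneg)
        qed
        also have "\<dots> = 2 ^ (n + 1) * S ^ (j - 1) * Y (n - j)"
          unfolding Y_def handshake[symmetric] by (simp add: sum_distrib_left)
        finally have "(\<Sum>\<sigma>\<in>?Q. ?f \<sigma>) \<le> c0 * (1 / \<delta>) ^ (j - 1) * (2 ^ (n + 1) * S ^ (j - 1) * Y (n - j))"
          using c01 \<delta> by (simp add: mult_left_mono)
        also have "\<dots> = c0 * 2 ^ (n + 1) * (S / (\<theta> * \<delta>)) ^ (j - 1) * (\<theta> ^ (j - 1) * Y (n - j))"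
          using \<theta>(1) by (simp add: power_divide power_mult_distrib)
        \<comment> \<open>The ratio S / (\<theta> \<delta>) is at most 1, so the size j = 2 is the
          worst one.\<close>
        also have "\<dots> \<le> c0 * 2 ^ (n + 1) * (S / (\<theta> * \<delta>)) ^ 1 * T"
        proof (intro mult_mono)
          have "S * 1 \<le> S * (4 * real (2 * l) * c0 * 2 ^ (2 * l + 1))"
          proof (rule mult_left_mono)
            have "1 \<le> (2::real) ^ (2 * l + 1)" by (rule one_le_power) simp
            then have "1 * 1 * 1 * 1 \<le> 4 * real (2 * l) * c0 * 2 ^ (2 * l + 1)"
              using l c01 by (intro mult_mono) auto
            then show "1 \<le> 4 * real (2 * l) * c0 * 2 ^ (2 * l + 1)" by simp
          qed (rule S)
          also have "\<dots> \<le> \<theta> * \<delta>" using S(2) by (simp only: mult_ac)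
          finally have "S / (\<theta> * \<delta>) \<le> 1" using \<theta>\<delta> by simp
          then show "(S / (\<theta> * \<delta>)) ^ (j - 1) \<le> (S / (\<theta> * \<delta>)) ^ 1"
            using j S \<theta>\<delta> by (intro power_decreasing) auto
          have "n - 1 - (n - j) = j - 1" using j by auto
          then show "\<theta> ^ (j - 1) * Y (n - j) \<le> T" using decay[of "n - j"] j by auto
        qed (use c01 S \<theta> \<theta>\<delta> Y_pos[of "n - j"] in \<open>auto intro!: mult_nonneg_nonneg simp: less_imp_le\<close>)
        finally show "(\<Sum>\<sigma>\<in>?Q. ?f \<sigma>) \<le> c0 * 2 ^ (n + 1) * S / (\<theta> * \<delta>) * T" by simp
      qed
      also have "\<dots> = real (n - 1) * (c0 * 2 ^ (n + 1) * S / (\<theta> * \<delta>) * T)" using n4 by simp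
      also have "\<dots> \<le> real n * (c0 * 2 ^ (n + 1) * S / (\<theta> * \<delta>) * T)"
        using c01 S \<theta> \<delta> T0 by (intro mult_right_mono mult_nonneg_nonneg divide_nonneg_nonneg) auto
      also have "\<dots> = (real n * c0 * 2 ^ (n + 1) * S) / (\<theta> * \<delta>) * T" by simp
      also have "\<dots> \<le> T / 4" using S(2) by (intro small) (simp add: n_def)
      finally show ?thesis by (simp add: T_def)
    qed
  qed (use n4 r in auto)
  then show ?thesis unfolding Sat'_def n_def by (metis (mono_tags, lifting) mem_Collect_eq order_trans)
qed

section \<open>Wheels in vertex links\<close>

text \<open>The triples of \<open>E1\<close> steer the walk, while its pairs are completed to edges
  of the larger \<open>E\<close>. A triple carries at most the fraction 1 / dd of the weight of each
  of its pairs, and \<open>m\<close> is a lower bound for the codegrees in \<open>E\<close>; these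
  are the two sources of randomness.\<close>

locale wheel =
  fixes E E1 :: "'v set set" and tr :: "'v set \<Rightarrow> 'v set" and dd m :: real and r :: nat
  assumes finE: "finite E" and E1: "E1 \<subseteq> E" "E1 \<noteq> {}" and tr: "\<And>e. e \<in> E1 \<Longrightarrow> tr e \<subseteq> e \<and> card (tr e) = 3"
    and unif: "\<And>e. e \<in> E \<Longrightarrow> finite e \<and> card e = r"
    and dd: "1 \<le> dd" and m: "1 \<le> m"
    and spread3: "\<And>e q. e \<in> E1 \<Longrightarrow> q \<subseteq> tr e \<Longrightarrow> card q = 2 \<Longrightarrow>
      real (card {e'\<in>E1. tr e' = tr e}) * dd \<le> real (card {e'\<in>E1. q \<subseteq> tr e'})"
    and codeg: "\<And>e q. e \<in> E1 \<Longrightarrow> q \<subseteq> tr e \<Longrightarrow> card q = 2 \<Longrightarrow> m \<le> real (card {e'\<in>E. q \<subseteq> e'})"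
begin

text \<open>\<open>w u\<close> is the weighted link graph of \<open>u\<close> in the triples and \<open>wp u\<close> its degrees. The closed walk starts and
  ends at \<open>u\<close>: its first dart chooses a vertex with mass \<open>wp u\<close>, the middle ones follow the random walk in the
  link, the last one returns to \<open>u\<close>; the factors \<open>1 / cod\<close> make the edges over the pairs uniform.\<close>

definition X where "X = \<Union> (tr ` E1)"
definition act where "act x y \<longleftrightarrow> x \<noteq> y \<and> (\<exists>e\<in>E1. {x, y} \<subseteq> tr e)"
definition cod where "cod x y = real (card {e\<in>E. {x, y} \<subseteq> e})"
definition wp where "wp x y = (if x = y then 0 else real (card {e\<in>E1. {x, y} \<subseteq> tr e}))"
definition w where "w u x y = (if u \<noteq> x \<and> x \<noteq> y \<and> u \<noteq> y then real (card {e\<in>E1. tr e = {u, x, y}}) else 0)"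
definition D where "D = {(e, x, y). e \<in> E \<and> x \<in> e \<and> y \<in> e \<and> act x y}"
definition first where "first u d = wp u (dst d) / cod (src d) (dst d)"
definition mid where "mid u d = w u (src d) (dst d) / wp u (src d) / cod (src d) (dst d)"
definition last_step where "last_step d = 1 / cod (src d) (dst d)"

lemma finE1: "finite E1" using finE E1 finite_subset by blast
lemma fin_tr: "e \<in> E1 \<Longrightarrow> finite (tr e)" using tr by (intro card_ge_0_finite) auto
lemma finX: "finite X" unfolding X_def using finE1 fin_tr by auto

lemma act_X: "act x y \<Longrightarrow> x \<in> X \<and> y \<in> X" by (auto simp: act_def X_def)
lemma act_sym: "act x y = act y x" by (auto simp: act_def)
lemma wp_sym: "wp x y = wp y x" by (simp add: wp_def insert_commute)
lemma wp_nonneg: "0 \<le> wp x y" by (simp add: wp_def)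
lemma w_nonneg: "0 \<le> w u x y" by (simp add: w_def)
lemma w_swap: "w u x y = w u y x" by (auto simp: w_def insert_commute)
lemma w_rot: "w u x y = w x u y" by (auto simp: w_def insert_commute)

lemma cod_ge: "act x y \<Longrightarrow> m \<le> cod x y"
  unfolding act_def cod_def using codeg[of _ "{x, y}"] by auto

lemma cod_pos: "act x y \<Longrightarrow> 0 < cod x y" using cod_ge m by fastforce

lemma wp_act: "wp x y \<noteq> 0 \<Longrightarrow> act x y"
  unfolding wp_def act_def using finE1 by (auto simp: card_eq_0_iff split: if_splits)

lemma wp_le_cod: "wp x y \<le> cod x y"
proof -
  have "card {e\<in>E1. {x, y} \<subseteq> tr e} \<le> card {e\<in>E. {x, y} \<subseteq> e}"
  proof (rule card_mono)
    show "{e\<in>E1. {x, y} \<subseteq> tr e} \<subseteq> {e\<in>E. {x, y} \<subseteq> e}"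
      using E1(1) tr by (auto dest!: subsetD)
  qed (use finE in simp)
  then show ?thesis by (simp add: wp_def cod_def)
qed

lemma w_witness:
  assumes "w u x y \<noteq> 0"
  obtains e where "e \<in> E1" "tr e = {u, x, y}" "u \<noteq> x" "x \<noteq> y" "u \<noteq> y"
  using assms unfolding w_def by (auto split: if_splits simp: card_eq_0_iff)

lemma w_spread: "w u x y * dd \<le> wp u x"
proof (cases "w u x y = 0")
  case False
  then obtain e where e: "e \<in> E1" "tr e = {u, x, y}" "u \<noteq> x" "x \<noteq> y" "u \<noteq> y" by (rule w_witness)
  then show ?thesis using spread3[of e "{u, x}"] by (simp add: w_def wp_def)
qed (simp add: wp_nonneg)

lemma w_spread2: "w u x y * dd \<le> wp u y" using w_spread[of u y x] by (simp add: w_swap)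

lemma w_act: "w u x y \<noteq> 0 \<Longrightarrow> act x y \<and> act u x \<and> act u y"
  by (erule w_witness) (auto simp: act_def)

lemma w_zero: "wp u x = 0 \<Longrightarrow> w u x y = 0"
  using w_spread[of u x y] w_nonneg[of u x y] dd by (simp add: mult_le_0_iff)

lemma sum_w: "(\<Sum>y\<in>X. w u x y) = wp u x"
proof (cases "u = x")
  case False
  let ?A = "{e\<in>E1. {u, x} \<subseteq> tr e}"
  have "real (card ?A) = (\<Sum>y\<in>X. real (card {e\<in>?A. tr e - {u, x} = {y}}))"
  proof -
    have "?A = (\<Union>y\<in>X. {e\<in>?A. tr e - {u, x} = {y}})"
    proof
      show "?A \<subseteq> (\<Union>y\<in>X. {e\<in>?A. tr e - {u, x} = {y}})"
      proof
        fix e assume e: "e \<in> ?A"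
        then have "card (tr e - {u, x}) = 1" using tr[of e] False fin_tr by (simp add: card_Diff_subset)
        then obtain y where y: "tr e - {u, x} = {y}" by (auto simp: card_1_singleton_iff)
        then have "y \<in> X" using e by (auto simp: X_def)
        then show "e \<in> (\<Union>y\<in>X. {e\<in>?A. tr e - {u, x} = {y}})" using e y by blast
      qed
    qed blast
    then have "real (card ?A) = real (card (\<Union>y\<in>X. {e\<in>?A. tr e - {u, x} = {y}}))" by (rule arg_cong)
    also have "card (\<Union>y\<in>X. {e\<in>?A. tr e - {u, x} = {y}}) = (\<Sum>y\<in>X. card {e\<in>?A. tr e - {u, x} = {y}})"
      using finX finE1 by (intro card_UN_disjoint) auto
    finally show ?thesis by (simp only: of_nat_sum)
  qed
  also have "\<dots> = (\<Sum>y\<in>X. w u x y)"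
  proof (rule sum.cong[OF refl])
    fix y
    show "real (card {e\<in>?A. tr e - {u, x} = {y}}) = w u x y"
    proof (cases "y = u \<or> y = x")
      case True
      then have c: "{e\<in>?A. tr e - {u, x} = {y}} = {}" by auto
      have "w u x y = 0" using True by (auto simp: w_def)
      then show ?thesis unfolding c by simp
    next
      case F: False
      have c: "{e\<in>?A. tr e - {u, x} = {y}} = {e\<in>E1. tr e = {u, x, y}}"
        using F False by auto
      have "w u x y = real (card {e\<in>E1. tr e = {u, x, y}})" using F False by (auto simp: w_def)
      then show ?thesis unfolding c by simp
    qed
  qed
  finally show ?thesis using False by (simp add: wp_def)
qed (simp add: w_def wp_def)

text \<open>Each edge of \<open>E1\<close> contributes the 6 ordered pairs inside its
  triple.\<close>

lemma total_wp: "(\<Sum>u\<in>X. \<Sum>x\<in>X. wp u x) = 6 * real (card E1)"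
proof -
  have "(\<Sum>u\<in>X. \<Sum>x\<in>X. wp u x) = (\<Sum>u\<in>X. \<Sum>x\<in>X. \<Sum>e\<in>E1. if u \<noteq> x \<and> u \<in> tr e \<and> x \<in> tr e then 1 else 0)"
    by (intro sum.cong refl) (use finE1 in \<open>auto simp: wp_def sum.If_cases Int_def conj_commute\<close>)
  also have "\<dots> = (\<Sum>u\<in>X. \<Sum>e\<in>E1. \<Sum>x\<in>X. if u \<noteq> x \<and> u \<in> tr e \<and> x \<in> tr e then 1 else 0)"
    by (rule sum.cong[OF refl], rule sum.swap)
  also have "\<dots> = (\<Sum>e\<in>E1. \<Sum>u\<in>X. \<Sum>x\<in>X. if u \<noteq> x \<and> u \<in> tr e \<and> x \<in> tr e then 1 else 0)"
    by (rule sum.swap)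
  also have "\<dots> = (\<Sum>e\<in>E1. 6)"
  proof (rule sum.cong[OF refl])
    fix e assume e: "e \<in> E1"
    have sub: "tr e \<subseteq> X" using e by (auto simp: X_def)
    have "(\<Sum>u\<in>X. \<Sum>x\<in>X. if u \<noteq> x \<and> u \<in> tr e \<and> x \<in> tr e then 1 else 0) =
        (\<Sum>u\<in>X. if u \<in> tr e then 2 else (0::real))"
    proof (rule sum.cong[OF refl])
      fix u
      show "(\<Sum>x\<in>X. if u \<noteq> x \<and> u \<in> tr e \<and> x \<in> tr e then 1 else 0) = (if u \<in> tr e then 2 else (0::real))"
      proof (cases "u \<in> tr e")
        case True
        have "{x\<in>X. u \<noteq> x \<and> u \<in> tr e \<and> x \<in> tr e} = tr e - {u}" using True sub by auto
        then show ?thesis using True finX tr[OF e] fin_tr[OF e] by (simp add: sum.If_cases Int_def)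
      qed simp
    qed
    also have "\<dots> = 6"
    proof -
      have "X \<inter> {u. u \<in> tr e} = tr e" using sub by auto
      then show ?thesis using finX tr[OF e] by (simp add: sum.If_cases)
    qed
    finally show "(\<Sum>u\<in>X. \<Sum>x\<in>X. if u \<noteq> x \<and> u \<in> tr e \<and> x \<in> tr e then 1 else 0) = (6::real)" .
  qed
  finally show ?thesis by simp
qed

lemma finD: "finite D"
proof -
  have "D \<subseteq> E \<times> X \<times> X" using act_X by (auto simp: D_def)
  then show ?thesis using finE finX finite_subset by blast
qed

lemma dart_X: "d \<in> D \<Longrightarrow> src d \<in> X \<and> dst d \<in> X" using act_X by (auto simp: D_def)

lemma dart_act: "d \<in> D \<Longrightarrow> act (src d) (dst d)" by (auto simp: D_def)

text \<open>The factor 1 / cod cancels the number of edges that complete a pair, so the choice of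
  the edge disappears wherever only end points matter.\<close>

lemma sum_darts:
  "(\<Sum>d\<in>{d\<in>D. src d = x}. f (dst d) / cod x (dst d)) = (\<Sum>y\<in>X. if act x y then f y else 0)"
proof -
  have "(\<Sum>d\<in>{d\<in>D. src d = x}. f (dst d) / cod x (dst d)) =
     (\<Sum>y\<in>X. \<Sum>d\<in>{d\<in>{d\<in>D. src d = x}. dst d = y}. f (dst d) / cod x (dst d))"
    using finD finX dart_X by (intro sum.group[symmetric]) auto
  also have "\<dots> = (\<Sum>y\<in>X. if act x y then f y else 0)"
  proof (rule sum.cong[OF refl])
    fix y
    have "{d\<in>{d\<in>D. src d = x}. dst d = y} = (if act x y then (\<lambda>e. (e, x, y)) ` {e\<in>E. {x, y} \<subseteq> e} else {})"
      by (auto simp: D_def)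
    then have c: "real (card {d\<in>{d\<in>D. src d = x}. dst d = y}) = (if act x y then cod x y else 0)"
      by (simp add: card_image inj_on_def cod_def)
    have "(\<Sum>d\<in>{d\<in>{d\<in>D. src d = x}. dst d = y}. f (dst d) / cod x (dst d)) =
        real (card {d\<in>{d\<in>D. src d = x}. dst d = y}) * (f y / cod x y)" by simp
    then show "(\<Sum>d\<in>{d\<in>{d\<in>D. src d = x}. dst d = y}. f (dst d) / cod x (dst d)) = (if act x y then f y else 0)"
      unfolding c using cod_pos[of x y] by auto
  qed
  finally show ?thesis .
qed

lemma step_mid: "walk_sum D x (mid u # cs) y = (\<Sum>z\<in>X. w u x z / wp u x * walk_sum D z cs y)"
proof -
  have "walk_sum D x (mid u # cs) y = (\<Sum>d\<in>{d\<in>D. src d = x}. (w u x (dst d) / wp u x * walk_sum D (dst d) cs y) / cod x (dst d))"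
    by (simp add: mid_def)
  also have "\<dots> = (\<Sum>z\<in>X. if act x z then w u x z / wp u x * walk_sum D z cs y else 0)" by (rule sum_darts)
  also have "\<dots> = (\<Sum>z\<in>X. w u x z / wp u x * walk_sum D z cs y)"
    using w_act[of u x] by (intro sum.cong refl) auto
  finally show ?thesis .
qed

lemma step_first: "walk_sum D u (first u # cs) y = (\<Sum>z\<in>X. wp u z * walk_sum D z cs y)"
proof -
  have "walk_sum D u (first u # cs) y = (\<Sum>d\<in>{d\<in>D. src d = u}. (wp u (dst d) * walk_sum D (dst d) cs y) / cod u (dst d))"
    by (simp add: first_def)
  also have "\<dots> = (\<Sum>z\<in>X. if act u z then wp u z * walk_sum D z cs y else 0)" by (rule sum_darts)
  also have "\<dots> = (\<Sum>z\<in>X. wp u z * walk_sum D z cs y)"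
    using wp_act[of u] by (intro sum.cong refl) auto
  finally show ?thesis .
qed

lemma step_last: "u \<in> X \<Longrightarrow> walk_sum D x [last_step] u = (if act x u then 1 else 0)"
proof -
  assume u: "u \<in> X"
  have "walk_sum D x [last_step] u = (\<Sum>d\<in>{d\<in>D. src d = x}. (if dst d = u then 1 else 0) / cod x (dst d))"
    by (simp add: last_step_def)
  also have "\<dots> = (\<Sum>z\<in>X. if act x z then (if z = u then 1 else 0) else 0)" by (rule sum_darts)
  also have "\<dots> = (\<Sum>z\<in>X. if z = u then (if act x u then 1 else 0) else 0)" by (intro sum.cong) auto
  also have "\<dots> = (if act x u then 1 else 0)" using finX u by simp
  finally show ?thesis .
qed

end

lemma picked_append: "picked (p @ p') = picked p @ picked p'"
  by (induction p rule: picked.induct) auto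

lemma picked_empty: "picked p = [] \<longleftrightarrow> (\<forall>x\<in>set p. x = None)"
  by (induction p rule: picked.induct) auto

lemma picked_length_eq: "None \<notin> set p \<Longrightarrow> p = map Some (picked p)"
  by (induction p rule: picked.induct) auto

section \<open>Link walks with prescribed middle darts\<close>

context wheel
begin

text \<open>The price of prescribing one middle dart: 1 / dd for its end vertex and 1 / m for its
  edge.\<close>

definition a where "a = 1 / (dd * m)"
definition mcut where "mcut u p = map2 cut (replicate (length p) (mid u)) (pat p)"

lemma a_pos: "0 < a" using dd m by (simp add: a_def)

lemma mcut_simps:
  "mcut u [] = []" "mcut u (None # p) = mid u # mcut u p" "mcut u (Some d # p) = cut (mid u) {d} # mcut u p"
  by (auto simp: mcut_def pat_def cut_def)

lemma mcut_append: "mcut u (p @ p') = mcut u p @ mcut u p'"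
  by (simp add: mcut_def pat_def replicate_add)

lemma mcut_replicate: "mcut u (replicate k None) = replicate k (mid u)"
  by (induction k) (auto simp: mcut_simps)

lemma K_le: "w u x y / wp u x \<le> 1 / dd"
proof (cases "wp u x = 0")
  case True then show ?thesis using dd by simp
next
  case False
  then have "0 < wp u x" using wp_nonneg[of u x] by linarith
  then show ?thesis using w_spread[of u x y] dd by (simp add: field_simps)
qed

lemma K_nonneg: "0 \<le> w u x y / wp u x" using w_nonneg wp_nonneg by simp

lemma sum_K: "(\<Sum>y\<in>X. w u x y / wp u x) \<le> 1"
  by (simp add: sum_divide_distrib[symmetric] sum_w)

lemma wp_K: "wp u x * (w u x y / wp u x) = w u x y"
  using w_zero[of u x y] by (cases "wp u x = 0") auto

lemma mid_nonneg: "0 \<le> mid u d"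
  unfolding mid_def using w_nonneg wp_nonneg by (simp add: cod_def)

lemma mid_le: "d \<in> D \<Longrightarrow> mid u d \<le> a"
proof -
  assume d: "d \<in> D"
  have "mid u d \<le> 1 / dd / m"
    unfolding mid_def using K_le[of u "src d" "dst d"] K_nonneg cod_ge[OF dart_act[OF d]] m dd
    by (intro frac_le[of "1 / dd"]) auto
  then show ?thesis by (simp add: a_def)
qed

lemma wp_mid: "wp u (src d) * mid u d = w u (src d) (dst d) / cod (src d) (dst d)"
  using w_zero[of u "src d" "dst d"] by (cases "wp u (src d) = 0") (auto simp: mid_def)

lemma mcut_nonneg: "c \<in> set (mcut u p) \<Longrightarrow> 0 \<le> c d"
  unfolding mcut_def by (rule map2_cut_nonneg[rotated]) (auto simp: mid_nonneg)

lemma mcut_walk_nonneg: "0 \<le> walk_sum D x (mcut u p) y"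
proof (rule walk_sum_nonneg[OF finD])
  fix c d assume "c \<in> set (mcut u p)"
  then show "0 \<le> c d" by (rule mcut_nonneg)
qed

lemma append_X: "x \<in> X \<Longrightarrow> walk_sum D x (cs @ cs') y = (\<Sum>z\<in>X. walk_sum D x cs z * walk_sum D z cs' y)"
  using walk_sum_append[OF finD finX] dart_X by blast

text \<open>Free steps form a substochastic kernel, and each prescribed dart contributes at most
  \<open>a\<close>.\<close>

lemma mid_total: "set (picked p) \<subseteq> D \<Longrightarrow> (\<Sum>y\<in>X. walk_sum D x (mcut u p) y) \<le> a ^ length (picked p)"
proof (induction p arbitrary: x rule: picked.induct)
  case 1
  then show ?case using finX by (simp add: mcut_simps)
next
  case (2 p)
  have "(\<Sum>y\<in>X. walk_sum D x (mcut u (None # p)) y) = (\<Sum>z\<in>X. w u x z / wp u x * (\<Sum>y\<in>X. walk_sum D z (mcut u p) y))"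
    by (simp add: mcut_simps step_mid sum_distrib_left del: walk_sum.simps) (rule sum.swap)
  also have "\<dots> \<le> (\<Sum>z\<in>X. w u x z / wp u x * a ^ length (picked p))"
    using 2 K_nonneg by (intro sum_mono mult_left_mono) auto
  also have "\<dots> \<le> 1 * a ^ length (picked p)"
    unfolding sum_distrib_right[symmetric] using sum_K a_pos by (intro mult_right_mono) auto
  finally show ?case by simp
next
  case (3 d p)
  then have d: "d \<in> D" by simp
  have "(\<Sum>y\<in>X. walk_sum D x (mcut u (Some d # p)) y) =
     (if src d = x then mid u d * (\<Sum>y\<in>X. walk_sum D (dst d) (mcut u p) y) else 0)"
    by (simp add: mcut_simps walk_sum_single[OF finD d] sum_distrib_left del: walk_sum.simps)
  also have "\<dots> \<le> a * a ^ length (picked p)"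
    using 3 d mid_le[OF d] mid_nonneg a_pos by (auto intro!: mult_mono sum_nonneg mcut_walk_nonneg)
  finally show ?case by simp
qed

lemma mid_end: "set (picked p) \<subseteq> D \<Longrightarrow> y \<in> X \<Longrightarrow> walk_sum D x (mcut u p) y \<le> a ^ length (picked p)"
  using member_le_sum[of y X "\<lambda>y. walk_sum D x (mcut u p) y"] finX mcut_walk_nonneg mid_total[of p x u]
  by fastforce

text \<open>The last free step has to hit one particular vertex, which happens with probability at
  most 1 / dd.\<close>

lemma mid_end_gap:
  "set (picked p) \<subseteq> D \<Longrightarrow> None \<in> set p \<Longrightarrow> y \<in> X \<Longrightarrow> walk_sum D x (mcut u p) y \<le> a ^ length (picked p) * (1 / dd)"
proof (induction p arbitrary: x rule: picked.induct)
  case (2 p)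
  show ?case
  proof (cases "None \<in> set p")
    case True
    have "walk_sum D x (mcut u (None # p)) y = (\<Sum>z\<in>X. w u x z / wp u x * walk_sum D z (mcut u p) y)"
      by (simp add: mcut_simps step_mid del: walk_sum.simps)
    also have "\<dots> \<le> (\<Sum>z\<in>X. w u x z / wp u x * (a ^ length (picked p) * (1 / dd)))"
      using 2 True K_nonneg by (intro sum_mono mult_left_mono) auto
    also have "\<dots> \<le> 1 * (a ^ length (picked p) * (1 / dd))"
      unfolding sum_distrib_right[symmetric] using sum_K a_pos dd by (intro mult_right_mono) auto
    finally show ?thesis by simp
  next
    case False
    \<comment> \<open>The vertex that the last free step must reach: the source of the prescribed
      dart after it, or the end \<open>y\<close> if there is none. The branch for
      \<open>None\<close> is a filler.\<close>
    define t where "t = (case p of [] \<Rightarrow> y | None # _ \<Rightarrow> y | Some d # _ \<Rightarrow> src d)"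
    have tX: "t \<in> X"
      using 2 False dart_X by (cases p rule: picked.cases) (auto simp: t_def)
    have z0: "walk_sum D z (mcut u p) y = 0" if "z \<noteq> t" for z
      using that False 2 by (cases p rule: picked.cases)
        (auto simp: t_def mcut_simps walk_sum_single[OF finD] simp del: walk_sum.simps(2))
    have "walk_sum D x (mcut u (None # p)) y = (\<Sum>z\<in>X. w u x z / wp u x * walk_sum D z (mcut u p) y)"
      by (simp add: mcut_simps step_mid del: walk_sum.simps)
    also have "\<dots> = (\<Sum>z\<in>X. if z = t then w u x t / wp u x * walk_sum D t (mcut u p) y else 0)"
      using z0 by (intro sum.cong refl) auto
    also have "\<dots> = w u x t / wp u x * walk_sum D t (mcut u p) y" using tX finX by simp
    also have "\<dots> \<le> (1 / dd) * a ^ length (picked p)"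
      using 2 K_le K_nonneg dd by (intro mult_mono mid_end mcut_walk_nonneg) auto
    finally show ?thesis by (simp add: mult.commute)
  qed
next
  case (3 d p)
  then have d: "d \<in> D" by simp
  have "walk_sum D x (mcut u (Some d # p)) y = (if src d = x then mid u d * walk_sum D (dst d) (mcut u p) y else 0)"
    by (simp add: mcut_simps walk_sum_single[OF finD d] del: walk_sum.simps)
  also have "\<dots> \<le> a * (a ^ length (picked p) * (1 / dd))"
  proof -
    have "mid u d * walk_sum D (dst d) (mcut u p) y \<le> a * (a ^ length (picked p) * (1 / dd))"
      using 3 mid_le[OF d] a_pos by (intro mult_mono mcut_walk_nonneg) auto
    moreover have "0 \<le> a * (a ^ length (picked p) * (1 / dd))" using a_pos dd by simp
    ultimately show ?thesis by simp
  qed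
  finally show ?case by simp
qed simp

text \<open>The link degrees \<open>wp u\<close> are a reversible measure for the walk in the link
  of \<open>u\<close>, so free steps preserve them. The induction runs from the right because the
  bound concerns the end of the walk.\<close>

lemma mid_stationary:
  "set (picked p) \<subseteq> D \<Longrightarrow> y \<in> X \<Longrightarrow>
    (\<Sum>x\<in>X. wp u x * walk_sum D x (mcut u p) y) \<le> wp u y * a ^ length (picked p)"
proof (induction p arbitrary: y rule: rev_induct)
  case Nil
  have "(\<Sum>x\<in>X. wp u x * walk_sum D x (mcut u []) y) = (\<Sum>x\<in>X. if x = y then wp u y else 0)"
    by (intro sum.cong) (auto simp: mcut_simps)
  then show ?case using Nil finX by simp
next
  case (snoc c p)
  have D: "set (picked p) \<subseteq> D" using snoc.prems by (simp add: picked_append)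
  have "(\<Sum>x\<in>X. wp u x * walk_sum D x (mcut u (p @ [c])) y) =
      (\<Sum>x\<in>X. \<Sum>z\<in>X. wp u x * walk_sum D x (mcut u p) z * walk_sum D z (mcut u [c]) y)"
    by (intro sum.cong refl) (simp add: mcut_append append_X sum_distrib_left mult.assoc del: walk_sum.simps)
  also have "\<dots> = (\<Sum>z\<in>X. (\<Sum>x\<in>X. wp u x * walk_sum D x (mcut u p) z) * walk_sum D z (mcut u [c]) y)"
    by (subst sum.swap) (simp add: sum_distrib_right)
  also have "\<dots> \<le> (\<Sum>z\<in>X. (wp u z * a ^ length (picked p)) * walk_sum D z (mcut u [c]) y)"
    using snoc.IH[OF D] by (intro sum_mono mult_right_mono mcut_walk_nonneg) auto
  also have "\<dots> = a ^ length (picked p) * (\<Sum>z\<in>X. wp u z * walk_sum D z (mcut u [c]) y)"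
    by (simp add: sum_distrib_left mult_ac)
  also have "(\<Sum>z\<in>X. wp u z * walk_sum D z (mcut u [c]) y) \<le> wp u y * a ^ length (picked [c])"
  proof (cases c)
    case None
    have "wp u z * walk_sum D z (mcut u [c]) y = w u z y" for z
    proof -
      have "walk_sum D z (mcut u [c]) y = (\<Sum>x\<in>X. w u z x / wp u z * walk_sum D x [] y)"
        by (simp add: None mcut_simps step_mid del: walk_sum.simps)
      also have "\<dots> = (\<Sum>x\<in>X. if x = y then w u z y / wp u z else 0)" by (intro sum.cong) auto
      also have "\<dots> = w u z y / wp u z" using snoc.prems finX by simp
      finally show ?thesis using wp_K by simp
    qed
    then show ?thesis using sum_w[of u y] w_swap[of u y] by (simp add: None)
  next
    case (Some d)
    then have d: "d \<in> D" using snoc.prems by (simp add: picked_append)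
    have "(\<Sum>z\<in>X. wp u z * walk_sum D z (mcut u [c]) y) = (\<Sum>z\<in>X. if z = src d then wp u (src d) * (mid u d * (if dst d = y then 1 else 0)) else 0)"
      by (intro sum.cong refl) (auto simp: Some mcut_simps walk_sum_single[OF finD d] simp del: walk_sum.simps(2))
    also have "\<dots> = wp u (src d) * (mid u d * (if dst d = y then 1 else 0))" using finX dart_X[OF d] by simp
    also have "\<dots> \<le> wp u y * a"
    proof (cases "dst d = y")
      case True
      have "wp u (src d) * mid u d = w u (src d) y / cod (src d) y"
        using True by (simp only: wp_mid)
      also have "\<dots> \<le> (wp u y / dd) / m"
        using w_spread2[of u "src d" y] dd m cod_ge[OF dart_act[OF d]] True w_nonneg
        by (intro frac_le) (auto simp: field_simps wp_nonneg)
      finally show ?thesis using True by (simp add: a_def)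
    qed (use wp_nonneg a_pos in auto)
    finally show ?thesis by (simp add: Some)
  qed
  finally show ?case using a_pos by (simp add: picked_append power_add mult_ac)
qed

lemma mid_first:
  "set (picked p) \<subseteq> D \<Longrightarrow> picked p \<noteq> [] \<Longrightarrow>
    (\<Sum>x\<in>X. wp u x * (\<Sum>z\<in>X. walk_sum D x (mcut u p) z))
      \<le> w u (src (hd (picked p))) (dst (hd (picked p))) / cod (src (hd (picked p))) (dst (hd (picked p))) * a ^ (length (picked p) - 1)"
proof (induction p rule: picked.induct)
  case (2 p)
  have "(\<Sum>x\<in>X. wp u x * (\<Sum>z\<in>X. walk_sum D x (mcut u (None # p)) z)) =
     (\<Sum>x\<in>X. \<Sum>y\<in>X. wp u x * (w u x y / wp u x) * (\<Sum>z\<in>X. walk_sum D y (mcut u p) z))"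
  proof (rule sum.cong[OF refl])
    fix x
    have "(\<Sum>z\<in>X. walk_sum D x (mcut u (None # p)) z) = (\<Sum>y\<in>X. w u x y / wp u x * (\<Sum>z\<in>X. walk_sum D y (mcut u p) z))"
      by (simp add: mcut_simps step_mid sum_distrib_left del: walk_sum.simps) (rule sum.swap)
    then show "wp u x * (\<Sum>z\<in>X. walk_sum D x (mcut u (None # p)) z) =
      (\<Sum>y\<in>X. wp u x * (w u x y / wp u x) * (\<Sum>z\<in>X. walk_sum D y (mcut u p) z))"
      by (simp only: sum_distrib_left mult.assoc)
  qed
  also have "\<dots> = (\<Sum>x\<in>X. \<Sum>y\<in>X. w u y x * (\<Sum>z\<in>X. walk_sum D y (mcut u p) z))"
  proof -
    have "wp u x * (w u x y / wp u x) = w u y x" for x y using wp_K[of u x y] w_swap[of u x y] by (rule trans)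
    then show ?thesis by (simp only:)
  qed
  also have "\<dots> = (\<Sum>y\<in>X. (\<Sum>x\<in>X. w u y x) * (\<Sum>z\<in>X. walk_sum D y (mcut u p) z))"
    by (subst sum.swap) (simp only: sum_distrib_right)
  also have "\<dots> = (\<Sum>y\<in>X. wp u y * (\<Sum>z\<in>X. walk_sum D y (mcut u p) z))" by (simp only: sum_w)
  finally show ?case using 2 by simp
next
  case (3 d p)
  then have d: "d \<in> D" by simp
  have "(\<Sum>x\<in>X. wp u x * (\<Sum>z\<in>X. walk_sum D x (mcut u (Some d # p)) z)) =
     (\<Sum>x\<in>X. if x = src d then wp u (src d) * mid u d * (\<Sum>z\<in>X. walk_sum D (dst d) (mcut u p) z) else 0)"
    by (intro sum.cong refl)
      (auto simp: mcut_simps walk_sum_single[OF finD d] sum_distrib_left mult.assoc simp del: walk_sum.simps)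
  also have "\<dots> = wp u (src d) * mid u d * (\<Sum>z\<in>X. walk_sum D (dst d) (mcut u p) z)"
    using finX dart_X[OF d] by simp
  also have "wp u (src d) * mid u d = w u (src d) (dst d) / cod (src d) (dst d)"
    by (rule wp_mid)
  also have "\<dots> * (\<Sum>z\<in>X. walk_sum D (dst d) (mcut u p) z) \<le> \<dots> * a ^ length (picked p)"
    using 3 w_nonneg by (intro mult_left_mono mid_total) (auto simp: cod_def)
  finally show ?case by simp
qed simp

definition \<kappa> where "\<kappa> n u = first u # replicate (n - 2) (mid u) @ [last_step]"

lemma length_\<kappa>: "3 \<le> n \<Longrightarrow> length (\<kappa> n u) = n" by (simp add: \<kappa>_def)

lemma \<kappa>_nonneg: "c \<in> set (\<kappa> n u) \<Longrightarrow> 0 \<le> c d"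
  unfolding \<kappa>_def using mid_nonneg[of u d] wp_nonneg[of u "dst d"]
  by (auto simp: first_def last_step_def cod_def split: if_splits)

lemma first_le: "d \<in> D \<Longrightarrow> first (src d) d \<le> 1 \<and> 0 \<le> first (src d) d"
  using cod_pos[OF dart_act] wp_le_cod[of "src d" "dst d"] wp_nonneg by (fastforce simp: first_def)

text \<open>The middle steps and the return have total weight 1 from any vertex of positive link
  degree, and middle steps lead only to such vertices. What remains is the mass wp u x of the first
  step.\<close>

lemma total_mass:
  assumes n: "3 \<le> n"
  shows "(\<Sum>u\<in>X. walk_sum D u (\<kappa> n u) u) = 6 * real (card E1)"
proof -
  have K1: "(\<Sum>y\<in>X. w u x y / wp u x) = 1" if "wp u x \<noteq> 0" for u x
    using that by (simp add: sum_divide_distrib[symmetric] sum_w)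
  have mids: "wp u x \<noteq> 0 \<Longrightarrow> u \<in> X \<Longrightarrow> walk_sum D x (replicate k (mid u) @ [last_step]) u = 1" for u x k
  proof (induction k arbitrary: x)
    case 0
    then show ?case using step_last[of u x] wp_act[of u x] act_sym by auto
  next
    case (Suc k)
    have "walk_sum D x (replicate (Suc k) (mid u) @ [last_step]) u =
      (\<Sum>z\<in>X. w u x z / wp u x * walk_sum D z (replicate k (mid u) @ [last_step]) u)"
      by (simp add: step_mid del: walk_sum.simps)
    also have "\<dots> = (\<Sum>z\<in>X. w u x z / wp u x)"
    proof (rule sum.cong[OF refl])
      fix z
      show "w u x z / wp u x * walk_sum D z (replicate k (mid u) @ [last_step]) u = w u x z / wp u x"
      proof (cases "w u x z = 0")
        case False
        then have "wp u z \<noteq> 0" using w_zero[of u z x] w_swap[of u x z] by auto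
        then show ?thesis using Suc by simp
      qed simp
    qed
    also have "\<dots> = 1" using K1 Suc.prems by simp
    finally show ?case .
  qed
  have "(\<Sum>u\<in>X. walk_sum D u (\<kappa> n u) u) = (\<Sum>u\<in>X. \<Sum>x\<in>X. wp u x)"
  proof (rule sum.cong[OF refl])
    fix u assume u: "u \<in> X"
    have "walk_sum D u (\<kappa> n u) u = (\<Sum>x\<in>X. wp u x * walk_sum D x (replicate (n - 2) (mid u) @ [last_step]) u)"
      by (simp add: \<kappa>_def step_first del: walk_sum.simps)
    also have "\<dots> = (\<Sum>x\<in>X. wp u x)"
    proof (rule sum.cong[OF refl])
      fix x
      show "wp u x * walk_sum D x (replicate (n - 2) (mid u) @ [last_step]) u = wp u x"
        using mids[of u x "n - 2"] u by (cases "wp u x = 0") auto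
    qed
    finally show "walk_sum D u (\<kappa> n u) u = (\<Sum>x\<in>X. wp u x)" .
  qed
  then show ?thesis by (simp add: total_wp)
qed

end

section \<open>Bad patterns in wheels\<close>

context wheel
begin

definition C where "C q = (case q of None \<Rightarrow> UNIV | Some d \<Rightarrow> {d})"
definition L where "L q u z = walk_sum D z [cut last_step (C q)] u"

lemma L_None: "u \<in> X \<Longrightarrow> 0 \<le> L None u z \<and> L None u z \<le> 1"
  by (simp add: L_def C_def cut_UNIV step_last del: walk_sum.simps)

lemma L_Some: "d \<in> D \<Longrightarrow> L (Some d) u z = (if src d = z \<and> dst d = u then 1 / cod z u else 0)"
  by (simp add: L_def C_def walk_sum_single[OF finD] del: walk_sum.simps(2)) (simp add: last_step_def)

lemma pattern_split:
  assumes n: "3 \<le> n" and len: "length P = n"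
  obtains c p cl where "P = c # p @ [cl]" "length p = n - 2"
    "\<And>u. map2 cut (\<kappa> n u) (pat P) = cut (first u) (C c) # mcut u p @ [cut last_step (C cl)]"
proof -
  obtain c P' where P': "P = c # P'" using n len by (cases P) auto
  have "P' \<noteq> []" using P' n len by auto
  then obtain p cl where p: "P' = p @ [cl]" by (metis rev_exhaust)
  have lp: "length p = n - 2" using P' p n len by simp
  have "map2 cut (\<kappa> n u) (pat P) = cut (first u) (C c) # mcut u p @ [cut last_step (C cl)]" for u
    unfolding \<kappa>_def P' p pat_def mcut_def using lp by (simp add: C_def)
  then show ?thesis using that P' p lp by blast
qed

text \<open>One prescribed dart comes for free, because it fixes the hub or is summed against it;
  each further one costs \<open>a\<close>. The cases are whether the first and the last dart of the
  walk are prescribed. The factor \<open>dd\<close> is lost only when all n darts are prescribed,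
  since then no random step is left that has to hit a given vertex.\<close>

lemma pattern_mass:
  assumes n: "3 \<le> n" and P: "P \<in> patterns D n (j, \<sigma>)" and j: "1 \<le> j"
  shows "bad_mass D X (\<kappa> n) (pat P) \<le> (if j = n then dd else 1) * a ^ (j - 1)"
proof -
  have len: "length P = n" "length (picked P) = j" "set (picked P) \<subseteq> D"
    using P by (auto simp: patterns_def)
  obtain c p cl where P_eq: "P = c # p @ [cl]" and lp: "length p = n - 2"
    and cuts: "\<And>u. map2 cut (\<kappa> n u) (pat P) = cut (first u) (C c) # mcut u p @ [cut last_step (C cl)]"
    using pattern_split[OF n len(1)] by metis
  let ?k = "length (picked p)"
  have Dp: "set (picked p) \<subseteq> D" using len(3) by (auto simp: P_eq set_picked)
  have pj: "length (picked P) = length (picked [c]) + ?k + length (picked [cl])"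
    using picked_append[of "[c]" "p @ [cl]"] picked_append[of p "[cl]"] by (simp add: P_eq)
  have dd1: "1 \<le> (if j = n then dd else 1)" using dd by simp
  have fin: "a ^ (j - 1) \<le> (if j = n then dd else 1) * a ^ (j - 1)"
    using dd1 a_pos mult_right_mono[of 1 "if j = n then dd else 1" "a ^ (j - 1)"] by simp
  have bm: "bad_mass D X (\<kappa> n) (pat P) = (\<Sum>u\<in>X. walk_sum D u (cut (first u) (C c) # (mcut u p @ [cut last_step (C cl)])) u)"
    by (simp only: bad_mass_def cuts)
  have W: "walk_sum D y (mcut u p @ [cut last_step (C cl)]) u = (\<Sum>z\<in>X. walk_sum D y (mcut u p) z * L cl u z)"
    if "y \<in> X" for y u using append_X[OF that] by (simp add: L_def del: walk_sum.simps)
  have DS: "d \<in> D" if "c = Some d \<or> cl = Some d" for d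
    using that len(3) by (auto simp: P_eq set_picked)
  show ?thesis
  proof (cases c)
    case (Some d0)
    have d0: "d0 \<in> D" using DS Some by auto
    have X0: "src d0 \<in> X" "dst d0 \<in> X" using dart_X[OF d0] by auto
    let ?u = "src d0"
    have "bad_mass D X (\<kappa> n) (pat P) = (\<Sum>u\<in>X. if u = ?u then first ?u d0 * walk_sum D (dst d0) (mcut ?u p @ [cut last_step (C cl)]) ?u else 0)"
      unfolding bm by (intro sum.cong refl) (auto simp: Some C_def walk_sum_single[OF finD d0] simp del: walk_sum.simps)
    also have "\<dots> = first ?u d0 * (\<Sum>z\<in>X. walk_sum D (dst d0) (mcut ?u p) z * L cl ?u z)"
      using finX X0 by (simp add: W)
    also have "\<dots> \<le> 1 * (\<Sum>z\<in>X. walk_sum D (dst d0) (mcut ?u p) z * L cl ?u z)"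
    proof (rule mult_right_mono)
      show "0 \<le> (\<Sum>z\<in>X. walk_sum D (dst d0) (mcut ?u p) z * L cl ?u z)"
        using L_None[OF X0(1)] L_Some DS
        by (intro sum_nonneg mult_nonneg_nonneg mcut_walk_nonneg) (cases cl; auto simp: cod_def)
    qed (use first_le[OF d0] in simp)
    also have "\<dots> \<le> (if j = n then dd else 1) * a ^ (j - 1)"
    proof (cases cl)
      case None
      have "(\<Sum>z\<in>X. walk_sum D (dst d0) (mcut ?u p) z * L cl ?u z) \<le> (\<Sum>z\<in>X. walk_sum D (dst d0) (mcut ?u p) z * 1)"
        using L_None[OF X0(1)] by (intro sum_mono mult_left_mono mcut_walk_nonneg) (auto simp: None)
      also have "\<dots> \<le> a ^ ?k" using mid_total[OF Dp] by simp
      also have "?k = j - 1" using pj len Some None by simp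
      finally show ?thesis using fin by simp
    next
      case (Some dl)
      have dl: "dl \<in> D" using DS Some by auto
      have jk: "j = ?k + 2" using pj len \<open>c = Some d0\<close> Some by simp
      have "(\<Sum>z\<in>X. walk_sum D (dst d0) (mcut ?u p) z * L cl ?u z) \<le>
          (\<Sum>z\<in>X. if z = src dl then walk_sum D (dst d0) (mcut ?u p) (src dl) * (1 / m) else 0)"
      proof (rule sum_mono)
        fix z
        have "1 / cod (src dl) (dst dl) \<le> 1 / m"
          using cod_ge[OF dart_act[OF dl]] m by (intro divide_left_mono mult_pos_pos) auto
        then have "walk_sum D (dst d0) (mcut ?u p) (src dl) * (1 / cod (src dl) (dst dl)) \<le>
            walk_sum D (dst d0) (mcut ?u p) (src dl) * (1 / m)"
          by (rule mult_left_mono) (rule mcut_walk_nonneg)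
        moreover have "0 \<le> walk_sum D (dst d0) (mcut ?u p) (src dl) * (1 / m)"
          using mcut_walk_nonneg[of "dst d0" ?u p "src dl"] m by simp
        ultimately show "walk_sum D (dst d0) (mcut ?u p) z * L cl ?u z \<le>
          (if z = src dl then walk_sum D (dst d0) (mcut ?u p) (src dl) * (1 / m) else 0)"
          by (auto simp: Some L_Some[OF dl])
      qed
      also have "\<dots> = walk_sum D (dst d0) (mcut ?u p) (src dl) * (1 / m)" using finX dart_X[OF dl] by simp
      also have "\<dots> \<le> (if j = n then dd else 1) * a ^ (j - 1)"
      \<comment> \<open>The last dart pays only 1 / m, for its edge. The missing 1 / dd is supplied
        by a free middle step, if there is one.\<close>
      proof (cases "None \<in> set p")
        case True
        have "walk_sum D (dst d0) (mcut ?u p) (src dl) * (1 / m) \<le> a ^ ?k * (1 / dd) * (1 / m)"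
          using mid_end_gap[OF Dp True] dart_X[OF dl] m by (intro mult_right_mono) auto
        also have "\<dots> = a ^ (j - 1)" by (simp add: jk a_def)
        finally show ?thesis using fin by simp
      next
        case False
        have "?k = length p" using picked_length_eq[OF False] by (metis length_map)
        then have jn: "j = n" using jk lp n by simp
        have "walk_sum D (dst d0) (mcut ?u p) (src dl) * (1 / m) \<le> a ^ ?k * (1 / m)"
          using mid_end[OF Dp] dart_X[OF dl] m by (intro mult_right_mono) auto
        also have "\<dots> = dd * a ^ (j - 1)" using dd by (simp add: jk a_def)
        finally show ?thesis using jn by simp
      qed
      finally show ?thesis by simp
    qed
    finally show ?thesis .
  next
    case None
    have "bad_mass D X (\<kappa> n) (pat P) = (\<Sum>u\<in>X. \<Sum>z\<in>X. (\<Sum>y\<in>X. wp u y * walk_sum D y (mcut u p) z) * L cl u z)"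
      unfolding bm
    proof (rule sum.cong[OF refl])
      fix u
      have "walk_sum D u (cut (first u) (C c) # (mcut u p @ [cut last_step (C cl)])) u
         = (\<Sum>y\<in>X. \<Sum>z\<in>X. wp u y * walk_sum D y (mcut u p) z * L cl u z)"
        unfolding None C_def by (simp add: cut_UNIV step_first W[unfolded C_def] sum_distrib_left mult.assoc del: walk_sum.simps)
      then show "walk_sum D u (cut (first u) (C c) # (mcut u p @ [cut last_step (C cl)])) u
         = (\<Sum>z\<in>X. (\<Sum>y\<in>X. wp u y * walk_sum D y (mcut u p) z) * L cl u z)"
        by (simp only: sum_distrib_right) (rule sum.swap)
    qed
    also have "\<dots> \<le> a ^ (j - 1)"
    \<comment> \<open>If the last dart is prescribed, stationarity leaves the factor wp / cod \<le>
      1 for its pair. Otherwise the same factor arises for the first prescribed dart by summing over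
      all hubs.\<close>
    proof (cases cl)
      case (Some dl)
      have dl: "dl \<in> D" using DS Some by auto
      have Xl: "src dl \<in> X" "dst dl \<in> X" using dart_X[OF dl] by auto
      let ?S = "\<Sum>y\<in>X. wp (dst dl) y * walk_sum D y (mcut (dst dl) p) (src dl)"
      have "(\<Sum>u\<in>X. \<Sum>z\<in>X. (\<Sum>y\<in>X. wp u y * walk_sum D y (mcut u p) z) * L cl u z)
         = (\<Sum>u\<in>X. \<Sum>z\<in>X. if z = src dl then (if u = dst dl then ?S / cod (src dl) (dst dl) else 0) else 0)"
        by (intro sum.cong refl) (auto simp: Some L_Some[OF dl])
      also have "\<dots> = ?S / cod (src dl) (dst dl)" using finX Xl by simp
      also have "\<dots> \<le> (wp (dst dl) (src dl) * a ^ ?k) / cod (src dl) (dst dl)"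
        using mid_stationary[OF Dp Xl(1)] by (intro divide_right_mono) (auto simp: cod_def)
      also have "\<dots> = (wp (src dl) (dst dl) / cod (src dl) (dst dl)) * a ^ ?k" by (simp add: wp_sym)
      also have "\<dots> \<le> 1 * a ^ ?k"
        using wp_le_cod[of "src dl" "dst dl"] cod_pos[OF dart_act[OF dl]] a_pos by (intro mult_right_mono) auto
      also have "?k = j - 1" using pj len \<open>c = None\<close> Some by simp
      finally show ?thesis by simp
    next
      case None
      have kj: "?k = j" using pj len \<open>c = None\<close> None by simp
      then have ne: "picked p \<noteq> []" using j by auto
      let ?d = "hd (picked p)"
      have d: "?d \<in> D" using Dp ne by auto
      have "(\<Sum>u\<in>X. \<Sum>z\<in>X. (\<Sum>y\<in>X. wp u y * walk_sum D y (mcut u p) z) * L cl u z)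
          \<le> (\<Sum>u\<in>X. \<Sum>z\<in>X. (\<Sum>y\<in>X. wp u y * walk_sum D y (mcut u p) z) * 1)"
        using L_None by (intro sum_mono mult_left_mono sum_nonneg mult_nonneg_nonneg wp_nonneg mcut_walk_nonneg) (auto simp: None)
      also have "\<dots> = (\<Sum>u\<in>X. \<Sum>y\<in>X. wp u y * (\<Sum>z\<in>X. walk_sum D y (mcut u p) z))"
        by (rule sum.cong[OF refl]) (simp only: sum_distrib_left mult_1_right, rule sum.swap)
      also have "\<dots> \<le> (\<Sum>u\<in>X. w u (src ?d) (dst ?d) / cod (src ?d) (dst ?d) * a ^ (?k - 1))"
        by (intro sum_mono mid_first[OF Dp ne])
      also have "\<dots> = (\<Sum>u\<in>X. w (src ?d) (dst ?d) u) / cod (src ?d) (dst ?d) * a ^ (?k - 1)"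
      proof -
        have e: "w u (src ?d) (dst ?d) = w (src ?d) (dst ?d) u" for u
          using w_rot[of u "src ?d" "dst ?d"] w_swap[of "src ?d" u "dst ?d"] by (rule trans)
        show ?thesis by (simp only: e sum_distrib_right sum_divide_distrib)
      qed
      also have "\<dots> \<le> 1 * a ^ (?k - 1)"
        unfolding sum_w using wp_le_cod[of "src ?d" "dst ?d"] cod_pos[OF dart_act[OF d]] a_pos by (intro mult_right_mono) auto
      finally show ?thesis by (simp add: kj)
    qed
    finally show ?thesis using fin by simp
  qed
qed

text \<open>The middle steps stay in the link of the hub and never visit the hub itself, so i = 0
  contributes nothing. For i > 0 the walk returns to a link vertex by free steps, the last of which
  must hit it and does so with probability at most 1 / dd.\<close>

lemma vertex_mass:
  assumes n: "3 \<le> n" and ij: "i < j" "j < n"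
  shows "(\<Sum>z\<in>X. bad_mass D X (\<kappa> n) (vpat n (i, j, z))) \<le> 6 * real (card E1) / dd"
proof -
  have len: "length (\<kappa> n u) = n" for u using n by (rule length_\<kappa>)
  have vp: "bad_mass D X (\<kappa> n) (vpat n (i, j, z)) =
    (\<Sum>u\<in>X. walk_sum D u (take i (\<kappa> n u)) z * walk_sum D z (take (j - i) (drop i (\<kappa> n u))) z * walk_sum D z (drop j (\<kappa> n u)) u)"
    if z: "z \<in> X" for z
    unfolding bad_mass_def
  proof (rule sum.cong[OF refl])
    fix u assume u: "u \<in> X"
    show "walk_sum D u (map2 cut (\<kappa> n u) (vpat n (i, j, z))) u =
      walk_sum D u (take i (\<kappa> n u)) z * walk_sum D z (take (j - i) (drop i (\<kappa> n u))) z * walk_sum D z (drop j (\<kappa> n u)) u"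
      using walk_sum_vpat[OF finD finX _ u z ij(1), of "\<kappa> n u" u] dart_X ij(2) by (simp add: len del: walk_sum.simps)
  qed
  show ?thesis
  proof (cases "i = 0")
    case True
    have avoid: "walk_sum D x (replicate k (mid u)) u = 0" if "x \<noteq> u" for u x k
      using that
    proof (induction k arbitrary: x)
      case (Suc k)
      have "walk_sum D x (replicate (Suc k) (mid u)) u = (\<Sum>z\<in>X. w u x z / wp u x * walk_sum D z (replicate k (mid u)) u)"
        by (simp add: step_mid del: walk_sum.simps)
      also have "\<dots> = 0"
      proof (rule sum.neutral, rule ballI)
        fix z
        show "w u x z / wp u x * walk_sum D z (replicate k (mid u)) u = 0"
          using Suc.IH[of z] by (cases "z = u") (auto simp: w_def)
      qed
      finally show ?case .
    qed simp
    have "walk_sum D z (take j (\<kappa> n z)) z = 0" for z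
    proof -
      have t: "take j (\<kappa> n z) = first z # replicate (j - 1) (mid z)"
        using ij n by (cases j) (auto simp: \<kappa>_def)
      have "walk_sum D z (take j (\<kappa> n z)) z = (\<Sum>x\<in>X. wp z x * walk_sum D x (replicate (j - 1) (mid z)) z)"
        by (simp only: t step_first)
      also have "\<dots> = 0"
      proof (rule sum.neutral, rule ballI)
        fix x show "wp z x * walk_sum D x (replicate (j - 1) (mid z)) z = 0"
          using avoid[of x z "j - 1"] by (cases "x = z") (auto simp: wp_def)
      qed
      finally show ?thesis .
    qed
    then have z0: "walk_sum D u (take i (\<kappa> n u)) z * walk_sum D z (take (j - i) (drop i (\<kappa> n u))) z * walk_sum D z (drop j (\<kappa> n u)) u = 0" for u z
      using True by (cases "u = z") auto
    have "bad_mass D X (\<kappa> n) (vpat n (i, j, z)) = 0" if "z \<in> X" for z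
      by (simp only: vp[OF that] z0 sum.neutral_const)
    then have "(\<Sum>z\<in>X. bad_mass D X (\<kappa> n) (vpat n (i, j, z))) = 0" by (rule sum.neutral[OF ballI])
    then show ?thesis using dd by simp
  next
    case False
    have "(\<Sum>z\<in>X. bad_mass D X (\<kappa> n) (vpat n (i, j, z))) \<le> (\<Sum>z\<in>X. \<Sum>u\<in>X. wp u z * (1 / dd))"
    proof (rule sum_mono)
      fix z assume z: "z \<in> X"
      show "bad_mass D X (\<kappa> n) (vpat n (i, j, z)) \<le> (\<Sum>u\<in>X. wp u z * (1 / dd))"
        unfolding vp[OF z]
      proof (rule sum_mono)
        fix u assume u: "u \<in> X"
        have 1: "walk_sum D u (take i (\<kappa> n u)) z \<le> wp u z"
        proof -
          have t: "take i (\<kappa> n u) = first u # mcut u (replicate (i - 1) None)"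
            using ij n False by (cases i) (auto simp: \<kappa>_def mcut_replicate)
          have "walk_sum D u (take i (\<kappa> n u)) z = (\<Sum>x\<in>X. wp u x * walk_sum D x (mcut u (replicate (i - 1) None)) z)"
            by (simp only: t step_first)
          also have "\<dots> \<le> wp u z * a ^ length (picked (replicate (i - 1) None :: ('v set, 'v) dart option list))"
            using z by (intro mid_stationary) (auto simp: set_picked)
          also have "picked (replicate (i - 1) None :: ('v set, 'v) dart option list) = []" by (auto simp: picked_empty)
          finally show ?thesis by simp
        qed
        have 2: "walk_sum D z (take (j - i) (drop i (\<kappa> n u))) z \<le> 1 / dd"
        proof -
          have t: "take (j - i) (drop i (\<kappa> n u)) = mcut u (replicate (j - i) None)"
            using ij n False by (cases i) (auto simp: \<kappa>_def mcut_replicate min_def)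
          have "walk_sum D z (mcut u (replicate (j - i) None)) z \<le> a ^ length (picked (replicate (j - i) None :: ('v set, 'v) dart option list)) * (1 / dd)"
            using z ij by (intro mid_end_gap) (auto simp: set_picked)
          moreover have "picked (replicate (j - i) None :: ('v set, 'v) dart option list) = []" by (auto simp: picked_empty)
          ultimately show ?thesis unfolding t by simp
        qed
        have 3: "walk_sum D z (drop j (\<kappa> n u)) u \<le> 1"
        proof -
          have t: "drop j (\<kappa> n u) = mcut u (replicate (n - 1 - j) None) @ [last_step]"
            using ij n False by (cases j) (auto simp: \<kappa>_def mcut_replicate)
          have "walk_sum D z (drop j (\<kappa> n u)) u = (\<Sum>x\<in>X. walk_sum D z (mcut u (replicate (n - 1 - j) None)) x * walk_sum D x [last_step] u)"
            by (simp only: t append_X[OF z])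
          also have "\<dots> \<le> (\<Sum>x\<in>X. walk_sum D z (mcut u (replicate (n - 1 - j) None)) x * 1)"
            using step_last[OF u] by (intro sum_mono mult_left_mono mcut_walk_nonneg) (simp del: walk_sum.simps)
          also have "\<dots> \<le> a ^ length (picked (replicate (n - 1 - j) None :: ('v set, 'v) dart option list))"
            using mid_total[of "replicate (n - 1 - j) None" z u] by (simp add: set_picked)
          also have "picked (replicate (n - 1 - j) None :: ('v set, 'v) dart option list) = []" by (auto simp: picked_empty)
          finally show ?thesis by simp
        qed
        have nn: "0 \<le> walk_sum D x cs y" if "set cs \<subseteq> set (\<kappa> n u)" for x cs y
          using that \<kappa>_nonneg by (intro walk_sum_nonneg finD) blast
        have nn3: "0 \<le> walk_sum D u (take i (\<kappa> n u)) z" "0 \<le> walk_sum D z (take (j - i) (drop i (\<kappa> n u))) z" "0 \<le> walk_sum D z (drop j (\<kappa> n u)) u"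
          by (intro nn; meson set_take_subset set_drop_subset order_trans)+
        have "walk_sum D u (take i (\<kappa> n u)) z * walk_sum D z (take (j - i) (drop i (\<kappa> n u))) z * walk_sum D z (drop j (\<kappa> n u)) u
          \<le> wp u z * (1 / dd) * 1"
          using 1 2 3 nn3 wp_nonneg dd by (intro mult_mono) auto
        then show "walk_sum D u (take i (\<kappa> n u)) z * walk_sum D z (take (j - i) (drop i (\<kappa> n u))) z * walk_sum D z (drop j (\<kappa> n u)) u
          \<le> wp u z * (1 / dd)" by simp
      qed
    qed
    also have "\<dots> = (\<Sum>u\<in>X. \<Sum>z\<in>X. wp u z) * (1 / dd)"
      by (subst sum.swap) (simp only: sum_distrib_right)
    finally show ?thesis by (simp add: total_wp)
  qed
qed

lemma darts_per_edge:
  assumes "e \<in> E"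
  shows "card {d\<in>D. edge d = e} \<le> r\<^sup>2"
proof -
  have fe: "finite e" "card e = r" using unif[OF assms] by auto
  have "{d\<in>D. edge d = e} \<subseteq> (\<lambda>(x, y). (e, x, y)) ` (e \<times> e)" by (auto simp: D_def)
  then have "card {d\<in>D. edge d = e} \<le> card ((\<lambda>(x, y). (e, x, y)) ` (e \<times> e))"
    using fe by (intro card_mono) auto
  also have "\<dots> \<le> card (e \<times> e)" using fe by (intro card_image_le) auto
  finally show ?thesis using fe by (simp add: card_cartesian_product power2_eq_square)
qed

text \<open>The bounds for pattern masses no longer depend on the position of
  \<open>\<sigma>\<close>, so it suffices to count the saturated sets: at most |E| 2^(2 l + 1) S^(j
  - 1) of size j. The total mass is 6 |E1|, hence the ratio \<open>B\<close>. The two conditions on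
  S / (dd m) treat the sizes below 2 l, where j = 2 is the worst, and the size 2 l with its extra
  factor \<open>dd\<close>.\<close>

lemma wheel_good_cycle:
  assumes l: "2 \<le> l" and c0: "c0 = real ((2 * l * r\<^sup>2 + 1) ^ (2 * l))"
    and B: "real (card E) \<le> B * real (card E1)" "1 \<le> B"
    and big: "4 * (real (2 * l))\<^sup>2 * c0 * B \<le> dd"
    and S: "0 \<le> S" "real (2 * l) * c0 * B * 2 ^ (2 * l + 1) * (S / (dd * m)) \<le> 1"
       "real (2 * l) * c0 * B * 2 ^ (2 * l + 1) * ((S / (dd * m)) ^ (2 * l - 1) * dd) \<le> 1"
    and Sat: "\<And>\<sigma>. \<sigma> \<in> Sat \<Longrightarrow> 2 \<le> card \<sigma> \<and> card \<sigma> \<le> 2 * l" "finite Sat"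
    and few: "\<And>e j. e \<in> E \<Longrightarrow> 2 \<le> j \<Longrightarrow> j \<le> 2 * l \<Longrightarrow>
         real (card {\<sigma>\<in>Sat. e \<in> \<sigma> \<and> card \<sigma> = j}) \<le> 2 ^ (2 * l + 1) * S ^ (j - 1)"
  shows "\<exists>A\<in>berge_cycles r (2 * l). A \<subseteq> E \<and> card A = 2 * l \<and> (\<forall>\<sigma>\<in>Sat. \<not> \<sigma> \<subseteq> A)"
proof -
  define n where "n = 2 * l"
  define Sat' where "Sat' = {\<sigma>\<in>Sat. \<sigma> \<subseteq> E}"
  have n4: "4 \<le> n" and n3: "3 \<le> n" using l by (auto simp: n_def)
  have c01: "1 \<le> c0" by (simp add: c0)
  have cardE1: "0 < real (card E1)" using finE1 E1(2) by (simp add: card_gt_0_iff)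
  define T where "T = 6 * real (card E1)"
  have T0: "0 < T" using cardE1 by (simp add: T_def)
  have total: "(\<Sum>x\<in>X. walk_sum D x (\<kappa> n x) x) = T" using total_mass[OF n3] by (simp add: T_def)
  have c0B: "1 \<le> c0 * B" using c01 B(2) mult_mono[of 1 c0 1 B] by simp
  have mass: "(\<Sum>P\<in>patterns D n (j, \<sigma>). bad_mass D X (\<kappa> n) (pat P)) \<le> c0 * ((if j = n then dd else 1) * a ^ (j - 1))"
    if \<sigma>: "\<sigma> \<subseteq> E" "card \<sigma> \<le> n" and j: "1 \<le> j" for \<sigma> j
  proof -
    let ?b = "(if j = n then dd else 1) * a ^ (j - 1)"
    have f\<sigma>: "finite \<sigma>" using \<sigma> finE finite_subset by auto
    have b0: "0 \<le> ?b" using dd a_pos by simp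
    have "(\<Sum>P\<in>patterns D n (j, \<sigma>). bad_mass D X (\<kappa> n) (pat P)) \<le> (\<Sum>P\<in>patterns D n (j, \<sigma>). ?b)"
      using pattern_mass[OF n3 _ j] by (intro sum_mono) auto
    also have "\<dots> = real (card (patterns D n (j, \<sigma>))) * ?b" by simp
    also have "\<dots> \<le> real ((n * r\<^sup>2 + 1) ^ n) * ?b"
      using card_patterns(2)[OF finD _ f\<sigma> \<sigma>(2), of "r\<^sup>2" j] darts_per_edge \<sigma>(1) b0
      by (intro mult_right_mono of_nat_mono) auto
    finally show ?thesis by (simp add: c0 n_def)
  qed
  have "\<exists>A\<in>berge_cycles r n. A \<subseteq> E \<and> card A = n \<and> (\<forall>\<sigma>\<in>Sat'. \<not> \<sigma> \<subseteq> A)"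
  proof (rule good_cycle_exists[OF finD finX _ finE, where \<kappa> = "\<kappa> n" and q = "r\<^sup>2"])
    show "edge d \<in> E \<and> src d \<in> X \<and> src d \<in> edge d \<and> dst d \<in> edge d" if "d \<in> D" for d
      using that dart_X[OF that] by (auto simp: D_def)
    show "0 \<le> c d" if "c \<in> set (\<kappa> n x)" for x c d using that by (rule \<kappa>_nonneg)
    show "length (\<kappa> n x) = n" for x by (rule length_\<kappa>[OF n3])
    show "\<sigma> \<subseteq> E \<and> 2 \<le> card \<sigma> \<and> card \<sigma> \<le> n" if "\<sigma> \<in> Sat'" for \<sigma> using that Sat by (auto simp: Sat'_def n_def)
    show "card {d\<in>D. edge d = e} \<le> r\<^sup>2" if "e \<in> E" for e by (rule darts_per_edge[OF that])
    show "0 < (\<Sum>x\<in>X. walk_sum D x (\<kappa> n x) x)" using T0 total by simp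
    let ?I = "{(i::nat, j, z). i < j \<and> j < n \<and> z \<in> X}" and ?J = "{(i, j). i < j \<and> j < n}"
    show "(\<Sum>t\<in>?I. bad_mass D X (\<kappa> n) (vpat n t)) \<le> (\<Sum>x\<in>X. walk_sum D x (\<kappa> n x) x) / 4"
    proof -
      have J: "?J \<subseteq> {..<n} \<times> {..<n}" by auto
      have cJ: "card ?J \<le> n\<^sup>2" using card_mono[OF _ J] by (simp add: card_cartesian_product power2_eq_square)
      have "(\<Sum>t\<in>?I. bad_mass D X (\<kappa> n) (vpat n t)) = (\<Sum>(s, z)\<in>?J \<times> X. bad_mass D X (\<kappa> n) (vpat n (fst s, snd s, z)))"
        by (rule sum.reindex_bij_witness[of _ "\<lambda>(s, z). (fst s, snd s, z)" "\<lambda>(i, j, z). ((i, j), z)"]) auto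
      also have "\<dots> = (\<Sum>s\<in>?J. \<Sum>z\<in>X. bad_mass D X (\<kappa> n) (vpat n (fst s, snd s, z)))"
        by (simp only: sum.cartesian_product)
      also have "\<dots> \<le> (\<Sum>s\<in>?J. T / dd)"
        using vertex_mass[OF n3] by (intro sum_mono) (auto simp: T_def)
      also have "\<dots> = real (card ?J) * (T / dd)" by simp
      also have "\<dots> \<le> (real n)\<^sup>2 * (T / dd)"
        using cJ T0 dd by (intro mult_right_mono) (auto simp flip: of_nat_power)
      also have "\<dots> \<le> T / 4"
      proof -
        have "4 * (real n)\<^sup>2 * 1 \<le> 4 * (real n)\<^sup>2 * (c0 * B)" using c0B by (intro mult_left_mono) auto
        then have "4 * (real n)\<^sup>2 \<le> dd" using big by (simp add: n_def mult_ac)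
        then have "4 * (real n)\<^sup>2 * T \<le> dd * T" using T0 by (intro mult_right_mono) auto
        then show ?thesis using dd by (simp add: field_simps)
      qed
      finally show ?thesis by (simp add: total)
    qed
    show "(\<Sum>e\<in>E. \<Sum>P\<in>patterns D n (2, {e}). bad_mass D X (\<kappa> n) (pat P)) \<le> (\<Sum>x\<in>X. walk_sum D x (\<kappa> n x) x) / 4"
    proof -
      have "(\<Sum>e\<in>E. \<Sum>P\<in>patterns D n (2, {e}). bad_mass D X (\<kappa> n) (pat P)) \<le> (\<Sum>e\<in>E. c0 * a)"
        using mass[of "{e}" 2 for e] n4 by (intro sum_mono) fastforce
      also have "\<dots> = real (card E) * (c0 * a)" by simp
      also have "\<dots> \<le> (B * real (card E1)) * (c0 * a)" using B c01 a_pos by (intro mult_right_mono) auto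
      also have "\<dots> = (c0 * B) * (1 / (dd * m)) * real (card E1)" by (simp add: a_def)
      also have "\<dots> \<le> 1 * real (card E1)"
      proof (rule mult_right_mono)
        have "1 \<le> (real (2 * l))\<^sup>2" by (rule one_le_power) (use l in simp)
        then have "1 * 1 \<le> (4 * (real (2 * l))\<^sup>2) * m" using m by (intro mult_mono) linarith+
        then have "1 \<le> 4 * (real (2 * l))\<^sup>2 * m" by simp
        then have "(c0 * B) * 1 \<le> (c0 * B) * (4 * (real (2 * l))\<^sup>2 * m)" using c0B by (intro mult_left_mono) auto
        also have "\<dots> = (4 * (real (2 * l))\<^sup>2 * c0 * B) * m" by simp
        also have "\<dots> \<le> dd * m" using big m by (intro mult_right_mono) auto
        finally show "(c0 * B) * (1 / (dd * m)) \<le> 1" using dd m by simp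
      qed simp
      also have "\<dots> \<le> T / 4" by (simp add: T_def)
      finally show ?thesis by (simp add: total)
    qed
    show "(\<Sum>\<sigma>\<in>Sat'. \<Sum>P\<in>patterns D n (card \<sigma>, \<sigma>). bad_mass D X (\<kappa> n) (pat P)) \<le> (\<Sum>x\<in>X. walk_sum D x (\<kappa> n x) x) / 4"
    proof -
      let ?f = "\<lambda>\<sigma>. \<Sum>P\<in>patterns D n (card \<sigma>, \<sigma>). bad_mass D X (\<kappa> n) (pat P)"
      have fS: "finite Sat'" using Sat(2) by (simp add: Sat'_def)
      have "(\<Sum>\<sigma>\<in>Sat'. ?f \<sigma>) = (\<Sum>j\<in>{2..n}. \<Sum>\<sigma>\<in>{\<sigma>\<in>Sat'. card \<sigma> = j}. ?f \<sigma>)"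
        using fS Sat(1) by (intro sum.group[symmetric]) (auto simp: Sat'_def n_def)
      also have "\<dots> \<le> (\<Sum>j\<in>{2..n}. real (card E1) / real n)"
      proof (rule sum_mono)
        fix j assume j: "j \<in> {2..n}"
        let ?Q = "{\<sigma>\<in>Sat'. card \<sigma> = j}" and ?b = "(if j = n then dd else 1) * a ^ (j - 1)"
        have b0: "0 \<le> ?b" using dd a_pos by simp
        have fQ: "finite ?Q" using fS by simp
        have "(\<Sum>\<sigma>\<in>?Q. ?f \<sigma>) \<le> (\<Sum>\<sigma>\<in>?Q. c0 * ?b)"
        proof (rule sum_mono)
          fix \<sigma> assume "\<sigma> \<in> ?Q"
          then show "?f \<sigma> \<le> c0 * ?b" using mass[of \<sigma> j] j by (auto simp: Sat'_def)
        qed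
        also have "\<dots> = real (card ?Q) * (c0 * ?b)" by simp
        also have "real (card ?Q) \<le> real (card E) * (2 ^ (n + 1) * S ^ (j - 1))"
        proof -
          have "real (card ?Q) = (\<Sum>\<sigma>\<in>?Q. 1)" by simp
          also have "\<dots> \<le> (\<Sum>\<sigma>\<in>?Q. \<Sum>e\<in>\<sigma>. 1)"
            using j by (intro sum_mono) auto
          also have "\<dots> = (\<Sum>e\<in>E. real (card {\<sigma>\<in>?Q. e \<in> \<sigma>}) * 1)"
            using fQ by (intro sum_over_members finE) (auto simp: Sat'_def)
          also have "\<dots> \<le> (\<Sum>e\<in>E. 2 ^ (n + 1) * S ^ (j - 1))"
          proof (rule sum_mono)
            fix e assume e: "e \<in> E"
            have "card {\<sigma>\<in>?Q. e \<in> \<sigma>} \<le> card {\<sigma>\<in>Sat. e \<in> \<sigma> \<and> card \<sigma> = j}"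
              using Sat(2) by (intro card_mono) (auto simp: Sat'_def)
            then show "real (card {\<sigma>\<in>?Q. e \<in> \<sigma>}) * 1 \<le> 2 ^ (n + 1) * S ^ (j - 1)"
              using few[OF e, of j] j by (simp add: n_def)
          qed
          finally show ?thesis by simp
        qed
        also have "real (card E) * (2 ^ (n + 1) * S ^ (j - 1)) * (c0 * ?b) \<le>
            (B * real (card E1)) * (2 ^ (n + 1) * S ^ (j - 1)) * (c0 * ?b)"
          using B S c01 b0 by (intro mult_right_mono) auto
        also have "\<dots> = real (card E1) * (c0 * B * 2 ^ (n + 1) * ((S / (dd * m)) ^ (j - 1) * (if j = n then dd else 1)))"
          by (simp add: a_def power_divide power_mult_distrib)
        also have "\<dots> \<le> real (card E1) * (1 / real n)"
        proof (rule mult_left_mono)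
          have s0: "0 \<le> S / (dd * m)" using S dd m by simp
          have n0: "0 < real n" using n4 by simp
          have "real n * (c0 * B * 2 ^ (n + 1) * ((S / (dd * m)) ^ (j - 1) * (if j = n then dd else 1))) \<le> 1"
          proof (cases "j = n")
            case True then show ?thesis using S(3) by (simp add: n_def mult_ac)
          next
            case False
            have k: "0 \<le> real n * (c0 * B * 2 ^ (n + 1))" using c0B n0 by simp
            have "S / (dd * m) \<le> 1"
            proof -
              have "1 \<le> (2::real) ^ (n + 1)" by (rule one_le_power) simp
              then have "1 * 1 * 1 \<le> real n * (c0 * B) * 2 ^ (n + 1)" using n4 c0B by (intro mult_mono) auto
              then have "1 * (S / (dd * m)) \<le> real n * (c0 * B) * 2 ^ (n + 1) * (S / (dd * m))"
                using s0 by (intro mult_right_mono) auto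
              then show ?thesis using S(2) by (simp add: n_def mult_ac)
            qed
            then have "(S / (dd * m)) ^ (j - 1) \<le> (S / (dd * m)) ^ 1"
              using j s0 by (intro power_decreasing) auto
            then have "real n * (c0 * B * 2 ^ (n + 1)) * (S / (dd * m)) ^ (j - 1) \<le> real n * (c0 * B * 2 ^ (n + 1)) * (S / (dd * m))"
              using k by (intro mult_left_mono) auto
            also have "\<dots> \<le> 1" using S(2) by (simp add: n_def mult_ac)
            finally show ?thesis using False by (simp add: mult_ac)
          qed
          then show "c0 * B * 2 ^ (n + 1) * ((S / (dd * m)) ^ (j - 1) * (if j = n then dd else 1)) \<le> 1 / real n"
            using n0 by (simp add: field_simps)
        qed simp
        finally show "(\<Sum>\<sigma>\<in>?Q. ?f \<sigma>) \<le> real (card E1) / real n" using c01 b0 by (simp add: mult_right_mono)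
      qed
      also have "\<dots> = real (n - 1) * (real (card E1) / real n)" using n4 by simp
      also have "\<dots> \<le> real n * (real (card E1) / real n)" by (intro mult_right_mono) auto
      also have "\<dots> \<le> T / 4" using n4 by (simp add: T_def)
      finally show ?thesis by (simp add: total)
    qed
  qed (use n4 unif in auto)
  then show ?thesis unfolding Sat'_def n_def by (metis (mono_tags, lifting) mem_Collect_eq order_trans)
qed

end

section \<open>Supersaturation\<close>

text \<open>As long as some pair inside an edge has codegree at most \<open>D\<close>, all edges
  over it are removed and assigned to it. The pair is then absent from the remaining edges, so it is
  never chosen again.\<close>

lemma peel:
  fixes G :: "'v set set" and D :: real
  assumes "finite G" and D0: "0 \<le> D"
  shows "\<exists>F G' p. G = F \<union> G' \<and> F \<inter> G' = {} \<and> (\<forall>e\<in>F. p e \<subseteq> e \<and> card (p e) = 2) \<and>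
    (\<forall>q. real (card {e\<in>F. p e = q}) \<le> D) \<and>
    (\<forall>e\<in>G'. \<forall>q\<subseteq>e. card q = 2 \<longrightarrow> D < real (card {e'\<in>G'. q \<subseteq> e'}))"
  using assms(1)
proof (induction G rule: finite_psubset_induct)
  case (psubset G)
  show ?case
  proof (cases "\<forall>e\<in>G. \<forall>q\<subseteq>e. card q = 2 \<longrightarrow> D < real (card {e'\<in>G. q \<subseteq> e'})")
    case True
    then show ?thesis using D0 by (intro exI[of _ "{}"] exI[of _ G]) auto
  next
    case False
    then obtain e q where q: "e \<in> G" "q \<subseteq> e" "card q = 2" "real (card {e'\<in>G. q \<subseteq> e'}) \<le> D"
      by (auto simp: not_less)
    define H where "H = {e'\<in>G. q \<subseteq> e'}"
    have "G - H \<subset> G" using q by (auto simp: H_def)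
    from psubset.IH[OF this] obtain F G' p where IH: "G - H = F \<union> G'" "F \<inter> G' = {}"
      "\<forall>e\<in>F. p e \<subseteq> e \<and> card (p e) = 2"
      "\<forall>q. real (card {e\<in>F. p e = q}) \<le> D"
      "\<forall>e\<in>G'. \<forall>q\<subseteq>e. card q = 2 \<longrightarrow> D < real (card {e'\<in>G'. q \<subseteq> e'})" by (elim exE conjE) (rule that)
    define p' where "p' = (\<lambda>e. if e \<in> H then q else p e)"
    have HF: "F \<inter> H = {}" "G' \<inter> H = {}" using IH(1) by auto
    have Fq: "p e \<noteq> q" if "e \<in> F" for e
    proof
      assume "p e = q"
      then have "q \<subseteq> e" using IH(3) that by auto
      then show False using that IH(1) by (auto simp: H_def)
    qed
    have multi: "real (card {e\<in>F \<union> H. p' e = q'}) \<le> D" for q'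
    proof (cases "q' = q")
      case True
      have "{e\<in>F \<union> H. p' e = q'} = H" using True Fq HF by (auto simp: p'_def)
      then show ?thesis using q(4) by (simp add: H_def)
    next
      case False
      have "{e\<in>F \<union> H. p' e = q'} = {e\<in>F. p e = q'}" using False HF by (auto simp: p'_def)
      then show ?thesis using IH(4) by auto
    qed
    show ?thesis
    proof (rule exI[of _ "F \<union> H"], rule exI[of _ G'], rule exI[of _ p'], intro conjI)
      show "G = F \<union> H \<union> G'" using IH(1) by (auto simp: H_def)
      show "(F \<union> H) \<inter> G' = {}" using IH(2) HF by auto
      show "\<forall>e\<in>F \<union> H. p' e \<subseteq> e \<and> card (p' e) = 2" using IH(3) q by (auto simp: p'_def H_def)
    qed (use multi IH(5) in auto)
  qed
qed

text \<open>Removing a vertex of degree below \<open>\<delta>\<close> loses fewer than \<delta>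
  edges and at least one vertex, so the assumed inequality persists and rules out the empty
  graph.\<close>

lemma min_degree_subgraph:
  fixes F :: "'e set" and p :: "'e \<Rightarrow> 'v set" and \<delta> :: real
  assumes "finite F" "\<And>e. e \<in> F \<Longrightarrow> finite (p e)" "0 \<le> \<delta>" "\<delta> * real (card (\<Union> (p ` F))) < real (card F)"
  shows "\<exists>F'\<subseteq>F. F' \<noteq> {} \<and> (\<forall>e\<in>F'. \<forall>x\<in>p e. \<delta> \<le> real (card {e'\<in>F'. x \<in> p e'}))"
  using assms
proof (induction F rule: finite_psubset_induct)
  case (psubset F)
  show ?case
  proof (cases "\<forall>e\<in>F. \<forall>x\<in>p e. \<delta> \<le> real (card {e'\<in>F. x \<in> p e'})")
    case True
    moreover have "F \<noteq> {}" using psubset.prems by auto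
    ultimately show ?thesis by blast
  next
    case False
    then obtain e x where x: "e \<in> F" "x \<in> p e" "real (card {e'\<in>F. x \<in> p e'}) < \<delta>" by (auto simp: not_le)
    define F1 where "F1 = {e'\<in>F. x \<notin> p e'}"
    have sub: "F1 \<subset> F" using x by (auto simp: F1_def)
    have "card F = card F1 + card {e'\<in>F. x \<in> p e'}"
    proof -
      have "F = F1 \<union> {e'\<in>F. x \<in> p e'}" by (auto simp: F1_def)
      then have "card F = card (F1 \<union> {e'\<in>F. x \<in> p e'})" by (rule arg_cong)
      also have "\<dots> = card F1 + card {e'\<in>F. x \<in> p e'}"
        using psubset.hyps by (intro card_Un_disjoint) (auto simp: F1_def)
      finally show ?thesis .
    qed
    then have 1: "real (card F) - \<delta> \<le> real (card F1)" using x by simp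
    have fU: "finite (\<Union> (p ` F))" using psubset by auto
    have "\<Union> (p ` F1) \<subseteq> \<Union> (p ` F) - {x}" by (auto simp: F1_def)
    then have "card (\<Union> (p ` F1)) \<le> card (\<Union> (p ` F) - {x})" using fU by (intro card_mono) auto
    also have "\<dots> = card (\<Union> (p ` F)) - 1" using x by (subst card_Diff_singleton) auto
    finally have "card (\<Union> (p ` F1)) \<le> card (\<Union> (p ` F)) - 1" .
    moreover have "0 < card (\<Union> (p ` F))" using fU x by (auto simp: card_gt_0_iff)
    ultimately have "real (card (\<Union> (p ` F1))) \<le> real (card (\<Union> (p ` F))) - 1" by linarith
    then have "\<delta> * real (card (\<Union> (p ` F1))) \<le> \<delta> * (real (card (\<Union> (p ` F))) - 1)"
      using psubset.prems by (intro mult_left_mono) auto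
    also have "\<dots> < real (card F1)" using psubset.prems(3) 1 by (simp add: algebra_simps)
    finally have small: "\<delta> * real (card (\<Union> (p ` F1))) < real (card F1)" .
    have "\<exists>F'\<subseteq>F1. F' \<noteq> {} \<and> (\<forall>e\<in>F'. \<forall>x\<in>p e. \<delta> \<le> real (card {e'\<in>F'. x \<in> p e'}))"
    proof (rule psubset.IH[OF sub _ psubset.prems(2) small])
      show "finite (p e)" if "e \<in> F1" for e using psubset.prems(1) that by (simp add: F1_def)
    qed
    then obtain F' where F': "F' \<subseteq> F1" "F' \<noteq> {} \<and> (\<forall>e\<in>F'. \<forall>x\<in>p e. \<delta> \<le> real (card {e'\<in>F'. x \<in> p e'}))"
      by (elim exE conjE) (rule that, assumption, intro conjI)
    have "F' \<subseteq> F" using F'(1) sub by (rule subset_trans[OF _ psubset_imp_subset])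
    then show ?thesis using F'(2) by (intro exI[of _ F']) (rule conjI)
  qed
qed

section \<open>Codegrees, cleaning and spread triples\<close>

definition shadow2 :: "'v set set \<Rightarrow> 'v set set" where
  "shadow2 G = {q. card q = 2 \<and> (\<exists>e\<in>G. q \<subseteq> e)}"

lemma finite_shadow2:
  assumes "finite G" "\<And>e. e \<in> G \<Longrightarrow> finite e"
  shows "finite (shadow2 G)"
proof -
  have "shadow2 G \<subseteq> Pow (\<Union> G)" by (auto simp: shadow2_def)
  then show ?thesis using assms finite_subset by (metis finite_Pow_iff finite_Union)
qed

lemma sum_codegrees:
  fixes r :: nat
  assumes G: "finite G" "\<And>e. e \<in> G \<Longrightarrow> finite e \<and> card e = r"
  shows "(\<Sum>q\<in>shadow2 G. real (card {e\<in>G. q \<subseteq> e})) \<le> real (r\<^sup>2) * real (card G)"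
proof -
  have fS: "finite (shadow2 G)" using G by (intro finite_shadow2) auto
  have "(\<Sum>q\<in>shadow2 G. real (card {e\<in>G. q \<subseteq> e})) = (\<Sum>q\<in>shadow2 G. \<Sum>e\<in>G. if q \<subseteq> e then 1 else 0)"
    using G by (intro sum.cong refl) (simp add: sum.If_cases Int_def)
  also have "\<dots> = (\<Sum>e\<in>G. \<Sum>q\<in>shadow2 G. if q \<subseteq> e then 1 else 0)" by (rule sum.swap)
  also have "\<dots> \<le> (\<Sum>e\<in>G. real (r\<^sup>2))"
  proof (rule sum_mono)
    fix e assume e: "e \<in> G"
    have "(\<Sum>q\<in>shadow2 G. if q \<subseteq> e then 1 else (0::real)) = real (card {q\<in>shadow2 G. q \<subseteq> e})"
      using fS by (simp add: sum.If_cases Int_def)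
    also have "{q\<in>shadow2 G. q \<subseteq> e} \<subseteq> (\<lambda>(x, y). {x, y}) ` (e \<times> e)"
      by (auto simp: shadow2_def card_2_iff)
    then have "card {q\<in>shadow2 G. q \<subseteq> e} \<le> card ((\<lambda>(x, y). {x, y}) ` (e \<times> e))"
      using G(2)[OF e] by (intro card_mono) auto
    also have "\<dots> \<le> card (e \<times> e)" using G(2)[OF e] by (intro card_image_le) auto
    also have "\<dots> = r\<^sup>2" using G(2)[OF e] by (simp add: card_cartesian_product power2_eq_square)
    finally show "(\<Sum>q\<in>shadow2 G. if q \<subseteq> e then 1 else (0::real)) \<le> real (r\<^sup>2)" by simp
  qed
  finally show ?thesis by (simp add: mult.commute)
qed

text \<open>Deleting all edges over a deficient pair q loses fewer than cod q edges, but also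
  removes q from the shadow. The number of edges minus the sum of the thresholds therefore does not
  decrease.\<close>

lemma codegree_cleaning:
  fixes G0 :: "'e set" and tr :: "'e \<Rightarrow> 'v set" and cod :: "'v set \<Rightarrow> real"
  assumes "finite G0" "\<And>e. e \<in> G0 \<Longrightarrow> finite (tr e)" "\<And>q. 0 \<le> cod q"
    "s \<le> real (card G0) - (\<Sum>q\<in>shadow2 (tr ` G0). cod q)"
  shows "\<exists>E1\<subseteq>G0. s \<le> real (card E1) \<and>
    (\<forall>e\<in>E1. \<forall>q\<subseteq>tr e. card q = 2 \<longrightarrow> cod q \<le> real (card {e'\<in>E1. q \<subseteq> tr e'}))"
  using assms
proof (induction G0 rule: finite_psubset_induct)
  case (psubset G0)
  show ?case
  proof (cases "\<forall>e\<in>G0. \<forall>q\<subseteq>tr e. card q = 2 \<longrightarrow> cod q \<le> real (card {e'\<in>G0. q \<subseteq> tr e'})")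
    case True
    have "0 \<le> (\<Sum>q\<in>shadow2 (tr ` G0). cod q)" using psubset.prems by (intro sum_nonneg) auto
    then have "s \<le> real (card G0)" using psubset.prems(3) by linarith
    then show ?thesis using True by blast
  next
    case False
    then obtain e q where q: "e \<in> G0" "q \<subseteq> tr e" "card q = 2" "real (card {e'\<in>G0. q \<subseteq> tr e'}) < cod q"
      by (auto simp: not_le)
    define G1 where "G1 = {e'\<in>G0. \<not> q \<subseteq> tr e'}"
    have sub: "G1 \<subset> G0" using q by (auto simp: G1_def)
    have "card G0 = card G1 + card {e'\<in>G0. q \<subseteq> tr e'}"
    proof -
      have "G0 = G1 \<union> {e'\<in>G0. q \<subseteq> tr e'}" by (auto simp: G1_def)
      then have "card G0 = card (G1 \<union> {e'\<in>G0. q \<subseteq> tr e'})" by (rule arg_cong)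
      also have "\<dots> = card G1 + card {e'\<in>G0. q \<subseteq> tr e'}"
        using psubset.hyps by (intro card_Un_disjoint) (auto simp: G1_def)
      finally show ?thesis .
    qed
    then have 1: "real (card G0) - cod q \<le> real (card G1)" using q by simp
    have fS: "finite (shadow2 (tr ` G0))" using psubset by (intro finite_shadow2) auto
    have qS: "q \<in> shadow2 (tr ` G0)" using q by (auto simp: shadow2_def)
    have "(\<Sum>q\<in>shadow2 (tr ` G1). cod q) \<le> (\<Sum>q\<in>shadow2 (tr ` G0) - {q}. cod q)"
      using fS psubset.prems by (intro sum_mono2) (auto simp: shadow2_def G1_def)
    also have "\<dots> = (\<Sum>q\<in>shadow2 (tr ` G0). cod q) - cod q"
      using fS qS by (simp add: sum_diff1)
    finally have small: "s \<le> real (card G1) - (\<Sum>q\<in>shadow2 (tr ` G1). cod q)" using 1 psubset.prems(3) by linarith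
    have "\<exists>E1\<subseteq>G1. s \<le> real (card E1) \<and>
      (\<forall>e\<in>E1. \<forall>q\<subseteq>tr e. card q = 2 \<longrightarrow> cod q \<le> real (card {e'\<in>E1. q \<subseteq> tr e'}))"
    proof (rule psubset.IH[OF sub _ psubset.prems(2) small])
      show "finite (tr e)" if "e \<in> G1" for e using psubset.prems(1) that by (simp add: G1_def)
    qed
    then obtain E1 where E1: "E1 \<subseteq> G1" "s \<le> real (card E1) \<and>
      (\<forall>e\<in>E1. \<forall>q\<subseteq>tr e. card q = 2 \<longrightarrow> cod q \<le> real (card {e'\<in>E1. q \<subseteq> tr e'}))"
      by (elim exE conjE) (rule that, assumption, intro conjI)
    have "E1 \<subseteq> G0" using E1(1) sub by (rule subset_trans[OF _ psubset_imp_subset])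
    then show ?thesis using E1(2) by (intro exI[of _ E1]) (rule conjI)
  qed
qed

text \<open>Call a third vertex a heavy extension of a pair if the resulting triple has codegree above the allowed
  fraction of that of the pair. An edge all of whose extensions of its poorest pair are heavy has its other \<open>r - 2\<close> vertices inside the
  small set of heavy extensions of that pair, so such edges are rare.\<close>

lemma spread_triples:
  fixes G :: "'v set set" and d D :: real and r :: nat
  assumes G: "finite G" "\<And>e. e \<in> G \<Longrightarrow> finite e \<and> card e = r" and r: "3 \<le> r"
    and D: "\<And>e q. e \<in> G \<Longrightarrow> q \<subseteq> e \<Longrightarrow> card q = 2 \<Longrightarrow> D < real (card {e'\<in>G. q \<subseteq> e'})"
    and d: "0 < d" "(real (r - 2) * d) ^ (r - 2) * (2 * real (r\<^sup>2)) \<le> D"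
  shows "\<exists>G0\<subseteq>G. \<exists>tr. real (card G) / 2 \<le> real (card G0) \<and> (\<forall>e\<in>G0. tr e \<subseteq> e \<and> card (tr e) = 3 \<and>
     (\<forall>q\<subseteq>tr e. card q = 2 \<longrightarrow> real (card {e'\<in>G. tr e \<subseteq> e'}) * d \<le> real (card {e'\<in>G. q \<subseteq> e'})))"
proof -
  define cod where "cod q = real (card {e\<in>G. q \<subseteq> e})" for q
  have fG: "finite {e\<in>G. q \<subseteq> e}" for q using G by simp
  define V where "V = \<Union> G"
  have fV: "finite V" using G by (auto simp: V_def)
  have exq: "\<exists>q. q \<subseteq> e \<and> card q = 2 \<and> (\<forall>q'\<subseteq>e. card q' = 2 \<longrightarrow> cod q \<le> cod q')" if e: "e \<in> G" for e
  proof -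
    let ?Q = "{q. q \<subseteq> e \<and> card q = 2}"
    have fQ: "finite ?Q" using G(2)[OF e] by simp
    have neQ: "?Q \<noteq> {}"
      using obtain_subset_with_card_n[of 2 e] G(2)[OF e] r by auto
    obtain q where "q \<in> ?Q" "\<forall>q'\<in>?Q. cod q \<le> cod q'"
      using ex_min_if_finite[of "cod ` ?Q"] fQ neQ by (metis (no_types, lifting) arg_min_if_finite(1) arg_min_least)
    then show ?thesis by blast
  qed
  define mq where "mq e = (SOME q. q \<subseteq> e \<and> card q = 2 \<and> (\<forall>q'\<subseteq>e. card q' = 2 \<longrightarrow> cod q \<le> cod q'))" for e
  have mq: "mq e \<subseteq> e" "card (mq e) = 2" "\<And>q'. q' \<subseteq> e \<Longrightarrow> card q' = 2 \<Longrightarrow> cod (mq e) \<le> cod q'" if "e \<in> G" for e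
    using someI_ex[OF exq[OF that]] unfolding mq_def by blast+
  define good where "good e = (\<exists>z\<in>e - mq e. cod (insert z (mq e)) * d \<le> cod (mq e))" for e
  define G0 where "G0 = {e\<in>G. good e}"
  define Bd where "Bd = {e\<in>G. \<not> good e}"
  define Z where "Z q = {z\<in>V - q. cod q < cod (insert z q) * d}" for q
  have cod_pos: "0 < cod q" if "q \<in> shadow2 G" for q
    using that fG unfolding shadow2_def cod_def by (auto simp: card_gt_0_iff)
  \<comment> \<open>Summed over the third vertex, the codegrees of the triples count each edge over
    q at most r - 2 times, so at most (r - 2) d extensions are heavy.\<close>
  have Zcard: "real (card (Z q)) \<le> real (r - 2) * d" if q: "q \<in> shadow2 G" for q
  proof -
    have fq: "finite q" "card q = 2" using q by (auto simp: shadow2_def intro!: card_ge_0_finite)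
    have fZ: "finite (Z q)" using fV by (simp add: Z_def)
    have "real (card (Z q)) * cod q = (\<Sum>z\<in>Z q. cod q)" by simp
    also have "\<dots> \<le> (\<Sum>z\<in>Z q. cod (insert z q) * d)" by (intro sum_mono) (auto simp: Z_def)
    also have "\<dots> = d * (\<Sum>z\<in>Z q. cod (insert z q))" by (simp add: sum_distrib_left mult.commute)
    also have "\<dots> \<le> d * (real (r - 2) * cod q)"
    proof (rule mult_left_mono)
      have "(\<Sum>z\<in>Z q. cod (insert z q)) = (\<Sum>z\<in>Z q. \<Sum>e\<in>{e\<in>G. q \<subseteq> e}. if z \<in> e then 1 else 0)"
      proof (rule sum.cong[OF refl])
        fix z
        have "{e\<in>G. q \<subseteq> e} \<inter> {e. z \<in> e} = {e\<in>G. insert z q \<subseteq> e}" by auto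
        then show "cod (insert z q) = (\<Sum>e\<in>{e\<in>G. q \<subseteq> e}. if z \<in> e then 1 else 0)"
          using fG[of q] by (simp add: sum.If_cases cod_def)
      qed
      also have "\<dots> = (\<Sum>e\<in>{e\<in>G. q \<subseteq> e}. \<Sum>z\<in>Z q. if z \<in> e then 1 else 0)" by (rule sum.swap)
      also have "\<dots> \<le> (\<Sum>e\<in>{e\<in>G. q \<subseteq> e}. real (r - 2))"
      proof (rule sum_mono)
        fix e assume e: "e \<in> {e\<in>G. q \<subseteq> e}"
        have "(\<Sum>z\<in>Z q. if z \<in> e then 1 else (0::real)) = real (card (Z q \<inter> e))"
          using fZ by (simp add: sum.If_cases)
        also have "card (Z q \<inter> e) \<le> card (e - q)"
          using G e by (intro card_mono) (auto simp: Z_def)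
        also have "card (e - q) = r - 2" using e fq G by (subst card_Diff_subset) auto
        finally show "(\<Sum>z\<in>Z q. if z \<in> e then 1 else (0::real)) \<le> real (r - 2)" by simp
      qed
      finally show "(\<Sum>z\<in>Z q. cod (insert z q)) \<le> real (r - 2) * cod q" by (simp add: cod_def mult.commute)
    qed (use d in simp)
    finally have "real (card (Z q)) * cod q \<le> (real (r - 2) * d) * cod q" by (simp add: mult_ac)
    then show ?thesis using cod_pos[OF q] by simp
  qed
  \<comment> \<open>A bad edge with poorest pair \<open>q\<close> is determined by its other r - 2
    vertices, all in \<open>Z q\<close>. The hypothesis on \<open>d\<close> makes the number of such
    edges at most cod q / (2 r^2); as the codegrees sum to at most r^2 |G|, at most half of all
    edges are bad.\<close>
  have few: "real (card {e\<in>Bd. mq e = q}) * (2 * real (r\<^sup>2)) \<le> cod q" if q: "q \<in> shadow2 G" for q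
  proof -
    have fq: "finite q" "card q = 2" using q by (auto simp: shadow2_def intro!: card_ge_0_finite)
    have fZ: "finite (Z q)" using fV by (simp add: Z_def)
    have "{e\<in>Bd. mq e = q} \<subseteq> (\<lambda>s. s \<union> q) ` {s. s \<subseteq> Z q \<and> card s = r - 2}"
    proof
      fix e assume e: "e \<in> {e\<in>Bd. mq e = q}"
      then have eG: "e \<in> G" and bad: "\<not> good e" and me: "mq e = q" by (auto simp: Bd_def)
      have qe: "q \<subseteq> e" using mq(1)[OF eG] me by simp
      have "e - q \<subseteq> Z q" using bad eG unfolding good_def me by (auto simp: Z_def V_def not_le)
      moreover have "card (e - q) = r - 2" using fq G(2)[OF eG] qe by (subst card_Diff_subset) auto
      moreover have "e = (e - q) \<union> q" using qe by auto
      ultimately show "e \<in> (\<lambda>s. s \<union> q) ` {s. s \<subseteq> Z q \<and> card s = r - 2}" by blast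
    qed
    then have "card {e\<in>Bd. mq e = q} \<le> card ((\<lambda>s. s \<union> q) ` {s. s \<subseteq> Z q \<and> card s = r - 2})"
      using fZ by (intro card_mono) auto
    also have "\<dots> \<le> card {s. s \<subseteq> Z q \<and> card s = r - 2}" using fZ by (intro card_image_le) auto
    also have "\<dots> = card (Z q) choose (r - 2)" using fZ by (rule n_subsets)
    also have "\<dots> \<le> card (Z q) ^ (r - 2)" 
      by (cases "r - 2 \<le> card (Z q)") (auto intro: binomial_le_pow simp: binomial_eq_0)
    finally have "real (card {e\<in>Bd. mq e = q}) \<le> real (card (Z q)) ^ (r - 2)"
      by (simp flip: of_nat_power)
    also have "\<dots> \<le> (real (r - 2) * d) ^ (r - 2)" using Zcard[OF q] by (intro power_mono) auto
    finally have "real (card {e\<in>Bd. mq e = q}) * (2 * real (r\<^sup>2)) \<le> (real (r - 2) * d) ^ (r - 2) * (2 * real (r\<^sup>2))"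
      by (intro mult_right_mono) auto
    also have "\<dots> \<le> D" by (rule d(2))
    also have "\<dots> \<le> cod q" using q D unfolding shadow2_def cod_def by (auto intro: less_imp_le)
    finally show ?thesis .
  qed
  have fS: "finite (shadow2 G)" using G by (intro finite_shadow2) auto
  have fBd: "finite Bd" using G by (simp add: Bd_def)
  have "card Bd = (\<Sum>q\<in>shadow2 G. card {e\<in>Bd. mq e = q})"
  proof -
    have "(\<Sum>e\<in>Bd. 1) = (\<Sum>q\<in>shadow2 G. \<Sum>e\<in>{e\<in>Bd. mq e = q}. 1::nat)"
      using fS fBd mq by (intro sum.group[symmetric]) (auto simp: shadow2_def Bd_def)
    then show ?thesis by simp
  qed
  then have "real (card Bd) * (2 * real (r\<^sup>2)) = (\<Sum>q\<in>shadow2 G. real (card {e\<in>Bd. mq e = q}) * (2 * real (r\<^sup>2)))"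
    by (simp add: sum_distrib_right)
  also have "\<dots> \<le> (\<Sum>q\<in>shadow2 G. cod q)" using few by (intro sum_mono) auto
  also have "\<dots> \<le> real (r\<^sup>2) * real (card G)" unfolding cod_def by (rule sum_codegrees[OF G])
  finally have "real (r\<^sup>2) * (2 * real (card Bd)) \<le> real (r\<^sup>2) * real (card G)" by (simp only: mult_ac)
  then have half: "2 * real (card Bd) \<le> real (card G)" using r by simp
  have "card G = card G0 + card Bd"
  proof -
    have "G = G0 \<union> Bd" by (auto simp: G0_def Bd_def)
    then have "card G = card (G0 \<union> Bd)" by (rule arg_cong)
    also have "\<dots> = card G0 + card Bd" using G by (intro card_Un_disjoint) (auto simp: G0_def Bd_def)
    finally show ?thesis .
  qed
  then have c: "real (card G) / 2 \<le> real (card G0)" using half by simp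
  define tr where "tr e = insert (SOME z. z \<in> e - mq e \<and> cod (insert z (mq e)) * d \<le> cod (mq e)) (mq e)" for e
  have tr: "tr e \<subseteq> e \<and> card (tr e) = 3 \<and> (\<forall>q\<subseteq>tr e. card q = 2 \<longrightarrow> cod (tr e) * d \<le> cod q)" if e: "e \<in> G0" for e
  proof -
    have eG: "e \<in> G" and "good e" using e by (auto simp: G0_def)
    then have "\<exists>z. z \<in> e - mq e \<and> cod (insert z (mq e)) * d \<le> cod (mq e)" by (auto simp: good_def)
    from someI_ex[OF this] obtain z where z: "z \<in> e - mq e" "cod (insert z (mq e)) * d \<le> cod (mq e)" "tr e = insert z (mq e)"
      unfolding tr_def by blast
    have fm: "finite (mq e)" using mq[OF eG] G(2)[OF eG] finite_subset by blast
    have sub: "tr e \<subseteq> e" using z mq[OF eG] by auto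
    \<comment> \<open>All three pairs of the triple lie in \<open>e\<close> and have at least the
      codegree of its poorest pair, so the bound for that pair covers them.\<close>
    have "cod (tr e) * d \<le> cod q" if "q \<subseteq> tr e" "card q = 2" for q
    proof -
      have "q \<subseteq> e" using that(1) sub by (rule subset_trans)
      then have "cod (mq e) \<le> cod q" using mq(3)[OF eG] that(2) by blast
      then show ?thesis using z(2) unfolding z(3) by linarith
    qed
    then show ?thesis using sub z mq[OF eG] fm by simp
  qed
  show ?thesis using c tr unfolding cod_def by (intro exI[of _ G0] exI[of _ tr] conjI) (auto simp: G0_def)
qed

text \<open>Every \<open>W\<close> with at least half of the edges of \<open>G\<close> is peeled at
  level \<open>D\<close>, and the larger part has at least |G| / 4 edges. The assigned part has a
  subgraph of minimum degree |G| / (8 n), where the 8 leaves room for a strict inequality; the other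
  part becomes a wheel after its triples have been selected and cleaned.\<close>

lemma supersaturation:
  fixes G :: "'v set set" and n D d S \<theta> :: real and r l :: nat
  assumes G: "finite G" "G \<noteq> {}" "\<And>e. e \<in> G \<Longrightarrow> finite e \<and> card e = r" and r: "3 \<le> r" and l: "2 \<le> l"
    and n: "real (card (\<Union> G)) \<le> n" and D: "1 \<le> D"
    and \<delta>: "\<delta> = real (card G) / (8 * n)"
    and c1: "c1 = real ((2 * l * 2 + 1) ^ (2 * l))" and c2: "c2 = real ((2 * l * r\<^sup>2 + 1) ^ (2 * l))"
    and \<theta>: "0 < \<theta>" "\<theta> ^ (2 * l - 1) * n \<le> 1" "\<theta> ^ (l - 1) * (n * (D / \<delta>)) \<le> 1"
       "4 * (real (2 * l))\<^sup>2 * c1 * D \<le> \<theta> * \<delta>"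
    and d: "0 < d" "(real (r - 2) * d) ^ (r - 2) * (2 * real (r\<^sup>2)) \<le> D"
       "16 * (real (2 * l))\<^sup>2 * c2 \<le> dd"  "dd * (4 * real (r\<^sup>2)) = d"
    and S: "1 \<le> S" "4 * real (2 * l) * c1 * 2 ^ (2 * l + 1) * S \<le> \<theta> * \<delta>"
       "4 * real (2 * l) * c2 * 2 ^ (2 * l + 1) * (S / (dd * D)) \<le> 1"
       "4 * real (2 * l) * c2 * 2 ^ (2 * l + 1) * ((S / (dd * D)) ^ (2 * l - 1) * dd) \<le> 1"
  shows "\<exists>\<mu>. uniform_weight (2 * l) G \<mu> \<and> (\<forall>A. \<mu> A \<noteq> 0 \<longrightarrow> A \<in> berge_cycles r (2 * l)) \<and>
     0 < wdeg G \<mu> {} \<and> spread G (4 * real (2 * l)) (1 / S) \<mu>"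
proof -
  have cG: "0 < real (card G)" using G by (simp add: card_gt_0_iff)
  have "\<exists>\<mu>. uniform_weight (2 * l) G \<mu> \<and> (\<forall>A. \<mu> A \<noteq> 0 \<longrightarrow> A \<in> {A\<in>berge_cycles r (2 * l). A \<subseteq> G \<and> card A = 2 * l}) \<and>
     0 < wdeg G \<mu> {} \<and> spread G (4 * real (2 * l)) (1 / S) \<mu>"
  proof (rule spread_weight_exists[OF G(1,2) _ S(1)])
    fix W Sat assume W: "W \<subseteq> G" "card G \<le> 2 * card W" and SatG: "Sat \<subseteq> Pow G"
      and Sat: "\<And>\<sigma>. \<sigma> \<in> Sat \<Longrightarrow> 2 \<le> card \<sigma> \<and> card \<sigma> \<le> 2 * l"
      and few: "\<And>e j. e \<in> W \<Longrightarrow> 2 \<le> j \<Longrightarrow> j \<le> 2 * l \<Longrightarrow>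
         real (card {\<sigma>\<in>Sat. e \<in> \<sigma> \<and> card \<sigma> = j}) \<le> 2 ^ (2 * l + 1) * S ^ (j - 1)"
    have fSat: "finite Sat" using SatG G(1) finite_subset by (metis finite_Pow_iff)
    have fW: "finite W" using W G finite_subset by auto
    obtain F G' p where FG: "W = F \<union> G'" "F \<inter> G' = {}" "\<forall>e\<in>F. p e \<subseteq> e \<and> card (p e) = 2"
      and mult: "\<forall>q. real (card {e\<in>F. p e = q}) \<le> D"
      and cod: "\<forall>e\<in>G'. \<forall>q\<subseteq>e. card q = 2 \<longrightarrow> D < real (card {e'\<in>G'. q \<subseteq> e'})"
      using peel[OF fW order_trans[OF zero_le_one D]] by (elim exE conjE) (rule that)
    have ff: "finite F" "finite G'" using FG fW by auto
    have "card W = card F + card G'" using FG ff by (simp add: card_Un_disjoint)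
    then consider "real (card G) \<le> 4 * real (card F)" | "real (card G) \<le> 4 * real (card G')" using W(2) by linarith
    then have "\<exists>A\<in>berge_cycles r (2 * l). A \<subseteq> W \<and> card A = 2 * l \<and> (\<forall>\<sigma>\<in>Sat. \<not> \<sigma> \<subseteq> A)"
    proof cases
      case 1
      have FG': "F \<subseteq> G" using FG W by auto
      have fp: "finite (p e)" if "e \<in> F" for e using FG(3) that by (intro card_ge_0_finite) auto
      have sub: "\<Union> (p ` F) \<subseteq> \<Union> G" using FG(3) FG' by blast
      have fUG: "finite (\<Union> G)" using G by auto
      have cX: "real (card (\<Union> (p ` F))) \<le> n"
        using card_mono[OF fUG sub] n by linarith
      obtain e0 where "e0 \<in> G" using G by auto
      moreover have "e0 \<noteq> {}" using G(3)[OF \<open>e0 \<in> G\<close>] r by auto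
      ultimately have "\<Union> G \<noteq> {}" by blast
      then have n0: "0 < n" using n fUG by (metis card_gt_0_iff of_nat_0_less_iff less_le_trans)
      have \<delta>0: "0 < \<delta>" using \<delta> cG n0 by simp
      have "\<delta> * real (card (\<Union> (p ` F))) \<le> \<delta> * n" using cX \<delta>0 by (intro mult_left_mono) auto
      also have "\<dots> = real (card G) / 8" using \<delta> n0 by simp
      also have "\<dots> < real (card F)" using 1 cG by linarith
      finally have big: "\<delta> * real (card (\<Union> (p ` F))) < real (card F)" .
      have "\<exists>F'\<subseteq>F. F' \<noteq> {} \<and> (\<forall>e\<in>F'. \<forall>x\<in>p e. \<delta> \<le> real (card {e'\<in>F'. x \<in> p e'}))"
        by (rule min_degree_subgraph[OF ff(1) _ less_imp_le[OF \<delta>0] big]) (rule fp)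
      then obtain F' where F': "F' \<subseteq> F" "F' \<noteq> {}" "\<forall>e\<in>F'. \<forall>x\<in>p e. \<delta> \<le> real (card {e'\<in>F'. x \<in> p e'})"
        by (elim exE conjE) (rule that)
      have fF': "finite F'" using F'(1) ff(1) by (rule finite_subset)
      have pg: "pair_graph F' p \<delta> D"
      proof
        show "real (card {e\<in>F'. p e = q}) \<le> D" for q
        proof -
          have "card {e\<in>F'. p e = q} \<le> card {e\<in>F. p e = q}" using F' ff by (intro card_mono) auto
          then have "real (card {e\<in>F'. p e = q}) \<le> real (card {e\<in>F. p e = q})" by simp
          also have "\<dots> \<le> D" by (rule mult[rule_format])
          finally show ?thesis .
        qed
      qed (use fF' F' FG(3) \<delta>0 in auto)
      have "\<exists>A\<in>berge_cycles r (2 * l). A \<subseteq> F' \<and> card A = 2 * l \<and> (\<forall>\<sigma>\<in>Sat. \<not> \<sigma> \<subseteq> A)"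
      proof (rule assigned_good_cycle[OF pg _ l c1 D _ \<theta> _ S(2) Sat fSat])
        show "p e \<subseteq> e \<and> finite e \<and> card e = r" if "e \<in> F'" for e
          using that F'(1) FG(3) FG' G(3) by blast
        have "card (\<Union> (p ` F')) \<le> card (\<Union> (p ` F))" using F'(1) ff fp by (intro card_mono) auto
        then show "real (card (\<Union> (p ` F'))) \<le> n" using cX by linarith
        show "real (card {\<sigma>\<in>Sat. e \<in> \<sigma> \<and> card \<sigma> = j}) \<le> 2 ^ (2 * l + 1) * S ^ (j - 1)"
          if "e \<in> F'" "2 \<le> j" "j \<le> 2 * l" for e j using few[of e j] that F' FG by auto
      qed (use S(1) in auto)
      then obtain A where A: "A \<in> berge_cycles r (2 * l)" "A \<subseteq> F'" "card A = 2 * l" "\<forall>\<sigma>\<in>Sat. \<not> \<sigma> \<subseteq> A" by blast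
      have "A \<subseteq> W" using A(2) F'(1) FG(1) by blast
      then show ?thesis using A by blast
    next
      case 2
      have GG': "G' \<subseteq> G" using FG W by auto
      have unif': "finite e \<and> card e = r" if "e \<in> G'" for e using that GG' G by auto
      have D': "D < real (card {e'\<in>G'. q \<subseteq> e'})" if "e \<in> G'" "q \<subseteq> e" "card q = 2" for e q using cod that by blast
      have "\<exists>G0\<subseteq>G'. \<exists>tr. real (card G') / 2 \<le> real (card G0) \<and> (\<forall>e\<in>G0. tr e \<subseteq> e \<and> card (tr e) = 3 \<and>
          (\<forall>q\<subseteq>tr e. card q = 2 \<longrightarrow> real (card {e'\<in>G'. tr e \<subseteq> e'}) * d \<le> real (card {e'\<in>G'. q \<subseteq> e'})))"
        by (rule spread_triples[OF ff(2) _ r _ d(1,2)]) (use unif' D' in auto)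
      then obtain G0 tr where G0: "G0 \<subseteq> G'" "real (card G') / 2 \<le> real (card G0)"
        and tr: "\<forall>e\<in>G0. tr e \<subseteq> e \<and> card (tr e) = 3 \<and>
          (\<forall>q\<subseteq>tr e. card q = 2 \<longrightarrow> real (card {e'\<in>G'. tr e \<subseteq> e'}) * d \<le> real (card {e'\<in>G'. q \<subseteq> e'}))"
        by (elim exE conjE) (rule that)
      have tr_sub: "tr e \<subseteq> e" if "e \<in> G0" for e using tr[rule_format, OF that] by simp
      have tr_card: "card (tr e) = 3" if "e \<in> G0" for e using tr[rule_format, OF that] by simp
      have tr_cod: "real (card {e'\<in>G'. tr e \<subseteq> e'}) * d \<le> real (card {e'\<in>G'. q \<subseteq> e'})"
        if "e \<in> G0" "q \<subseteq> tr e" "card q = 2" for e q using tr[rule_format, OF that(1)] that(2,3) by simp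
      \<comment> \<open>Cleaning with thresholds codegree / (4 r^2) removes at most a quarter of
        \<open>G'\<close>, because the codegrees sum to at most r^2 |G'|. At least |G'| / 4 edges
        remain, whence B = 4 below, and the spread \<open>d\<close> of the triples drops to
        \<open>dd\<close>.\<close>
      define cd where "cd q = real (card {e\<in>G'. q \<subseteq> e}) / (4 * real (r\<^sup>2))" for q
      have r2: "0 < real (r\<^sup>2)" using r by simp
      have fG0: "finite G0" using G0 ff finite_subset by auto
      have ftr: "finite (tr e)" if "e \<in> G0" for e using tr_card[OF that] by (intro card_ge_0_finite) simp
      have "(\<Sum>q\<in>shadow2 (tr ` G0). cd q) \<le> (\<Sum>q\<in>shadow2 G'. cd q)"
      proof (rule sum_mono2)
        show "finite (shadow2 G')" using ff unif' by (intro finite_shadow2) auto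
        show "shadow2 (tr ` G0) \<subseteq> shadow2 G'"
        proof
          fix q assume "q \<in> shadow2 (tr ` G0)"
          then obtain e where e: "e \<in> G0" "q \<subseteq> tr e" "card q = 2" by (auto simp: shadow2_def)
          have "e \<in> G'" "q \<subseteq> e" using e(1) G0(1) subset_trans[OF e(2) tr_sub[OF e(1)]] by auto
          then show "q \<in> shadow2 G'" using e(3) by (auto simp: shadow2_def)
        qed
      qed (simp add: cd_def)
      also have "\<dots> \<le> (real (r\<^sup>2) * real (card G')) / (4 * real (r\<^sup>2))"
      proof -
        have "(\<Sum>q\<in>shadow2 G'. real (card {e\<in>G'. q \<subseteq> e})) \<le> real (r\<^sup>2) * real (card G')"
          by (rule sum_codegrees[OF ff(2)]) (rule unif')
        then show ?thesis unfolding cd_def sum_divide_distrib[symmetric] by (intro divide_right_mono) auto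
      qed
      also have "\<dots> = real (card G') / 4" using r2 by simp
      finally have s: "real (card G') / 4 \<le> real (card G0) - (\<Sum>q\<in>shadow2 (tr ` G0). cd q)" using G0(2) by linarith
      have "\<exists>E1\<subseteq>G0. real (card G') / 4 \<le> real (card E1) \<and>
          (\<forall>e\<in>E1. \<forall>q\<subseteq>tr e. card q = 2 \<longrightarrow> cd q \<le> real (card {e'\<in>E1. q \<subseteq> tr e'}))"
        by (rule codegree_cleaning[OF fG0 _ _ s]) (use ftr in \<open>auto simp: cd_def\<close>)
      then obtain E1 where E1: "E1 \<subseteq> G0" "real (card G') / 4 \<le> real (card E1)"
        "\<forall>e\<in>E1. \<forall>q\<subseteq>tr e. card q = 2 \<longrightarrow> cd q \<le> real (card {e'\<in>E1. q \<subseteq> tr e'})"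
        by (elim exE conjE) (rule that)
      have E1G: "E1 \<subseteq> G'" using E1 G0 by auto
      have G'pos: "0 < real (card G')" using 2 cG by linarith
      have dd1: "1 \<le> dd"
      proof -
        have c2': "1 \<le> c2" by (simp add: c2)
        have "1 \<le> (real (2 * l))\<^sup>2" by (rule one_le_power) (use l in simp)
        then have "1 * 1 \<le> 16 * (real (2 * l))\<^sup>2 * c2" using c2' by (intro mult_mono) linarith+
        then show ?thesis using d(3) by simp
      qed
      have wh: "wheel G' E1 tr dd D r"
      proof
        show "E1 \<noteq> {}" using E1(2) G'pos by auto
        show "tr e \<subseteq> e \<and> card (tr e) = 3" if "e \<in> E1" for e
          using tr_sub tr_card subsetD[OF E1(1) that] by blast
        show "real (card {e'\<in>E1. tr e' = tr e}) * dd \<le> real (card {e'\<in>E1. q \<subseteq> tr e'})"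
          if e: "e \<in> E1" and q: "q \<subseteq> tr e" "card q = 2" for e q
        proof -
          have "{e'\<in>E1. tr e' = tr e} \<subseteq> {e'\<in>G'. tr e \<subseteq> e'}"
            using subsetD[OF E1(1)] subsetD[OF G0(1)] tr_sub by fastforce
          then have "card {e'\<in>E1. tr e' = tr e} \<le> card {e'\<in>G'. tr e \<subseteq> e'}" using ff by (intro card_mono) auto
          then have "real (card {e'\<in>E1. tr e' = tr e}) * dd \<le> real (card {e'\<in>G'. tr e \<subseteq> e'}) * dd"
            using dd1 by (intro mult_right_mono) auto
          also have "\<dots> = real (card {e'\<in>G'. tr e \<subseteq> e'}) * d / (4 * real (r\<^sup>2))" using d(4) r2 by (simp add: field_simps)
          also have "\<dots> \<le> cd q" unfolding cd_def using tr_cod[OF subsetD[OF E1(1) e] q] by (intro divide_right_mono) auto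
          also have "\<dots> \<le> real (card {e'\<in>E1. q \<subseteq> tr e'})" using E1(3) e q by blast
          finally show ?thesis .
        qed
        show "D \<le> real (card {e'\<in>G'. q \<subseteq> e'})" if "e \<in> E1" "q \<subseteq> tr e" "card q = 2" for e q
        proof -
          have "e \<in> G0" using that(1) E1(1) by auto
          then have "e \<in> G'" "q \<subseteq> e" using G0(1) subset_trans[OF that(2) tr_sub] by auto
          then show ?thesis using D'[of e q] that(3) by simp
        qed
      qed (use ff E1G unif' dd1 D in auto)
      have "\<exists>A\<in>berge_cycles r (2 * l). A \<subseteq> G' \<and> card A = 2 * l \<and> (\<forall>\<sigma>\<in>Sat. \<not> \<sigma> \<subseteq> A)"
      proof (rule wheel.wheel_good_cycle[OF wh l c2 _ _ _ _ _ _ Sat fSat, where B = 4])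
        show "real (card {\<sigma>\<in>Sat. e \<in> \<sigma> \<and> card \<sigma> = j}) \<le> 2 ^ (2 * l + 1) * S ^ (j - 1)"
          if "e \<in> G'" "2 \<le> j" "j \<le> 2 * l" for e j using few[of e j] that FG by auto
      qed (use E1(2) d(3) S in \<open>auto simp: mult_ac\<close>)
      then obtain A where A: "A \<in> berge_cycles r (2 * l)" "A \<subseteq> G'" "card A = 2 * l" "\<forall>\<sigma>\<in>Sat. \<not> \<sigma> \<subseteq> A" by blast
      have "A \<subseteq> W" using A(2) FG(1) by blast
      then show ?thesis using A by blast
    qed
    then obtain A where A: "A \<in> berge_cycles r (2 * l)" "A \<subseteq> W" "card A = 2 * l" "\<forall>\<sigma>\<in>Sat. \<not> \<sigma> \<subseteq> A" by blast
    have "A \<subseteq> G" using A(2) W(1) by blast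
    then show "\<exists>A\<in>{A\<in>berge_cycles r (2 * l). A \<subseteq> G \<and> card A = 2 * l}. A \<subseteq> W \<and> (\<forall>\<sigma>\<in>Sat. \<not> \<sigma> \<subseteq> A)"
      using A by (intro bexI[of _ A]) auto
  qed (use l in auto)
  then obtain \<mu> where "uniform_weight (2 * l) G \<mu>" "\<forall>A. \<mu> A \<noteq> 0 \<longrightarrow> A \<in> {A\<in>berge_cycles r (2 * l). A \<subseteq> G \<and> card A = 2 * l}"
     "0 < wdeg G \<mu> {}" "spread G (4 * real (2 * l)) (1 / S) \<mu>" by (elim exE conjE) (rule that)
  then show ?thesis by (intro exI[of _ \<mu>]) simp
qed

section \<open>Choice of parameters and iteration\<close>

definition rate :: "nat \<Rightarrow> nat \<Rightarrow> real" where
  "rate l r = (2 * real l - 2) / (2 * (real r - 1) * real l ^ 2 - (real r + 2) * real l + 2)"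

text \<open>Up to a constant factor a bound for |G| / S, when G has t n^(1 + 1/l) edges and
  \<open>S\<close> is the value found in \<open>parameter_choice\<close>. The second term does not
  improve with t.\<close>

definition fingerprint :: "nat \<Rightarrow> nat \<Rightarrow> real \<Rightarrow> real \<Rightarrow> real" where
  "fingerprint l r t n = max (t powr (- rate l r) * n powr (1 + 1 / real l)) (n powr (1 + 1 / (2 * real l - 1)))"

lemma powr_divide_power:
  fixes x a :: real
  assumes "0 < x" "0 < m" "real m = b"
  shows "(x powr (a / b)) ^ m = x powr a"
  using assms by (simp add: powr_realpow[symmetric] powr_powr del: of_nat_less_0_iff)

lemma parameter_choice:
  fixes l r :: nat and c1 c2 :: real
  assumes l: "2 \<le> l" and r: "3 \<le> r" and c1: "1 \<le> c1" and c2: "1 \<le> c2"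
  shows "\<exists>K\<ge>1. \<exists>C>0. \<forall>t n. K \<le> t \<longrightarrow> 1 \<le> n \<longrightarrow> (\<exists>D d dd S \<theta>. 1 \<le> D \<and>
     0 < \<theta> \<and> \<theta> ^ (2 * l - 1) * n \<le> 1 \<and> \<theta> ^ (l - 1) * (n * (D / (t * n powr (1 / real l) / 8))) \<le> 1 \<and>
     4 * (real (2 * l))\<^sup>2 * c1 * D \<le> \<theta> * (t * n powr (1 / real l) / 8) \<and>
     0 < d \<and> (real (r - 2) * d) ^ (r - 2) * (2 * real (r\<^sup>2)) \<le> D \<and>
     16 * (real (2 * l))\<^sup>2 * c2 \<le> dd \<and> dd * (4 * real (r\<^sup>2)) = d \<and>
     1 \<le> S \<and> 4 * real (2 * l) * c1 * 2 ^ (2 * l + 1) * S \<le> \<theta> * (t * n powr (1 / real l) / 8) \<and>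
     4 * real (2 * l) * c2 * 2 ^ (2 * l + 1) * (S / (dd * D)) \<le> 1 \<and>
     4 * real (2 * l) * c2 * 2 ^ (2 * l + 1) * ((S / (dd * D)) ^ (2 * l - 1) * dd) \<le> 1 \<and>
     t * n powr (1 + 1 / real l) / S \<le> C * fingerprint l r t n)"
proof -
  define L R where "L = real l" and "R = real r"
  have L: "2 \<le> L" and R: "3 \<le> R" using l r by (auto simp: L_def R_def)
  define \<Delta> where "\<Delta> = 2 * (R - 1) * L ^ 2 - (R + 2) * L + 2"
  \<comment> \<open>This form shows positivity, and it separates the part of \<open>\<Delta>\<close>
    that cancels in 1 - \<alpha> from the part that yields \<open>\<gamma>\<close>.\<close>
  have \<Delta>_eq: "\<Delta> = (R - 2) * (L * (2 * L - 1)) + 2 * (L - 1)\<^sup>2"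
    by (simp add: \<Delta>_def power2_eq_square algebra_simps)
  have \<Delta>: "0 < \<Delta>"
  proof -
    have "0 \<le> (R - 2) * (L * (2 * L - 1))" using L R by (intro mult_nonneg_nonneg) auto
    moreover have "0 < 2 * (L - 1)\<^sup>2" using L by simp
    ultimately show ?thesis unfolding \<Delta>_eq by linarith
  qed
  \<comment> \<open>The exponent of \<open>d\<close>. It solves 1 - \<alpha> - \<beta> (2 l - 2) /
    (2 l - 1) = - (1 - \<alpha>) / (l - 1) with \<alpha> = (r - 2) \<beta>: wheels and pair graphs
    then ask for the same power of t in the fingerprint.\<close>
  define \<beta> where "\<beta> = L * (2 * L - 1) / \<Delta>"
  define \<alpha> where "\<alpha> = \<beta> * (R - 2)"
  define \<gamma> where "\<gamma> = (2 * L - 2) / \<Delta>"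
  have \<gamma>_rate: "\<gamma> = rate l r" by (simp add: \<gamma>_def rate_def \<Delta>_def L_def R_def)
  have \<beta>: "0 < \<beta>" unfolding \<beta>_def using L \<Delta> by simp
  have \<alpha>: "0 < \<alpha>" unfolding \<alpha>_def using \<beta> R by simp
  have \<alpha>1: "1 - \<alpha> = (L - 1) * \<gamma>"
  proof -
    have "1 - \<alpha> = (\<Delta> - (R - 2) * (L * (2 * L - 1))) / \<Delta>" unfolding \<alpha>_def \<beta>_def using \<Delta> by (simp add: field_simps)
    also have "\<dots> = 2 * (L - 1)\<^sup>2 / \<Delta>" by (simp add: \<Delta>_eq)
    finally show ?thesis by (simp add: \<gamma>_def power2_eq_square field_simps)
  qed
  have \<gamma>: "0 < \<gamma>" unfolding \<gamma>_def using L \<Delta> by simp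
  have \<beta>\<gamma>: "1 - \<alpha> - \<beta> * ((2 * L - 2) / (2 * L - 1)) = - \<gamma>"
  proof -
    have "\<beta> * ((2 * L - 2) / (2 * L - 1)) = L * \<gamma> * ((2 * L - 1) / (2 * L - 1))" unfolding \<beta>_def \<gamma>_def by simp
    also have "\<dots> = L * \<gamma>" using L by simp
    finally have "\<beta> * ((2 * L - 2) / (2 * L - 1)) = L * \<gamma>" .
    then show ?thesis unfolding \<alpha>1 by (simp add: algebra_simps)
  qed
  \<comment> \<open>With d = cd t^\<beta> the factor (r - 2) d equals t^\<beta> / (2 R^2), and its
    power r - 2 is at most D / (2 R^2).\<close>
  define cd where "cd = 1 / ((R - 2) * (2 * R\<^sup>2))"
  define ce where "ce = cd / (4 * R\<^sup>2)"
  have R9: "9 \<le> R\<^sup>2" using R power_mono[of 3 R 2] by simp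
  have cd: "0 < cd" unfolding cd_def using R by simp
  have ce: "0 < ce" "ce \<le> 1"
  proof -
    show "0 < ce" unfolding ce_def using cd R by simp
    have "1 * 18 \<le> (R - 2) * (2 * R\<^sup>2)" using R R9 by (intro mult_mono) auto
    then have "cd \<le> 1" unfolding cd_def by (simp add: divide_le_eq)
    then show "ce \<le> 1" unfolding ce_def using R9 cd by (simp add: divide_le_eq)
  qed
  \<comment> \<open>\<open>A\<close> absorbs the constants in the conditions on \<open>S\<close>;
    \<open>Q\<close> below also absorbs those in the conditions on \<open>D\<close> and
    \<open>dd\<close>.\<close>
  define A where "A = 4 * (2 * L) * (c1 + c2) * 2 ^ (2 * l + 1)"
  have pow2: "(1::real) \<le> 2 ^ (2 * l + 1)" by (rule one_le_power) simp
  have A: "1 \<le> A"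
  proof -
    have "1 * 1 * 1 \<le> 4 * (2 * L) * (c1 + c2) * 2 ^ (2 * l + 1)"
      using L c1 c2 pow2 by (intro mult_mono) auto
    then show ?thesis by (simp add: A_def)
  qed
  define Q where "Q = 16 * (2 * L)\<^sup>2 * (c1 + c2) * A"
  have LL: "1 \<le> (2 * L)\<^sup>2" using L by (intro one_le_power) simp
  have Q: "A \<le> Q" "4 * (2 * L)\<^sup>2 * c1 \<le> Q" "16 * (2 * L)\<^sup>2 * c2 \<le> Q" "1 \<le> Q"
  proof -
    have "1 * 1 \<le> (16 * (2 * L)\<^sup>2) * (c1 + c2)" using LL c1 c2 by (intro mult_mono) auto
    then have "1 * A \<le> (16 * (2 * L)\<^sup>2) * (c1 + c2) * A" using A by (intro mult_right_mono) auto
    then show "A \<le> Q" by (simp add: Q_def)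
    then show "1 \<le> Q" using A by simp
    have "(4 * (2 * L)\<^sup>2 * c1) * 1 \<le> (16 * (2 * L)\<^sup>2 * (c1 + c2)) * A"
      using LL c1 c2 A by (intro mult_mono) auto
    then show "4 * (2 * L)\<^sup>2 * c1 \<le> Q" by (simp add: Q_def)
    have "(16 * (2 * L)\<^sup>2 * c2) * 1 \<le> (16 * (2 * L)\<^sup>2 * (c1 + c2)) * A"
      using LL c1 c2 A by (intro mult_mono) auto
    then show "16 * (2 * L)\<^sup>2 * c2 \<le> Q" by (simp add: Q_def)
  qed
  define \<xi> where "\<xi> = (2 * L - 2) / (2 * L - 1)"
  have \<xi>: "1 / 2 \<le> \<xi>" "\<xi> \<le> 1" "0 < \<xi>"
    unfolding \<xi>_def using L by (auto simp: field_simps)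
  text \<open>\<open>K\<close> is taken so large that every power of \<open>t\<close> which has to be large exceeds the constants.\<close>
  define K where "K = max ((64 * Q) powr (1 / (1 - \<alpha>))) ((Q\<^sup>2 / ce) powr (1 / \<beta>))"
  define C where "C = 64 * A / ce"
  have pos1\<alpha>: "0 < 1 - \<alpha>" unfolding \<alpha>1 using L \<gamma> by simp
  have K1: "1 \<le> K" unfolding K_def using Q(4) pos1\<alpha> by (intro max.coboundedI1 ge_one_powr_ge_zero) auto
  have C: "0 < C" unfolding C_def using A ce by simp
  show ?thesis
  proof (rule exI[of _ K], intro conjI K1, rule exI[of _ C], intro conjI C allI impI)
    fix t n :: real assume t: "K \<le> t" and n: "1 \<le> n"
    have t1: "1 \<le> t" using t K1 by simp
    have t\<alpha>: "64 * Q \<le> t powr (1 - \<alpha>)"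
    proof -
      have "64 * Q = ((64 * Q) powr (1 / (1 - \<alpha>))) powr (1 - \<alpha>)" using Q(4) pos1\<alpha> by (simp add: powr_powr)
      also have "\<dots> \<le> t powr (1 - \<alpha>)" using t pos1\<alpha> by (intro powr_mono2) (auto simp: K_def)
      finally show ?thesis .
    qed
    have t\<beta>: "Q\<^sup>2 \<le> ce * t powr \<beta>"
    proof -
      have "Q\<^sup>2 / ce = ((Q\<^sup>2 / ce) powr (1 / \<beta>)) powr \<beta>" using Q(4) ce \<beta> by (simp add: powr_powr)
      also have "\<dots> \<le> t powr \<beta>" using t \<beta> by (intro powr_mono2) (auto simp: K_def)
      finally show ?thesis using ce by (simp add: field_simps)
    qed
    define D where "D = t powr \<alpha>"
    define d where "d = cd * t powr \<beta>"
    define dd where "dd = ce * t powr \<beta>"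
    define \<delta> where "\<delta> = t * n powr (1 / L) / 8"
    \<comment> \<open>\<open>\<theta>1\<close> and \<open>\<theta>2\<close> each give equality in
      one of the two decay conditions on \<open>\<theta>\<close>; \<open>S2\<close> is the bound
      that the wheel imposes.\<close>
    define \<theta>1 where "\<theta>1 = (\<delta> / (n * D)) powr (1 / (L - 1))"
    define \<theta>2 where "\<theta>2 = n powr (- 1 / (2 * L - 1))"
    define \<theta> where "\<theta> = min \<theta>1 \<theta>2"
    define S2 where "S2 = D * dd powr \<xi>"
    define S where "S = min (\<theta> * \<delta>) S2 / A"
    have D: "1 \<le> D" unfolding D_def using t1 \<alpha> by (intro ge_one_powr_ge_zero) auto
    have Q2: "Q \<le> Q\<^sup>2" using Q(4) by (simp add: power2_eq_square)
    have dd: "Q \<le> dd" "1 \<le> dd" "Q\<^sup>2 \<le> dd" using t\<beta> Q2 Q(4) by (auto simp: dd_def)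
    have \<delta>0: "0 < \<delta>" unfolding \<delta>_def using t1 n by simp
    have \<theta>0: "0 < \<theta>1" "0 < \<theta>2" "0 < \<theta>" unfolding \<theta>_def \<theta>1_def \<theta>2_def using \<delta>0 n D by auto
    have l1: "real (l - 1) = L - 1" "real (2 * l - 1) = 2 * L - 1" "real (r - 2) = R - 2"
      using l r by (auto simp: L_def R_def of_nat_diff)
    note l1 = l1 l1(1,2)[unfolded One_nat_def]
    have l0: "0 < l - 1" "0 < 2 * l - 1" "0 < r - 2" using l r by auto
    have th1: "\<theta>1 ^ (l - 1) = \<delta> / (n * D)"
      unfolding \<theta>1_def using powr_divide_power[OF _ l0(1) l1(1), of "\<delta> / (n * D)" 1] \<delta>0 n D by simp
    have th2: "\<theta>2 ^ (2 * l - 1) = 1 / n"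
      unfolding \<theta>2_def using powr_divide_power[OF _ l0(2) l1(2), of n "- 1"] n by (simp add: powr_minus divide_inverse)
    have \<delta>D: "\<delta> / D = t powr (1 - \<alpha>) * n powr (1 / L) / 8"
      unfolding \<delta>_def D_def using t1 by (simp add: powr_diff)
    have \<theta>1_eq: "\<theta>1 = t powr \<gamma> * n powr (- 1 / L) / 8 powr (1 / (L - 1))"
    proof -
      have "\<delta> / (n * D) = t powr (1 - \<alpha>) * n powr (1 / L - 1) / 8"
      proof -
        have "\<delta> / (n * D) = \<delta> / D / n" by simp
        also have "\<dots> = t powr (1 - \<alpha>) * (n powr (1 / L) / n powr 1) / 8" unfolding \<delta>D using n by simp
        finally show ?thesis by (simp only: powr_diff)
      qed
      also have "\<dots> powr (1 / (L - 1)) = t powr ((1 - \<alpha>) * (1 / (L - 1))) * n powr ((1 / L - 1) * (1 / (L - 1))) / 8 powr (1 / (L - 1))"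
        using t1 n by (simp add: powr_mult powr_divide powr_powr)
      also have "(1 - \<alpha>) * (1 / (L - 1)) = \<gamma>" unfolding \<alpha>1 using L by simp
      also have "(1 / L - 1) * (1 / (L - 1)) = - 1 / L" using L by (simp add: field_simps)
      finally show ?thesis by (simp add: \<theta>1_def)
    qed
    have e8: "8 powr (1 / (L - 1)) \<le> (8::real)"
    proof -
      have "8 powr (1 / (L - 1)) \<le> 8 powr (1::real)" using L by (intro powr_mono) (auto simp: field_simps)
      then show ?thesis by simp
    qed
    have big1: "Q * D \<le> \<theta>1 * \<delta>"
    proof -
      have "\<theta>1 * \<delta> / D = (t powr \<gamma> * n powr (- 1 / L) / 8 powr (1 / (L - 1))) * (t powr (1 - \<alpha>) * n powr (1 / L) / 8)"
        unfolding \<delta>D[symmetric] \<theta>1_eq[symmetric] by simp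
      also have "\<dots> = t powr \<gamma> * t powr (1 - \<alpha>) / (8 * 8 powr (1 / (L - 1)))"
        using n by (simp add: powr_minus field_simps)
      also have "\<dots> \<ge> 1 * t powr (1 - \<alpha>) / (8 * 8)"
        using t1 \<gamma> e8 by (intro frac_le mult_mono) (auto intro: ge_one_powr_ge_zero)
      finally have "t powr (1 - \<alpha>) / 64 \<le> \<theta>1 * \<delta> / D" by simp
      then have "Q \<le> \<theta>1 * \<delta> / D" using t\<alpha> by linarith
      then show ?thesis using D by (simp add: field_simps)
    qed
    have big2: "Q * D \<le> \<theta>2 * \<delta>"
    proof -
      have "\<theta>2 * \<delta> / D = n powr (- 1 / (2 * L - 1)) * (t powr (1 - \<alpha>) * n powr (1 / L) / 8)"
        unfolding \<delta>D[symmetric] \<theta>2_def[symmetric] by simp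
      also have "\<dots> = n powr (1 / L - 1 / (2 * L - 1)) * (t powr (1 - \<alpha>) / 8)"
        using n by (simp add: powr_diff powr_minus field_simps)
      also have "\<dots> \<ge> 1 * (t powr (1 - \<alpha>) / 8)"
      proof (rule mult_right_mono)
        have "0 \<le> 1 / L - 1 / (2 * L - 1)" using L by (simp add: field_simps)
        then show "1 \<le> n powr (1 / L - 1 / (2 * L - 1))" using n by (intro ge_one_powr_ge_zero)
      qed simp
      finally have "t powr (1 - \<alpha>) / 8 \<le> \<theta>2 * \<delta> / D" by simp
      then have "Q \<le> \<theta>2 * \<delta> / D" using t\<alpha> Q(4) by linarith
      then show ?thesis using D by (simp add: field_simps)
    qed
    have big: "Q * D \<le> \<theta> * \<delta>" using big1 big2 by (auto simp: \<theta>_def min_def)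
    have S2A: "A \<le> S2"
    proof -
      have "Q = (Q\<^sup>2) powr (1 / 2)" using Q(4) by (simp add: powr_half_sqrt)
      also have "\<dots> \<le> dd powr (1 / 2)" using dd Q(4) by (intro powr_mono2) auto
      also have "\<dots> \<le> dd powr \<xi>" using dd \<xi> by (intro powr_mono) auto
      finally have "1 * Q \<le> D * dd powr \<xi>" using D Q(4) by (intro mult_mono) auto
      then show ?thesis using Q(1) by (simp add: S2_def)
    qed
    have "A * 1 \<le> Q * D" using Q(1) D A by (intro mult_mono) auto
    then have A\<theta>: "A \<le> \<theta> * \<delta>" using big by simp
    have S1: "1 \<le> S" unfolding S_def using S2A A\<theta> A by simp
    have SA: "A * S \<le> \<theta> * \<delta>" "A * S \<le> S2" unfolding S_def using A by auto
    have coeff: "4 * real (2 * l) * c1 * 2 ^ (2 * l + 1) \<le> A" "4 * real (2 * l) * c2 * 2 ^ (2 * l + 1) \<le> A"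
      unfolding A_def using c1 c2 L by (auto simp: L_def intro!: mult_right_mono mult_left_mono)
    have rat: "A * (S / (dd * D)) \<le> dd powr (- 1 / (2 * L - 1))"
    proof -
      have "A * (S / (dd * D)) \<le> S2 / (dd * D)" using SA(2) dd D by (simp add: divide_right_mono)
      also have "\<dots> = dd powr \<xi> / dd powr 1" using D dd by (simp add: S2_def)
      also have "\<dots> = dd powr (\<xi> - 1)" by (simp only: powr_diff)
      also have "\<xi> - 1 = - 1 / (2 * L - 1)" unfolding \<xi>_def using L by (simp add: field_simps)
      finally show ?thesis .
    qed
    have s0: "0 \<le> S / (dd * D)" using S1 dd D by simp
    have cond3: "A * (S / (dd * D)) \<le> 1"
    proof -
      have "dd powr (- 1 / (2 * L - 1)) \<le> dd powr 0" using dd L by (intro powr_mono) auto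
      then show ?thesis using rat dd by simp
    qed
    have cond4: "A * ((S / (dd * D)) ^ (2 * l - 1) * dd) \<le> 1"
    proof -
      \<comment> \<open>Since A \<ge> 1, it may be raised to the power 2 l - 1 and absorbed into the
        ratio.\<close>
      have "A * (S / (dd * D)) ^ (2 * l - 1) \<le> A ^ (2 * l - 1) * (S / (dd * D)) ^ (2 * l - 1)"
        using A l s0 self_le_power[of A "2 * l - 1"] by (intro mult_right_mono) auto
      also have "\<dots> = (A * (S / (dd * D))) ^ (2 * l - 1)" by (simp only: power_mult_distrib)
      also have "\<dots> \<le> (dd powr (- 1 / (2 * L - 1))) ^ (2 * l - 1)"
        using rat s0 A by (intro power_mono mult_nonneg_nonneg) auto
      also have "\<dots> = 1 / dd"
        using powr_divide_power[OF _ l0(2) l1(2), of dd "- 1"] dd by (simp add: powr_minus divide_inverse)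
      finally have "A * (S / (dd * D)) ^ (2 * l - 1) * dd \<le> 1 / dd * dd" using dd by (intro mult_right_mono) auto
      then show ?thesis using dd by (simp add: mult_ac)
    qed
    have cond_d: "(real (r - 2) * d) ^ (r - 2) * (2 * real (r\<^sup>2)) \<le> D"
    proof -
      have "(t powr \<beta>) ^ (r - 2) = D" unfolding D_def \<alpha>_def using t1 by (simp add: powr_realpow[symmetric] powr_powr l1)
      moreover have "real (r - 2) * d = 1 / (2 * R\<^sup>2) * t powr \<beta>" unfolding d_def cd_def l1 using R by (simp add: field_simps)
      ultimately have "(real (r - 2) * d) ^ (r - 2) = (1 / (2 * R\<^sup>2)) ^ (r - 2) * D" by (simp only: power_mult_distrib)
      also have "\<dots> \<le> (1 / (2 * R\<^sup>2)) ^ 1 * D"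
        using R9 r D by (intro mult_right_mono power_decreasing) (auto simp: divide_le_eq)
      finally have "(real (r - 2) * d) ^ (r - 2) * (2 * R\<^sup>2) \<le> (1 / (2 * R\<^sup>2)) ^ 1 * D * (2 * R\<^sup>2)"
        by (intro mult_right_mono) auto
      then show ?thesis using r by (simp add: R_def split: if_splits)
    qed
    have final: "t * n powr (1 + 1 / L) / S \<le> C * fingerprint l r t n"
    proof -
      define N where "N = t * n powr (1 + 1 / L)"
      define M where "M = fingerprint l r t n"
      have N\<delta>: "N = 8 * n * \<delta>" unfolding N_def \<delta>_def using n by (simp add: powr_add)
      have M1: "t powr (- \<gamma>) * n powr (1 + 1 / L) \<le> M" "n powr (1 + 1 / (2 * L - 1)) \<le> M"
        unfolding M_def fingerprint_def \<gamma>_rate L_def by auto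
      have M0: "0 < M" using M1(2) n by (smt (verit) powr_gt_zero)
      have b1: "N / (\<theta>1 * \<delta>) \<le> 64 * M"
      proof -
        have "N / (\<theta>1 * \<delta>) = 8 * n / \<theta>1" using \<delta>0 by (simp add: N\<delta>)
        also have "\<dots> = 8 * 8 powr (1 / (L - 1)) * (t powr (- \<gamma>) * n powr (1 + 1 / L))"
          unfolding \<theta>1_eq using n t1 by (simp add: powr_minus powr_add field_simps)
        also have "\<dots> \<le> 8 * 8 * M" using e8 M1 by (intro mult_mono) auto
        finally show ?thesis by simp
      qed
      have b2: "N / (\<theta>2 * \<delta>) \<le> 64 * M"
      proof -
        have "N / (\<theta>2 * \<delta>) = 8 * n / \<theta>2" using \<delta>0 by (simp add: N\<delta>)
        also have "\<dots> = 8 * n powr (1 + 1 / (2 * L - 1))"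
          unfolding \<theta>2_def using n by (simp add: powr_minus powr_add field_simps)
        also have "\<dots> \<le> 64 * M" using M1 M0 by simp
        finally show ?thesis .
      qed
      have b3: "N / S2 \<le> 1 / ce * M"
      proof -
        have "S2 = t powr \<alpha> * (ce powr \<xi> * t powr (\<beta> * \<xi>))"
          unfolding S2_def D_def dd_def using ce t1 by (simp add: powr_mult powr_powr)
        then have "N / S2 = 1 / ce powr \<xi> * (t powr 1 / (t powr \<alpha> * t powr (\<beta> * \<xi>)) * n powr (1 + 1 / L))"
          unfolding N_def using t1 by simp
        also have "t powr 1 / (t powr \<alpha> * t powr (\<beta> * \<xi>)) = t powr (1 - \<alpha> - \<beta> * \<xi>)"
          using t1 by (simp add: powr_diff)
        also have "1 - \<alpha> - \<beta> * \<xi> = - \<gamma>" using \<beta>\<gamma> by (simp add: \<xi>_def)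
        also have "1 / ce powr \<xi> * (t powr (- \<gamma>) * n powr (1 + 1 / L)) \<le> 1 / ce * M"
        proof (rule mult_mono)
          have "ce powr 1 \<le> ce powr \<xi>" using ce \<xi> by (intro powr_mono') auto
          then show "1 / ce powr \<xi> \<le> 1 / ce" using ce by (intro divide_left_mono) auto
        qed (use M1 ce in auto)
        finally show ?thesis .
      qed
      have c64: "64 * M \<le> 64 / ce * M" "1 / ce * M \<le> 64 / ce * M"
        using ce M0 by (auto simp: field_simps)
      have "N / min (\<theta> * \<delta>) S2 \<le> 64 / ce * M"
      proof -
        consider "min (\<theta> * \<delta>) S2 = \<theta>1 * \<delta>" | "min (\<theta> * \<delta>) S2 = \<theta>2 * \<delta>" | "min (\<theta> * \<delta>) S2 = S2"
          unfolding \<theta>_def min_def by metis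
        then show ?thesis using b1 b2 b3 c64 by cases auto
      qed
      then have "A * (N / min (\<theta> * \<delta>) S2) \<le> A * (64 / ce * M)" using A by (intro mult_left_mono) auto
      then show ?thesis by (simp add: S_def C_def N_def M_def mult_ac)
    qed
    show "\<exists>D d dd S \<theta>. 1 \<le> D \<and>
     0 < \<theta> \<and> \<theta> ^ (2 * l - 1) * n \<le> 1 \<and> \<theta> ^ (l - 1) * (n * (D / (t * n powr (1 / real l) / 8))) \<le> 1 \<and>
     4 * (real (2 * l))\<^sup>2 * c1 * D \<le> \<theta> * (t * n powr (1 / real l) / 8) \<and>
     0 < d \<and> (real (r - 2) * d) ^ (r - 2) * (2 * real (r\<^sup>2)) \<le> D \<and>
     16 * (real (2 * l))\<^sup>2 * c2 \<le> dd \<and> dd * (4 * real (r\<^sup>2)) = d \<and>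
     1 \<le> S \<and> 4 * real (2 * l) * c1 * 2 ^ (2 * l + 1) * S \<le> \<theta> * (t * n powr (1 / real l) / 8) \<and>
     4 * real (2 * l) * c2 * 2 ^ (2 * l + 1) * (S / (dd * D)) \<le> 1 \<and>
     4 * real (2 * l) * c2 * 2 ^ (2 * l + 1) * ((S / (dd * D)) ^ (2 * l - 1) * dd) \<le> 1 \<and>
     t * n powr (1 + 1 / real l) / S \<le> C * fingerprint l r t n"
      unfolding L_def[symmetric] \<delta>_def[symmetric]
    proof (rule exI[of _ D], rule exI[of _ d], rule exI[of _ dd], rule exI[of _ S], rule exI[of _ \<theta>], intro conjI)
      have "\<theta> ^ (2 * l - 1) \<le> \<theta>2 ^ (2 * l - 1)" using \<theta>0 by (intro power_mono) (auto simp: \<theta>_def)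
      then have "\<theta> ^ (2 * l - 1) * n \<le> 1 / n * n" unfolding th2 using n by (intro mult_right_mono) auto
      then show "\<theta> ^ (2 * l - 1) * n \<le> 1" using n by simp
      have "\<theta> ^ (l - 1) \<le> \<theta>1 ^ (l - 1)" using \<theta>0 by (intro power_mono) (auto simp: \<theta>_def)
      then have "\<theta> ^ (l - 1) * (n * (D / \<delta>)) \<le> (\<delta> / (n * D)) * (n * (D / \<delta>))"
        unfolding th1 using n D \<delta>0 by (intro mult_right_mono) auto
      then show "\<theta> ^ (l - 1) * (n * (D / \<delta>)) \<le> 1" using n D \<delta>0 by simp
      have "4 * (2 * L)\<^sup>2 * c1 * D \<le> Q * D" using Q D by (intro mult_right_mono) auto
      then show "4 * (real (2 * l))\<^sup>2 * c1 * D \<le> \<theta> * \<delta>" using big by (simp add: L_def)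
      show "0 < d" unfolding d_def using cd t1 by simp
      show "16 * (real (2 * l))\<^sup>2 * c2 \<le> dd" using Q dd by (simp add: L_def)
      show "dd * (4 * real (r\<^sup>2)) = d" unfolding dd_def d_def ce_def using r by (simp add: R_def)
      show "4 * real (2 * l) * c1 * 2 ^ (2 * l + 1) * S \<le> \<theta> * \<delta>"
        using mult_right_mono[OF coeff(1), of S] S1 SA(1) by linarith
      show "4 * real (2 * l) * c2 * 2 ^ (2 * l + 1) * (S / (dd * D)) \<le> 1"
        using mult_right_mono[OF coeff(2) s0] cond3 by linarith
      have "0 \<le> (S / (dd * D)) ^ (2 * l - 1) * dd" using s0 dd by simp
      then show "4 * real (2 * l) * c2 * 2 ^ (2 * l + 1) * ((S / (dd * D)) ^ (2 * l - 1) * dd) \<le> 1"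
        using mult_right_mono[OF coeff(2)] cond4 by (meson order_trans)
    qed (use D \<theta>0 cond_d S1 final in auto)
  qed
qed

section \<open>One container round and its iteration\<close>

lemma rate_pos:
  assumes "2 \<le> l" "3 \<le> r"
  shows "0 < rate l r"
proof -
  have L: "2 \<le> real l" "3 \<le> real r" using assms by auto
  have "0 \<le> (real r - 2) * (real l * (2 * real l - 1))" using L by (intro mult_nonneg_nonneg) auto
  moreover have "0 < 2 * (real l - 1)\<^sup>2" using L by simp
  ultimately have "0 < 2 * (real r - 1) * real l ^ 2 - (real r + 2) * real l + 2"
    by (simp add: power2_eq_square algebra_simps)
  then show ?thesis unfolding rate_def using L by (intro divide_pos_pos) auto
qed

text \<open>Rounds on denser graphs are cheaper, so the bound at the target density serves for all
  of them.\<close>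

lemma fingerprint_antimono:
  assumes "2 \<le> l" "3 \<le> r" "0 < t" "t \<le> t'"
  shows "fingerprint l r t' n \<le> fingerprint l r t n"
  unfolding fingerprint_def using rate_pos[OF assms(1,2)] assms(3,4)
  by (intro max.mono mult_right_mono powr_mono2' order_refl) auto

lemma card_nsets_le:
  shows "card (nsets {1..n} r) \<le> n ^ r"
proof -
  have "card (nsets {1..n} r) = n choose r"
    by (simp add: card_nsets)
  also have "\<dots> \<le> n ^ r" by (cases "r \<le> n") (auto simp: binomial_le_pow binomial_eq_0)
  finally show ?thesis .
qed

text \<open>\<open>t\<close> only parametrises the number of edges. A \<open>berge_free\<close>
  graph is independent for every weight supported on Berge cycles, so the container theorem applies
  to the weight from \<open>supersaturation\<close> with \<tau> = 1 / S.\<close>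

lemma container_step:
  assumes l: "2 \<le> l" and r: "3 \<le> r"
  shows "\<exists>K\<ge>1. \<exists>\<epsilon>>0. \<epsilon> \<le> 1 \<and> (\<exists>C\<ge>0. \<forall>n\<ge>3. \<forall>t G. K \<le> t \<longrightarrow> G \<subseteq> nsets {1..n} r \<longrightarrow>
     real (card G) = t * real n powr (1 + 1 / real l) \<longrightarrow>
     covered G (berge_free r (2 * l)) ((1 - \<epsilon>) * real (card G)) (exp (C * ln (real n) * fingerprint l r t (real n))))"
proof -
  define c1 c2 where "c1 = real ((2 * l * 2 + 1) ^ (2 * l))" and "c2 = real ((2 * l * r\<^sup>2 + 1) ^ (2 * l))"
  have "1 \<le> real (x ^ k)" if "1 \<le> x" for x k :: nat
    using one_le_power[OF that] by (metis of_nat_1 of_nat_le_iff)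
  then have c: "1 \<le> c1" "1 \<le> c2" unfolding c1_def c2_def by simp_all
  obtain K Cp where K: "1 \<le> K" and Cp: "0 < Cp" and par: "\<And>t n. K \<le> t \<Longrightarrow> 1 \<le> n \<Longrightarrow> \<exists>D d dd S \<theta>. 1 \<le> D \<and>
     0 < \<theta> \<and> \<theta> ^ (2 * l - 1) * n \<le> 1 \<and> \<theta> ^ (l - 1) * (n * (D / (t * n powr (1 / real l) / 8))) \<le> 1 \<and>
     4 * (real (2 * l))\<^sup>2 * c1 * D \<le> \<theta> * (t * n powr (1 / real l) / 8) \<and>
     0 < d \<and> (real (r - 2) * d) ^ (r - 2) * (2 * real (r\<^sup>2)) \<le> D \<and>
     16 * (real (2 * l))\<^sup>2 * c2 \<le> dd \<and> dd * (4 * real (r\<^sup>2)) = d \<and>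
     1 \<le> S \<and> 4 * real (2 * l) * c1 * 2 ^ (2 * l + 1) * S \<le> \<theta> * (t * n powr (1 / real l) / 8) \<and>
     4 * real (2 * l) * c2 * 2 ^ (2 * l + 1) * (S / (dd * D)) \<le> 1 \<and>
     4 * real (2 * l) * c2 * 2 ^ (2 * l + 1) * ((S / (dd * D)) ^ (2 * l - 1) * dd) \<le> 1 \<and>
     t * n powr (1 + 1 / real l) / S \<le> Cp * fingerprint l r t n"
    using parameter_choice[OF l r c] by blast
  have "1 \<le> 4 * real (2 * l)" using l by simp
  from hypergraph_containers[OF this, of "2 * l", where ?'a = "nat set"]
  obtain \<epsilon> K' where \<epsilon>: "0 < \<epsilon>" and K': "0 \<le> K'"
    and cont: "\<And>(V :: nat set set) \<mu> \<tau>. finite V \<Longrightarrow> V \<noteq> {} \<Longrightarrow> 0 < \<tau> \<Longrightarrow> \<tau> \<le> 1 \<Longrightarrow>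
      uniform_weight (2 * l) V \<mu> \<Longrightarrow> 0 < wdeg V \<mu> {} \<Longrightarrow> spread V (4 * real (2 * l)) \<tau> \<mu> \<Longrightarrow> has_containers V \<mu> \<epsilon> K' \<tau>"
    by metis
  define C where "C = real (r + 1) * (K' * (Cp + 1))"
  have "covered G (berge_free r (2 * l)) ((1 - min \<epsilon> 1) * real (card G)) (exp (C * ln (real n) * fingerprint l r t (real n)))"
    if n: "3 \<le> n" and t: "K \<le> t" and G: "G \<subseteq> nsets {1..n} r" and cG: "real (card G) = t * real n powr (1 + 1 / real l)" for n t G
  proof -
    have n1: "1 \<le> real n" using n by simp
    have fX: "finite (nsets {1..n} r)" by (simp add: finite_imp_finite_nsets)
    have fG: "finite G" using G fX finite_subset by blast
    have G0: "G \<noteq> {}" using cG t K n by auto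
    have Gr: "finite e \<and> card e = r" if "e \<in> G" for e using G that by (auto simp: nsets_def)
    have "card (\<Union> G) \<le> card {1..n}" using G by (intro card_mono) (auto simp: nsets_def)
    then have cU: "real (card (\<Union> G)) \<le> real n" by simp
    define \<delta> where "\<delta> = t * real n powr (1 / real l) / 8"
    have \<delta>: "\<delta> = real (card G) / (8 * real n)"
      unfolding \<delta>_def cG using n by (simp add: powr_add)
    define M where "M = fingerprint l r t (real n)"
    obtain D d dd S \<theta> where D: "1 \<le> D"
      and \<theta>: "0 < \<theta>" "\<theta> ^ (2 * l - 1) * real n \<le> 1" "\<theta> ^ (l - 1) * (real n * (D / \<delta>)) \<le> 1"
         "4 * (real (2 * l))\<^sup>2 * c1 * D \<le> \<theta> * \<delta>"
      and d: "0 < d" "(real (r - 2) * d) ^ (r - 2) * (2 * real (r\<^sup>2)) \<le> D"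
         "16 * (real (2 * l))\<^sup>2 * c2 \<le> dd"  "dd * (4 * real (r\<^sup>2)) = d"
      and S: "1 \<le> S" "4 * real (2 * l) * c1 * 2 ^ (2 * l + 1) * S \<le> \<theta> * \<delta>"
         "4 * real (2 * l) * c2 * 2 ^ (2 * l + 1) * (S / (dd * D)) \<le> 1"
         "4 * real (2 * l) * c2 * 2 ^ (2 * l + 1) * ((S / (dd * D)) ^ (2 * l - 1) * dd) \<le> 1"
      and fp: "real (card G) / S \<le> Cp * M"
      using par[OF t n1, folded \<delta>_def cG M_def] by (elim exE conjE) (rule that)
    obtain \<mu> where \<mu>: "uniform_weight (2 * l) G \<mu>" "\<forall>A. \<mu> A \<noteq> 0 \<longrightarrow> A \<in> berge_cycles r (2 * l)"
       "0 < wdeg G \<mu> {}" "spread G (4 * real (2 * l)) (1 / S) \<mu>"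
      using supersaturation[OF fG G0 Gr r l cU D \<delta> c1_def c2_def \<theta> d S] by blast
    have "has_containers G \<mu> \<epsilon> K' (1 / S)"
      using cont[OF fG G0 _ _ \<mu>(1,3,4)] S(1) by simp
    then show ?thesis
      unfolding has_containers_def
    proof (rule covered_mono)
      fix I :: "nat set set" assume "berge_free r (2 * l) I"
      then show "edge_free \<mu> I" using \<mu>(2) unfolding berge_free_def edge_free_def by blast
    next
      show "(1 - \<epsilon>) * real (card G) \<le> (1 - min \<epsilon> 1) * real (card G)" by (intro mult_right_mono) auto
    next
      have M1: "1 \<le> M"
      proof -
        have "1 \<le> real n powr (1 + 1 / (2 * real l - 1))" using n l by (intro ge_one_powr_ge_zero) auto
        then show ?thesis unfolding M_def fingerprint_def by simp
      qed
      \<comment> \<open>The base |G| + 1 of the container count is at most n^(r + 1), where one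
        factor n absorbs the 2. This is the source of the factor ln n in the exponent.\<close>
      have "card G \<le> n ^ r" using card_mono[OF fX G] card_nsets_le[of n r] by linarith
      moreover have "1 \<le> n ^ r" using n by simp
      ultimately have "card G + 1 \<le> 2 * n ^ r" by linarith
      also have "\<dots> \<le> n * n ^ r" using n by (intro mult_right_mono) auto
      finally have "real (card G + 1) \<le> real (n ^ (r + 1))" by (simp only: of_nat_le_iff power_Suc add_0_right Suc_eq_plus1[symmetric])
      then have cG1: "real (card G) + 1 \<le> real n powr real (r + 1)" using n powr_realpow[of "real n" "r + 1"] by simp
      have ex: "K' * (1 / S * real (card G) + 1) \<le> K' * ((Cp + 1) * M)"
        using fp M1 K' by (intro mult_left_mono) (auto simp: algebra_simps)
      have "(real (card G) + 1) powr (K' * (1 / S * real (card G) + 1)) \<le> (real n powr real (r + 1)) powr (K' * (1 / S * real (card G) + 1))"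
        using cG1 K' S by (intro powr_mono2) auto
      also have "\<dots> \<le> (real n powr real (r + 1)) powr (K' * ((Cp + 1) * M))"
        using ex n by (intro powr_mono ge_one_powr_ge_zero) auto
      also have "\<dots> = exp (C * ln (real n) * M)"
        using n by (simp add: powr_powr powr_def C_def mult_ac)
      finally show "(real (card G) + 1) powr (K' * (1 / S * real (card G) + 1)) \<le> exp (C * ln (real n) * fingerprint l r t (real n))"
        by (simp only: M_def)
    qed
  qed
  moreover have "0 \<le> C" unfolding C_def using K' Cp by simp
  moreover have "0 < min \<epsilon> 1" "min \<epsilon> 1 \<le> 1" using \<epsilon> by auto
  ultimately show ?thesis using K by (intro exI[of _ K] exI[of _ "min \<epsilon> 1"] exI[of _ C] conjI) auto
qed

lemma covered_trans:
  assumes "covered V P s g" and g': "0 \<le> g'"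
    and step: "\<And>U. U \<subseteq> V \<Longrightarrow> real (card U) \<le> s \<Longrightarrow> covered U P s' g'"
  shows "covered V P s' (g * g')"
  using assms(1)
proof (rule coveredE)
  fix \<C> assume C: "finite \<C>" "real (card \<C>) \<le> g" "\<And>U. U \<in> \<C> \<Longrightarrow> U \<subseteq> V" "\<And>U. U \<in> \<C> \<Longrightarrow> real (card U) \<le> s"
    "\<And>I. I \<subseteq> V \<Longrightarrow> P I \<Longrightarrow> \<exists>U\<in>\<C>. I \<subseteq> U"
  have "\<forall>U\<in>\<C>. \<exists>\<D>. finite \<D> \<and> real (card \<D>) \<le> g' \<and> (\<forall>W\<in>\<D>. W \<subseteq> U \<and> real (card W) \<le> s') \<and>
     (\<forall>I\<subseteq>U. P I \<longrightarrow> (\<exists>W\<in>\<D>. I \<subseteq> W))"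
    using step[OF C(3,4)] unfolding covered_def by blast
  then obtain \<D> where D: "\<And>U. U \<in> \<C> \<Longrightarrow> finite (\<D> U) \<and> real (card (\<D> U)) \<le> g' \<and> (\<forall>W\<in>\<D> U. W \<subseteq> U \<and> real (card W) \<le> s') \<and>
     (\<forall>I\<subseteq>U. P I \<longrightarrow> (\<exists>W\<in>\<D> U. I \<subseteq> W))" by metis
  show ?thesis
  proof (rule coveredI[of "\<Union> (\<D> ` \<C>)"])
    show "finite (\<Union> (\<D> ` \<C>))" using C D by auto
    have "real (card (\<Union> (\<D> ` \<C>))) \<le> (\<Sum>U\<in>\<C>. real (card (\<D> U)))"
      using card_UN_le[OF C(1), of \<D>] by (simp flip: of_nat_sum)
    also have "\<dots> \<le> real (card \<C>) * g'" using D by (intro sum_bounded_above) auto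
    also have "\<dots> \<le> g * g'" using C g' by (intro mult_right_mono) auto
    finally show "real (card (\<Union> (\<D> ` \<C>))) \<le> g * g'" .
    show "U \<subseteq> V \<and> real (card U) \<le> s'" if "U \<in> \<Union> (\<D> ` \<C>)" for U using that C(3) D by blast
    show "\<exists>U\<in>\<Union> (\<D> ` \<C>). I \<subseteq> U" if "I \<subseteq> V" "P I" for I
      using C(5)[OF that] D that by (meson UN_I)
  qed
qed

text \<open>A graph with at most \<open>T\<close> edges is its own container; any other is replaced
  by at most exp Q smaller ones. The cost \<open>Q\<close> is uniform over all sizes above
  \<open>T\<close>, so m rounds multiply to exp (m Q).\<close>

lemma covered_iterate:
  assumes X: "finite X" and \<epsilon>: "\<epsilon> \<le> 1" and Q: "0 \<le> Q"
    and step: "\<And>G. G \<subseteq> X \<Longrightarrow> T < real (card G) \<Longrightarrow> covered G P ((1 - \<epsilon>) * real (card G)) (exp Q)"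
    and G: "G \<subseteq> X" "(1 - \<epsilon>) ^ m * real (card G) \<le> T"
  shows "covered G P T (exp (real m * Q))"
  using G
proof (induction m arbitrary: G)
  case 0
  then show ?case by (intro coveredI[of "{G}"]) auto
next
  case (Suc m)
  show ?case
  proof (cases "T < real (card G)")
    case False
    then show ?thesis using Q by (intro coveredI[of "{G}"]) auto
  next
    case True
    have "covered G P T (exp Q * exp (real m * Q))"
    proof (rule covered_trans[OF step[OF Suc.prems(1) True]])
      fix U assume U: "U \<subseteq> G" "real (card U) \<le> (1 - \<epsilon>) * real (card G)"
      have "(1 - \<epsilon>) ^ m * real (card U) \<le> (1 - \<epsilon>) ^ m * ((1 - \<epsilon>) * real (card G))"
        using U \<epsilon> by (intro mult_left_mono) auto
      also have "\<dots> \<le> T" using Suc.prems(2) by (simp add: mult_ac)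
      finally show "covered U P T (exp (real m * Q))" using Suc.IH U(1) Suc.prems(1) by blast
    qed simp
    then show ?thesis by (simp add: distrib_right exp_add)
  qed
qed

theorem theorem5p3:
  fixes l r :: nat
  assumes "l \<ge> 2" and "r \<ge> 3"
  shows "\<exists>c>0. \<exists>K>0. \<forall>\<^sub>F n::nat in sequentially. \<forall>t::real. t \<ge> K * ln (real n) ^ (r - 2) \<longrightarrow>
    (\<exists>C :: nat set set set.
       (\<forall>G\<in>C. r_graph_on r {1..n} G) \<and>
       real (card C) \<le> exp (c * ln (real n) ^ (2 * r - 3) *
         max ((t / ln (real n) ^ (r - 2)) powr
                (- ((2 * real l - 2) /
                    (2 * (real r - 1) * real l ^ 2 - (real r + 2) * real l + 2)))
              * real n powr (1 + 1 / real l))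
             (ln (real n) * real n powr (1 + 1 / (2 * real l - 1)))) \<and>
       (\<forall>G\<in>C. real (card G) \<le> t * real n powr (1 + 1 / real l)) \<and>
       (\<forall>H. r_graph_on r {1..n} H \<and> berge_free r (2 * l) H \<longrightarrow> (\<exists>G\<in>C. H \<subseteq> G)))"
proof -
  obtain K \<epsilon> C where K: "1 \<le> K" and \<epsilon>: "0 < \<epsilon>" "\<epsilon> \<le> 1" and C: "0 \<le> C"
    and step: "\<forall>n\<ge>3. \<forall>t G. K \<le> t \<longrightarrow> G \<subseteq> nsets {1..n} r \<longrightarrow>
     real (card G) = t * real n powr (1 + 1 / real l) \<longrightarrow>
     covered G (berge_free r (2 * l)) ((1 - \<epsilon>) * real (card G)) (exp (C * ln (real n) * fingerprint l r t (real n)))"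
    using container_step[OF assms] by (elim exE conjE) (rule that)
  \<comment> \<open>r / \<epsilon> + 1 bounds the number of rounds per ln n; the final 1 keeps
    \<open>c\<close> positive when C = 0.\<close>
  define c where "c = (real r / \<epsilon> + 1) * C + 1"
  have c: "0 < c" unfolding c_def using \<epsilon> C by (intro add_nonneg_pos mult_nonneg_nonneg) auto
  have goal: "covered (nsets {1..n} r) (berge_free r (2 * l)) (t * real n powr (1 + 1 / real l))
       (exp (c * ln (real n) ^ (2 * r - 3) *
         max ((t / ln (real n) ^ (r - 2)) powr (- rate l r) * real n powr (1 + 1 / real l))
             (ln (real n) * real n powr (1 + 1 / (2 * real l - 1)))))"
    (is "covered ?X ?P ?T (exp (_ * _ * ?M))")
    if n: "3 \<le> n" and t: "K * ln (real n) ^ (r - 2) \<le> t" for n t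
  proof -
    define N where "N = real n powr (1 + 1 / real l)"
    have N: "1 \<le> N" unfolding N_def using n by (intro ge_one_powr_ge_zero) auto
    have "exp 1 \<le> real n" using exp_le n by linarith
    then have ln1: "1 \<le> ln (real n)" using n by (simp add: ln_ge_iff)
    define L where "L = ln (real n) ^ (r - 2)"
    have L: "1 \<le> L" unfolding L_def using ln1 by (rule one_le_power)
    have "K * 1 \<le> K * L" using K L by (intro mult_left_mono) auto
    then have tK: "K \<le> t" using t by (simp add: L_def)
    define F where "F = fingerprint l r t (real n)"
    have F0: "0 \<le> F" unfolding F_def fingerprint_def by (simp add: le_max_iff_disj)
    define Q where "Q = C * ln (real n) * F"
    have Q0: "0 \<le> Q" unfolding Q_def using C F0 ln1 by simp
    \<comment> \<open>Enough rounds for (1 - \<epsilon>)^m \<le> n^(-r), which brings the at most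
      n^r edges of the complete r-graph down to at most 1 and hence to the target.\<close>
    define m where "m = nat \<lceil>real r * ln (real n) / \<epsilon>\<rceil>"
    have a0: "0 \<le> real r * ln (real n) / \<epsilon>" using \<epsilon> ln1 by simp
    have m1: "real r * ln (real n) / \<epsilon> \<le> real m" unfolding m_def by linarith
    have "real m \<le> real r * ln (real n) / \<epsilon> + 1" unfolding m_def using a0 by linarith
    also have "\<dots> \<le> (real r / \<epsilon> + 1) * ln (real n)" using ln1 by (simp add: algebra_simps)
    finally have m2: "real m \<le> (real r / \<epsilon> + 1) * ln (real n)" .
    have fX: "finite ?X" by (simp add: finite_imp_finite_nsets)
    have "covered ?X ?P ?T (exp (real m * Q))"
    proof (rule covered_iterate[OF fX \<epsilon>(2) Q0])
      fix G assume G: "G \<subseteq> ?X" "?T < real (card G)"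
      \<comment> \<open>Above the target size the current density \<open>t'\<close> is at least t,
        so the round is available and costs at most \<open>Q\<close>.\<close>
      define t' where "t' = real (card G) / N"
      have tt: "t \<le> t'" unfolding t'_def using G(2)[folded N_def] N by (simp add: pos_le_divide_eq)
      have "covered G ?P ((1 - \<epsilon>) * real (card G)) (exp (C * ln (real n) * fingerprint l r t' (real n)))"
        using N tt tK by (intro step[rule_format, OF n _ G(1)]) (auto simp: t'_def N_def)
      then show "covered G ?P ((1 - \<epsilon>) * real (card G)) (exp Q)"
      proof (rule covered_mono)
        have "fingerprint l r t' (real n) \<le> F"
          unfolding F_def using tt tK K by (intro fingerprint_antimono[OF assms]) auto
        then show "exp (C * ln (real n) * fingerprint l r t' (real n)) \<le> exp Q"
          unfolding Q_def using C ln1 by (simp add: mult_left_mono)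
      qed auto
    next
      have "(1 - \<epsilon>) ^ m \<le> exp (- \<epsilon>) ^ m" using \<epsilon> exp_ge_add_one_self[of "- \<epsilon>"] by (intro power_mono) auto
      also have "\<dots> = exp (- (\<epsilon> * real m))" by (simp flip: exp_of_nat_mult add: mult_ac)
      also have "\<dots> \<le> exp (- (real r * ln (real n)))" using m1 \<epsilon> by (simp add: field_simps)
      also have "\<dots> = 1 / real n ^ r" using n by (simp add: exp_minus exp_of_nat_mult divide_inverse)
      finally have "(1 - \<epsilon>) ^ m * real (card ?X) \<le> 1 / real n ^ r * real (n ^ r)"
        using card_nsets_le[of n r] by (intro mult_mono) (simp_all only: of_nat_le_iff zero_le_divide_iff of_nat_0_le_iff zero_le_power, auto)
      also have "\<dots> \<le> 1 * 1" using n by simp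
      also have "\<dots> \<le> ?T" using tK K N unfolding N_def[symmetric] by (intro mult_mono) auto
      finally show "(1 - \<epsilon>) ^ m * real (card ?X) \<le> ?T" .
    qed simp
    then show ?thesis
    proof (rule covered_mono)
      \<comment> \<open>Dividing t by L \<ge> 1 enlarges the negative power, and multiplying by ln n
        \<ge> 1 enlarges the other term.\<close>
      have "F \<le> ?M"
        unfolding F_def fingerprint_def
      proof (rule max.mono)
        have "t / L \<le> t" using L tK K by (simp add: divide_le_eq)
        moreover have "0 < t / L" using L tK K by simp
        ultimately show "t powr - rate l r * real n powr (1 + 1 / real l) \<le> (t / ln (real n) ^ (r - 2)) powr - rate l r * real n powr (1 + 1 / real l)"
          unfolding L_def[symmetric] using rate_pos[OF assms] by (intro mult_right_mono powr_mono2') auto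
        show "real n powr (1 + 1 / (2 * real l - 1)) \<le> ln (real n) * real n powr (1 + 1 / (2 * real l - 1))"
          using ln1 mult_right_mono[of 1 "ln (real n)" "real n powr (1 + 1 / (2 * real l - 1))"] by simp
      qed
      \<comment> \<open>Two logarithms have accumulated, one from the number of rounds and one from
        the base of the container count. As 2 \<le> 2 r - 3 and ln n \<ge> 1, the stated power of ln
        n covers them.\<close>
      have "real m * Q \<le> ((real r / \<epsilon> + 1) * ln (real n)) * Q" using m2 Q0 by (intro mult_right_mono)
      also have "\<dots> = (c - 1) * (ln (real n) ^ 2 * F)" by (simp add: Q_def c_def power2_eq_square)
      also have "\<dots> \<le> c * (ln (real n) ^ (2 * r - 3) * ?M)"
        using c C \<epsilon> F0 ln1 \<open>F \<le> ?M\<close> assms(2) by (intro mult_mono power_increasing) (auto simp: c_def)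
      finally show "exp (real m * Q) \<le> exp (c * ln (real n) ^ (2 * r - 3) * ?M)" by (simp add: mult.assoc)
    qed auto
  qed
  have K0: "0 < K" using K by simp
  show ?thesis
    unfolding rate_def[symmetric]
  proof (rule exI[of _ c], rule conjI[OF c], rule exI[of _ K], rule conjI[OF K0],
      rule eventually_mono[OF eventually_ge_at_top[of "3::nat"]], intro allI impI)
    fix n :: nat and t :: real
    assume n: "3 \<le> n" and t: "K * ln (real n) ^ (r - 2) \<le> t"
    show "\<exists>C :: nat set set set.
       (\<forall>G\<in>C. r_graph_on r {1..n} G) \<and>
       real (card C) \<le> exp (c * ln (real n) ^ (2 * r - 3) *
         max ((t / ln (real n) ^ (r - 2)) powr (- rate l r) * real n powr (1 + 1 / real l))
             (ln (real n) * real n powr (1 + 1 / (2 * real l - 1)))) \<and>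
       (\<forall>G\<in>C. real (card G) \<le> t * real n powr (1 + 1 / real l)) \<and>
       (\<forall>H. r_graph_on r {1..n} H \<and> berge_free r (2 * l) H \<longrightarrow> (\<exists>G\<in>C. H \<subseteq> G))"
      (is "\<exists>C. ?Q C")
      using goal[OF n t]
    proof (rule coveredE)
      fix \<C> :: "nat set set set"
      assume *: "\<And>U. U \<in> \<C> \<Longrightarrow> U \<subseteq> nsets {1..n} r" "\<And>U. U \<in> \<C> \<Longrightarrow> real (card U) \<le> t * real n powr (1 + 1 / real l)"
        "\<And>I. I \<subseteq> nsets {1..n} r \<Longrightarrow> berge_free r (2 * l) I \<Longrightarrow> \<exists>U\<in>\<C>. I \<subseteq> U"
        and card: "real (card \<C>) \<le> exp (c * ln (real n) ^ (2 * r - 3) *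
         max ((t / ln (real n) ^ (r - 2)) powr (- rate l r) * real n powr (1 + 1 / real l))
             (ln (real n) * real n powr (1 + 1 / (2 * real l - 1))))"
      have "?Q \<C>" unfolding r_graph_on_def by (intro conjI ballI allI impI card *(1,2)) (assumption+, elim conjE, rule *(3))
      then show ?thesis by (rule exI)
    qed
  qed
qed

end
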